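(* Let $Q \subset \mathbb{R}^2$ be a (non-degenerate) parallelogram with smallest interior angle $\alpha$ and side lengths $a \ge b > 0$. If $\dfrac{b}{a} \le 2\sin\alpha - 1$, then $$M_2(Q) \le M_2(S),$$ where $S$ is a square and $M_2(\Omega) = \mu_2(\Omega)\,p(\Omega)^2$.
   Context: For a bounded planar domain $\Omega$ with sufficiently regular boundary (in particular, the interior of a convex polygon), the Neumann spectrum of the Laplacian on $\Omega$ is discrete. Its Neumann eigenvalues (for $-\Delta u = \mu u$ in $\Omega$ with $\partial u/\partial n = 0$ on $\partial\Omega$, understood in the weak sense) are listed with multiplicity as $0 = \mu_1(\Omega) < \mu_2(\Omega) \le \mu_3(\Omega) \le \dots$. The first eigenvalue $\mu_1(\Omega)=0$ corresponds to constant functions, so $\mu_2(\Omega)$ is the first non-zero Neumann eigenvalue. Equivalently, $$\mu_2(\Omega) = \min\left\{ \frac{\int_\Omega |\nabla u|^2\,dx\,dy}{\int_\Omega u^2\,dx\,dy} : u \in H^1(\Omega),\ u \ne 0,\ \int_\Omega u\,dx\,dy = 0 \right\}.$$ For a polygon, $\mu_2$ denotes this quantity for its interior. $p(\Omega)$ denotes the perimeter of $\Omega$ (the length of its boundary), and $M_2(\Omega) = \mu_2(\Omega)\,p(\Omega)^2$ is the normalized eigenvalue. $M_2$ is invariant under homotheties, so $M_2(S)$ does not depend on the choice of the square $S$. *)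

theory Defs
  imports "HOL-Analysis.Analysis"
begin

type_synonym point = "real \<times> real"


section \<open>The Neumann spectrum of a planar domain\<close>

definition square_integrable_on :: "(point \<Rightarrow> 'b::euclidean_space) \<Rightarrow> point set \<Rightarrow> bool" where
  "square_integrable_on f \<Omega> \<longleftrightarrow>
     set_borel_measurable lborel \<Omega> f \<and> set_integrable lborel \<Omega> (\<lambda>x. (norm (f x))\<^sup>2)"

text \<open>
  Weak derivatives are tested against continuously differentiable functions with compact support
  in the domain, as in Gilbarg and Trudinger; for \<open>L\<^sup>2\<close> functions this
  is equivalent, by mollification, to testing against smooth functions with compact support.
\<close>

definition test_function :: "point set \<Rightarrow> (point \<Rightarrow> real) \<Rightarrow> (point \<Rightarrow> point) \<Rightarrow> bool" where
  "test_function \<Omega> \<phi> D\<phi> \<longleftrightarrow>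
     (\<forall>x. GDERIV \<phi> x :> D\<phi> x) \<and> continuous_on UNIV D\<phi> \<and>
     (\<exists>K. compact K \<and> K \<subseteq> \<Omega> \<and> (\<forall>x. x \<notin> K \<longrightarrow> \<phi> x = 0))"

text \<open>
  \<open>H1_function \<Omega> u g\<close> says that \<open>u\<close> belongs to \<open>H\<^sup>1(\<Omega>)\<close> and that \<open>g\<close> represents its weak gradient,
  which is unique up to null sets.
\<close>

definition H1_function :: "point set \<Rightarrow> (point \<Rightarrow> real) \<Rightarrow> (point \<Rightarrow> point) \<Rightarrow> bool" where
  "H1_function \<Omega> u g \<longleftrightarrow>
     square_integrable_on u \<Omega> \<and> square_integrable_on g \<Omega> \<and>
     (\<forall>\<phi> D\<phi>. test_function \<Omega> \<phi> D\<phi> \<longrightarrow>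
        (LINT x:\<Omega>|lborel. u x *\<^sub>R D\<phi> x) = - (LINT x:\<Omega>|lborel. \<phi> x *\<^sub>R g x))"

text \<open>
  Weak form of \<open>-\<Delta>u = \<mu>u\<close> in \<open>\<Omega>\<close> with vanishing normal derivative on the boundary: the boundary
  condition is encoded by letting \<open>v\<close> range over all of \<open>H\<^sup>1(\<Omega>)\<close>. The zero function is not excluded
  here; it is excluded by the independence requirement below.
\<close>

definition weak_Neumann_solution :: "point set \<Rightarrow> real \<Rightarrow> (point \<Rightarrow> real) \<Rightarrow> bool" where
  "weak_Neumann_solution \<Omega> \<mu> u \<longleftrightarrow>
     (\<exists>g. H1_function \<Omega> u g \<and>
        (\<forall>v h. H1_function \<Omega> v h \<longrightarrow>
           (LINT x:\<Omega>|lborel. g x \<bullet> h x) = \<mu> * (LINT x:\<Omega>|lborel. u x * v x)))"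

text \<open>Linear independence modulo equality almost everywhere on \<open>\<Omega>\<close>.\<close>

definition ae_independent :: "point set \<Rightarrow> nat \<Rightarrow> (nat \<Rightarrow> point \<Rightarrow> real) \<Rightarrow> bool" where
  "ae_independent \<Omega> k u \<longleftrightarrow>
     (\<forall>c. (AE x in lborel. x \<in> \<Omega> \<longrightarrow> (\<Sum>i<k. c i * u i x) = 0) \<longrightarrow> (\<forall>i<k. c i = 0))"

text \<open>
  The eigenvalues are listed in increasing order with multiplicity, starting at \<open>k = 1\<close> with the
  eigenvalue \<open>0\<close> of the constants: the \<open>k\<close>-th one is the least \<open>\<Lambda>\<close> such that the eigenvalues
  up to \<open>\<Lambda>\<close> have total multiplicity at least \<open>k\<close>. When the spectrum is discrete, the infimum is a
  minimum.
\<close>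

definition Neumann_eigenvalue :: "nat \<Rightarrow> point set \<Rightarrow> real" where
  "Neumann_eigenvalue k \<Omega> =
     Inf {\<Lambda>. \<exists>u \<mu>. ae_independent \<Omega> k u \<and>
                 (\<forall>i<k. weak_Neumann_solution \<Omega> (\<mu> i) (u i) \<and> \<mu> i \<le> \<Lambda>)}"


section \<open>Convex polygons, given by their vertices in cyclic order\<close>

definition polygon_perimeter :: "point list \<Rightarrow> real" where
  "polygon_perimeter vs = (\<Sum>i<length vs. dist (vs ! i) (vs ! (Suc i mod length vs)))"

definition M2 :: "point list \<Rightarrow> real" where
  "M2 vs = Neumann_eigenvalue 2 (interior (convex hull (set vs))) * (polygon_perimeter vs)\<^sup>2"

text \<open>The angle at \<open>B\<close> between the segments \<open>BA\<close> and \<open>BC\<close>, in \<open>[0, \<pi>]\<close>.\<close>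

definition angle_at :: "point \<Rightarrow> point \<Rightarrow> point \<Rightarrow> real" where
  "angle_at A B C = arccos (((A - B) \<bullet> (C - B)) / (norm (A - B) * norm (C - B)))"

definition parallelogram :: "point \<Rightarrow> point \<Rightarrow> point \<Rightarrow> point \<Rightarrow> bool" where
  "parallelogram A B C D \<longleftrightarrow> B - A = C - D \<and> \<not> collinear {A, B, D}"

definition smallest_angle :: "point \<Rightarrow> point \<Rightarrow> point \<Rightarrow> point \<Rightarrow> real" where
  "smallest_angle A B C D =
     Min {angle_at D A B, angle_at A B C, angle_at B C D, angle_at C D A}"

definition is_square :: "point \<Rightarrow> point \<Rightarrow> point \<Rightarrow> point \<Rightarrow> bool" where
  "is_square A B C D \<longleftrightarrow>
     parallelogram A B C D \<and> dist A B = dist B C \<and> angle_at D A B = pi / 2"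

end

theory Submission
  imports Defs "HOL-Complex_Analysis.Great_Picard"
begin

text \<open>
  Upper bound: if \<open>s\<close> is the affine coordinate that runs from \<open>0\<close> to \<open>1\<close> along the side of length \<open>a\<close>,
  then \<open>cos (\<pi> s)\<close> has mean zero and Rayleigh quotient \<open>\<pi>\<^sup>2 / (a sin \<alpha>)\<^sup>2\<close>. The hypothesis says that
  \<open>a + b \<le> 2 a sin \<alpha>\<close>, so the normalised eigenvalue is at most \<open>16 \<pi>\<^sup>2\<close>, its value for the square.

  As eigenvalues are defined through weak solutions, the variational principle has to be proved, that is, a
  minimiser of the Rayleigh quotient has to be found. An affine map transports the problem to the unit
  square with a constant-coefficient quadratic form of the gradient. There the coefficients of an
  \<open>H\<^sup>1\<close> function in the cosine basis and those of its weak gradient in the mixed sine-cosine bases are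
  related by integration by parts, since the test fields are tangential at the boundary. Bessel's and
  Parseval's theorems then bound the tail of the cosine expansion by the Dirichlet energy. This is at
  the same time the compactness needed for the minimiser and the sharp Poincare inequality
  that gives the lower bound for the square.
\<close>

section \<open>Square-integrable functions\<close>

text \<open>The two sides of the inequality need different halves of the spectral theory. For Q one
  eigenfunction below the trial value, next to the constants, is enough, but it must be a genuine
  weak solution: the infimum runs over eigenvalues of weak solutions, so a trial function alone
  bounds nothing. For a square of side s it is enough that every weak solution with eigenvalue below
  pi^2 / s^2 is constant, because two constants are dependent; 16 pi^2 is this threshold times (4
  s)^2.

  The obstacle is the boundary. An H1 function is tested only against functions with compact support
  in the open domain, and neither traces nor approximation by functions smooth up to the boundary
  are used. The sine factors vanish to first order on exactly those edges where a boundary term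
  would arise, and this allows the cutoffs to be removed in the limit.

  Geometrically, a sin \<alpha> is the distance between the two sides of length b. Only the sine of
  the angle enters, and it is the same at all four vertices.\<close>

definition L2 :: "'a measure \<Rightarrow> ('a \<Rightarrow> 'b::euclidean_space) \<Rightarrow> bool" where
  "L2 M f \<longleftrightarrow> f \<in> borel_measurable M \<and> integrable M (\<lambda>x. (norm (f x))\<^sup>2)"

lemma L2_measurable: "L2 M f \<Longrightarrow> f \<in> borel_measurable M"
  by (simp add: L2_def)

lemma L2_integrable_sq: "L2 M f \<Longrightarrow> integrable M (\<lambda>x. (norm (f x))\<^sup>2)"
  by (simp add: L2_def)

lemma L2_integrable_inner:
  assumes f: "L2 M f" and g: "L2 M g"
  shows "integrable M (\<lambda>x. f x \<bullet> g x)"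
proof -
  have [measurable]: "f \<in> borel_measurable M" "g \<in> borel_measurable M"
    using f g by (simp_all add: L2_def)
  have "\<bar>f x \<bullet> g x\<bar> \<le> (norm (f x))\<^sup>2 + (norm (g x))\<^sup>2" for x
  proof -
    have "\<bar>f x \<bullet> g x\<bar> \<le> norm (f x) * norm (g x)" by (rule Cauchy_Schwarz_ineq2)
    also have "\<dots> \<le> (norm (f x))\<^sup>2 + (norm (g x))\<^sup>2"
      using sum_squares_bound[of "norm (f x)" "norm (g x)"]
        mult_nonneg_nonneg[OF norm_ge_zero norm_ge_zero, of "f x" "g x"]
      unfolding mult.assoc by linarith
    finally show ?thesis .
  qed
  then show ?thesis
    using L2_integrable_sq[OF f] L2_integrable_sq[OF g]
    by (intro Bochner_Integration.integrable_bound
        [where g = "\<lambda>x. f x \<bullet> g x" and f = "\<lambda>x. (norm (f x))\<^sup>2 + (norm (g x))\<^sup>2"]) auto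
qed

lemma L2_integrable_mult:
  fixes f g :: "'a \<Rightarrow> real"
  shows "L2 M f \<Longrightarrow> L2 M g \<Longrightarrow> integrable M (\<lambda>x. f x * g x)"
  using L2_integrable_inner[of M f g] by simp

lemma L2_integrable_scaleR:
  fixes u :: "'a \<Rightarrow> real" and g :: "'a \<Rightarrow> 'b::euclidean_space"
  assumes u: "L2 M u" and g: "L2 M g"
  shows "integrable M (\<lambda>x. u x *\<^sub>R g x)"
proof -
  have [measurable]: "u \<in> borel_measurable M" "g \<in> borel_measurable M"
    using u g by (simp_all add: L2_def)
  have n: "L2 M (\<lambda>x. norm (u x))" "L2 M (\<lambda>x. norm (g x))"
    using u g by (auto simp: L2_def)
  show ?thesis
    by (rule Bochner_Integration.integrable_bound[OF L2_integrable_mult[OF n]]) auto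
qed

lemma L2_add:
  assumes f: "L2 M f" and g: "L2 M g"
  shows "L2 M (\<lambda>x. f x + g x)"
proof -
  have "(norm (f x + g x))\<^sup>2 = (norm (f x))\<^sup>2 + 2 * (f x \<bullet> g x) + (norm (g x))\<^sup>2" for x
    by (simp add: power2_norm_eq_inner inner_commute algebra_simps)
  then show ?thesis
    using f g L2_integrable_inner[OF f g] by (auto simp: L2_def)
qed

lemma L2_linear:
  fixes h :: "'b::euclidean_space \<Rightarrow> 'c::euclidean_space"
  assumes f: "L2 M f" and h: "linear h"
  shows "L2 M (\<lambda>x. h (f x))"
proof -
  have b: "bounded_linear h" using h by (rule linear_conv_bounded_linear[THEN iffD1])
  then obtain K where K: "\<And>x. norm (h x) \<le> norm x * K"
    using bounded_linear.bounded by blast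
  have [measurable]: "f \<in> borel_measurable M" "h \<in> borel_measurable borel"
    using f b by (auto simp: L2_def intro!: borel_measurable_continuous_onI linear_continuous_on)
  have "(norm (h (f x)))\<^sup>2 \<le> K\<^sup>2 * (norm (f x))\<^sup>2" for x
    using power_mono[OF K norm_ge_zero, of "f x" 2] by (simp add: power_mult_distrib mult.commute)
  then have *: "norm ((norm (h (f x)))\<^sup>2) \<le> norm (K\<^sup>2 * (norm (f x))\<^sup>2)" for x
    by (simp add: abs_mult)
  have "integrable M (\<lambda>x. (norm (h (f x)))\<^sup>2)"
  proof (rule Bochner_Integration.integrable_bound[OF _ _ AE_I2])
    show "integrable M (\<lambda>x. K\<^sup>2 * (norm (f x))\<^sup>2)"
      using L2_integrable_sq[OF f] by simp
    show "(\<lambda>x. (norm (h (f x)))\<^sup>2) \<in> borel_measurable M" by measurable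
  qed (rule *)
  then show ?thesis by (simp add: L2_def)
qed

lemma L2_scaleR: "L2 M f \<Longrightarrow> L2 M (\<lambda>x. c *\<^sub>R f x)"
  by (erule L2_linear) (rule linear_scaleR)

lemma L2_cmult: "L2 M f \<Longrightarrow> L2 M (\<lambda>x. c * f x)" for f :: "'a \<Rightarrow> real"
  using L2_scaleR[of M f c] by simp

lemma L2_diff: "L2 M f \<Longrightarrow> L2 M g \<Longrightarrow> L2 M (\<lambda>x. f x - g x)"
  using L2_add[of M f "\<lambda>x. (-1) *\<^sub>R g x"] L2_scaleR[of M g "-1"] by simp

lemma L2_zero: "L2 M (\<lambda>x. 0)"
  by (simp add: L2_def)

lemma L2_sum: "(\<And>i. i \<in> I \<Longrightarrow> L2 M (f i)) \<Longrightarrow> L2 M (\<lambda>x. \<Sum>i\<in>I. f i x)"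
  by (induction I rule: infinite_finite_induct) (auto simp: L2_zero intro: L2_add)

lemma L2_bounded:
  assumes "finite_measure M" "f \<in> borel_measurable M" "\<And>x. x \<in> space M \<Longrightarrow> norm (f x) \<le> B"
  shows "L2 M f"
proof -
  interpret finite_measure M by fact
  have "(norm (f x))\<^sup>2 \<le> B\<^sup>2" if "x \<in> space M" for x
    using assms(3)[OF that] by (intro power_mono) auto
  then show ?thesis
    using assms(2) unfolding L2_def by (auto intro!: integrable_const_bound[where B = "B\<^sup>2"])
qed

lemma L2_integrable:
  fixes f :: "'a \<Rightarrow> 'b::euclidean_space"
  assumes "finite_measure M" "L2 M f"
  shows "integrable M f"
proof -
  interpret finite_measure M by fact
  have *: "norm (f x) \<le> 1 + (norm (f x))\<^sup>2" for x
    using sum_squares_bound[of 1 "norm (f x)"] norm_ge_zero[of "f x"]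
    unfolding power_one mult_1_right by linarith
  then show ?thesis
    using assms(2) *  unfolding L2_def
    by (intro Bochner_Integration.integrable_bound[where f = "\<lambda>x. 1 + (norm (f x))\<^sup>2" and g = f]) auto
qed

text \<open>Functions are not identified modulo null sets, so this is the square of a seminorm;
  keeping the square avoids roots in the estimates.\<close>

definition nsq :: "'a measure \<Rightarrow> ('a \<Rightarrow> 'b::euclidean_space) \<Rightarrow> real" where
  "nsq M f = (LINT x|M. (norm (f x))\<^sup>2)"

definition ip :: "'a measure \<Rightarrow> ('a \<Rightarrow> 'b::euclidean_space) \<Rightarrow> ('a \<Rightarrow> 'b) \<Rightarrow> real" where
  "ip M f g = (LINT x|M. f x \<bullet> g x)"

lemma nsq_nonneg: "0 \<le> nsq M f"
  by (simp add: nsq_def)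

lemma nsq_eq_ip: "nsq M f = ip M f f"
  by (simp add: nsq_def ip_def power2_norm_eq_inner)

lemma ip_commute: "ip M f g = ip M g f"
  by (simp add: ip_def inner_commute)

lemma ip_add_right:
  "L2 M f \<Longrightarrow> L2 M g \<Longrightarrow> L2 M h \<Longrightarrow> ip M f (\<lambda>x. g x + h x) = ip M f g + ip M f h"
  unfolding ip_def inner_add_right
  by (intro Bochner_Integration.integral_add L2_integrable_inner)

lemma ip_diff_right:
  "L2 M f \<Longrightarrow> L2 M g \<Longrightarrow> L2 M h \<Longrightarrow> ip M f (\<lambda>x. g x - h x) = ip M f g - ip M f h"
  unfolding ip_def inner_diff_right
  by (intro Bochner_Integration.integral_diff L2_integrable_inner)

lemma ip_scaleR_right: "ip M f (\<lambda>x. c *\<^sub>R g x) = c * ip M f g"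
  by (simp add: ip_def)

lemma nsq_add:
  assumes f: "L2 M f" and g: "L2 M g"
  shows "nsq M (\<lambda>x. f x + g x) = nsq M f + 2 * ip M f g + nsq M g"
proof -
  have "nsq M (\<lambda>x. f x + g x) = ip M (\<lambda>x. f x + g x) f + ip M (\<lambda>x. f x + g x) g"
    unfolding nsq_eq_ip using assms by (intro ip_add_right L2_add)
  also have "\<dots> = ip M f (\<lambda>x. f x + g x) + ip M g (\<lambda>x. f x + g x)"
    by (simp add: ip_commute)
  also have "\<dots> = nsq M f + 2 * ip M f g + nsq M g"
    using assms by (simp add: ip_add_right nsq_eq_ip ip_commute[of M g f])
  finally show ?thesis .
qed

lemma nsq_scaleR: "nsq M (\<lambda>x. c *\<^sub>R f x) = c\<^sup>2 * nsq M f"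
  by (simp add: nsq_def power_mult_distrib)

lemma nsq_diff:
  assumes f: "L2 M f" and g: "L2 M g"
  shows "nsq M (\<lambda>x. f x - g x) = nsq M f - 2 * ip M f g + nsq M g"
  using nsq_add[OF f L2_scaleR[OF g, of "-1"]] nsq_scaleR[of M "-1" g]
  by (simp add: ip_scaleR_right[of M f "-1" g, simplified])

lemma nsq_diff_swap: "nsq M (\<lambda>x. f x - g x) = nsq M (\<lambda>x. g x - f x)"
  by (simp add: nsq_def norm_minus_commute)

text \<open>The squared norm of f + t g is a nonnegative polynomial in t. When its quadratic term
  vanishes, the linear term has to vanish as well, hence the case distinction.\<close>

lemma ip_Cauchy_Schwarz:
  assumes f: "L2 M f" and g: "L2 M g"
  shows "(ip M f g)\<^sup>2 \<le> nsq M f * nsq M g"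
proof -
  have *: "0 \<le> nsq M f + 2 * t * ip M f g + t\<^sup>2 * nsq M g" for t
    using nsq_nonneg[of M "\<lambda>x. f x + t *\<^sub>R g x"] nsq_add[OF f L2_scaleR[OF g, of t]]
    by (simp add: ip_scaleR_right nsq_scaleR)
  show ?thesis
  proof (cases "nsq M g = 0")
    case True
    have "ip M f g = 0"
    proof (rule ccontr)
      assume "ip M f g \<noteq> 0"
      then show False
        \<comment> \<open>At this t the polynomial without quadratic term takes the value
          -1.\<close>
        using *[of "- (nsq M f + 1) / (2 * ip M f g)"] True by (simp add: field_simps)
    qed
    then show ?thesis by (simp add: True)
  next
    case False
    then have pos: "nsq M g > 0" using nsq_nonneg[of M g] by simp
    have "0 \<le> nsq M f - (ip M f g)\<^sup>2 / nsq M g"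
      \<comment> \<open>The minimiser of the quadratic polynomial.\<close>
      using *[of "- ip M f g / nsq M g"] pos by (simp add: power2_eq_square field_simps)
    then show ?thesis using pos by (simp add: field_simps)
  qed
qed

lemma tendsto_ip:
  assumes f: "\<And>n. L2 M (f n)" and g: "L2 M g" and h: "L2 M h"
    and lim: "(\<lambda>n. nsq M (\<lambda>x. f n x - g x)) \<longlonglongrightarrow> 0"
  shows "(\<lambda>n. ip M h (f n)) \<longlonglongrightarrow> ip M h g"
proof -
  have "(\<lambda>n. (ip M h (f n) - ip M h g)\<^sup>2) \<longlonglongrightarrow> 0"
  proof (rule tendsto_sandwich[OF _ _ tendsto_const])
    show "\<forall>\<^sub>F n in sequentially. (ip M h (f n) - ip M h g)\<^sup>2 \<le> nsq M h * nsq M (\<lambda>x. f n x - g x)"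
      using ip_Cauchy_Schwarz[OF h L2_diff[OF f g]] ip_diff_right[OF h f g] by simp
    show "(\<lambda>n. nsq M h * nsq M (\<lambda>x. f n x - g x)) \<longlonglongrightarrow> 0"
      using tendsto_mult_left[OF lim, of "nsq M h"] by simp
  qed auto
  then have "(\<lambda>n. ip M h (f n) - ip M h g) \<longlonglongrightarrow> 0" by simp
  then show ?thesis by (simp add: LIM_zero_iff)
qed

lemma tendsto_nsq:
  assumes f: "\<And>n. L2 M (f n)" and g: "L2 M g"
    and lim: "(\<lambda>n. nsq M (\<lambda>x. f n x - g x)) \<longlonglongrightarrow> 0"
  shows "(\<lambda>n. nsq M (f n)) \<longlonglongrightarrow> nsq M g"
proof -
  have "nsq M (f n) = nsq M (\<lambda>x. f n x - g x) + 2 * ip M g (f n) - nsq M g" for n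
    using nsq_diff[OF f g, of n] by (simp add: ip_commute)
  moreover have "(\<lambda>n. nsq M (\<lambda>x. f n x - g x) + 2 * ip M g (f n) - nsq M g)
      \<longlonglongrightarrow> 0 + 2 * ip M g g - nsq M g"
    by (intro tendsto_intros lim tendsto_ip f g)
  ultimately show ?thesis by (simp add: nsq_eq_ip)
qed

lemma nsq_eq_0_AE:
  assumes "L2 M f" "nsq M f = 0"
  shows "AE x in M. f x = 0"
proof -
  have "AE x in M. (norm (f x))\<^sup>2 = 0"
    using assms integral_nonneg_eq_0_iff_AE[of M "\<lambda>x. (norm (f x))\<^sup>2"] by (auto simp: L2_def nsq_def)
  then show ?thesis by simp
qed

lemma nn_integral_L2:
  "L2 M f \<Longrightarrow> (\<integral>\<^sup>+x. ennreal ((norm (f x))\<^sup>2) \<partial>M) = ennreal (nsq M f)"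
  unfolding nsq_def by (rule nn_integral_eq_integral) (auto simp: L2_def)

text \<open>A subsequence whose increments have squared norm below 4^-k converges almost everywhere.
  Fatou's lemma along this subsequence then bounds the distance of every late \<open>f n\<close>
  from the pointwise limit.\<close>

theorem Riesz_Fischer:
  fixes f :: "nat \<Rightarrow> 'a \<Rightarrow> 'b::euclidean_space"
  assumes f: "\<And>n. L2 M (f n)"
    and cauchy: "\<And>e. e > 0 \<Longrightarrow> \<exists>N. \<forall>m\<ge>N. \<forall>n\<ge>N. nsq M (\<lambda>x. f m x - f n x) < e"
  obtains g where "L2 M g" "(\<lambda>n. nsq M (\<lambda>x. f n x - g x)) \<longlonglongrightarrow> 0"
proof -
  have [measurable]: "f n \<in> borel_measurable M" for n using f by (rule L2_measurable)
  have "\<exists>N. \<forall>k. \<forall>m\<ge>N k. \<forall>n\<ge>N k. nsq M (\<lambda>x. f m x - f n x) < (1/4)^k"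
    by (intro choice allI cauchy) simp
  then obtain N where N: "\<And>k m n. m \<ge> N k \<Longrightarrow> n \<ge> N k \<Longrightarrow> nsq M (\<lambda>x. f m x - f n x) < (1/4)^k"
    by blast
  \<comment> \<open>The sum puts both \<open>r k\<close> and \<open>r (Suc k)\<close> beyond
    \<open>N k\<close>; the summand k forces \<open>r\<close> to infinity.\<close>
  define r where "r k = (\<Sum>i\<le>k. N i) + k" for k
  have rN: "N k \<le> r k" "N k \<le> r (Suc k)" for k
  proof -
    have "N k \<le> (\<Sum>i\<le>k. N i)" by (rule member_le_sum) auto
    then show "N k \<le> r k" "N k \<le> r (Suc k)" by (simp_all add: r_def)
  qed
  define d where "d k x = f (r (Suc k)) x - f (r k) x" for k x
  have [measurable]: "d k \<in> borel_measurable M" for k unfolding d_def by measurable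
  have dL2: "L2 M (d k)" for k unfolding d_def using f by (intro L2_diff)
  have dle: "nsq M (d k) \<le> (1/4)^k" for k
    using N[OF rN(2) rN(1), of k] unfolding d_def by simp
  have "(\<integral>\<^sup>+x. (\<Sum>k. ennreal (2^k * (norm (d k x))\<^sup>2)) \<partial>M)
      = (\<Sum>k. \<integral>\<^sup>+x. ennreal (2^k * (norm (d k x))\<^sup>2) \<partial>M)"
    by (rule nn_integral_suminf) measurable
  also have "\<dots> = (\<Sum>k. ennreal (2^k * nsq M (d k)))"
    using nn_integral_L2[OF dL2] by (simp add: ennreal_mult nn_integral_cmult nsq_nonneg)
  also have "\<dots> \<le> (\<Sum>k. ennreal ((1/2)^k))"
  proof (intro suminf_le ennreal_leI)
    fix k :: nat
    have "2^k * nsq M (d k) \<le> 2^k * (1/4)^k" using dle by simp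
    also have "\<dots> = (1/2)^k" by (simp flip: power_mult_distrib)
    finally show "2^k * nsq M (d k) \<le> (1/2)^k" .
  qed auto
  also have "\<dots> = ennreal (\<Sum>k. (1/2)^k)"
    by (rule suminf_ennreal2) (auto simp: complete_algebra_summable_geometric)
  finally have fin: "(\<integral>\<^sup>+x. (\<Sum>k. ennreal (2^k * (norm (d k x))\<^sup>2)) \<partial>M) \<noteq> \<infinity>"
    by (auto simp: top_unique)
  have "AE x in M. (\<Sum>k. ennreal (2^k * (norm (d k x))\<^sup>2)) \<noteq> \<infinity>"
    by (rule nn_integral_PInf_AE[OF _ fin]) measurable
  then have conv: "AE x in M. (\<lambda>k. f (r k) x) \<longlonglongrightarrow> lim (\<lambda>k. f (r k) x)"
  proof eventually_elim
    case (elim x)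
    then have "summable (\<lambda>k. 2^k * (norm (d k x))\<^sup>2)"
      by (intro summable_suminf_not_top) auto
    then have "summable (\<lambda>k. (1/2)^k + 2^k * (norm (d k x))\<^sup>2)"
      by (intro summable_add complete_algebra_summable_geometric) auto
    \<comment> \<open>The weight 2^k is a compromise: 2^k 4^-k is still summable, and 2 |d| \<le>
      2^-k + 2^k |d|^2 turns summable weighted squares into summable norms.\<close>
    then have "summable (\<lambda>k. norm (d k x))"
    proof (rule summable_comparison_test'[where N = 0])
      fix k :: nat
      have "0 \<le> (1 - 2^k * norm (d k x))\<^sup>2" by simp
      then have "2 * 2^k * norm (d k x) \<le> 1 + (2^k * norm (d k x))\<^sup>2"
        by (simp add: power2_diff)
      then have "2^k * (2 * norm (d k x)) \<le> 2^k * ((1/2)^k + 2^k * (norm (d k x))\<^sup>2)"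
        by (simp add: power_mult_distrib power2_eq_square algebra_simps power_divide)
      then have "2 * norm (d k x) \<le> (1/2)^k + 2^k * (norm (d k x))\<^sup>2" by simp
      then show "norm (norm (d k x)) \<le> (1/2)^k + 2^k * (norm (d k x))\<^sup>2"
        using norm_ge_zero[of "d k x"] unfolding real_norm_def abs_norm_cancel by linarith
    qed
    then have "summable (\<lambda>k. d k x)" by (rule summable_norm_cancel)
    then have "(\<lambda>n. \<Sum>k<n. d k x) \<longlonglongrightarrow> (\<Sum>k. d k x)" by (rule summable_LIMSEQ)
    moreover have "(\<Sum>k<n. d k x) = f (r n) x - f (r 0) x" for n
      unfolding d_def by (rule sum_lessThan_telescope)
    ultimately have "(\<lambda>n. f (r n) x - f (r 0) x + f (r 0) x) \<longlonglongrightarrow> (\<Sum>k. d k x) + f (r 0) x"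
      by (intro tendsto_add) auto
    then have "(\<lambda>n. f (r n) x) \<longlonglongrightarrow> (\<Sum>k. d k x) + f (r 0) x" by simp
    then show ?case by (simp add: limI)
  qed
  define g where "g x = lim (\<lambda>k. f (r k) x)" for x
  have [measurable]: "g \<in> borel_measurable M"
    unfolding g_def by (rule borel_measurable_lim_metric) measurable
  \<comment> \<open>One application of Fatou's lemma gives both that the difference is square
    integrable and that it is small.\<close>
  have key: "L2 M (\<lambda>x. f n x - g x) \<and> nsq M (\<lambda>x. f n x - g x) \<le> e"
    if e: "e > 0" and K: "\<forall>m\<ge>K. \<forall>n\<ge>K. nsq M (\<lambda>x. f m x - f n x) < e" and n: "n \<ge> K" for e K n
  proof -
    have "(\<integral>\<^sup>+x. ennreal ((norm (f n x - g x))\<^sup>2) \<partial>M)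
        = (\<integral>\<^sup>+x. liminf (\<lambda>k. ennreal ((norm (f n x - f (r k) x))\<^sup>2)) \<partial>M)"
    proof (rule nn_integral_cong_AE, use conv in eventually_elim)
      case (elim x)
      then have "(\<lambda>k. ennreal ((norm (f n x - f (r k) x))\<^sup>2)) \<longlonglongrightarrow> ennreal ((norm (f n x - g x))\<^sup>2)"
        unfolding g_def by (intro tendsto_intros)
      then show ?case by (rule lim_imp_Liminf[symmetric, OF trivial_limit_sequentially])
    qed
    also have "\<dots> \<le> liminf (\<lambda>k. \<integral>\<^sup>+x. ennreal ((norm (f n x - f (r k) x))\<^sup>2) \<partial>M)"
      by (rule nn_integral_liminf) measurable
    also have "\<dots> \<le> ennreal e"
    proof (rule Liminf_le, simp)
      show "\<forall>\<^sub>F k in sequentially. (\<integral>\<^sup>+x. ennreal ((norm (f n x - f (r k) x))\<^sup>2) \<partial>M) \<le> ennreal e"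
        unfolding eventually_sequentially
      proof (intro exI allI impI)
        fix k assume "K \<le> k"
        then have "r k \<ge> K" unfolding r_def by simp
        then show "(\<integral>\<^sup>+x. ennreal ((norm (f n x - f (r k) x))\<^sup>2) \<partial>M) \<le> ennreal e"
          using K n nn_integral_L2[OF L2_diff[OF f f], of n "r k"] by (simp add: ennreal_leI less_imp_le)
      qed
    qed
    finally have le: "(\<integral>\<^sup>+x. ennreal ((norm (f n x - g x))\<^sup>2) \<partial>M) \<le> ennreal e" .
    then have "integrable M (\<lambda>x. (norm (f n x - g x))\<^sup>2)"
      by (intro integrableI_bounded) (auto simp: order_le_less_trans)
    then have l: "L2 M (\<lambda>x. f n x - g x)" by (simp add: L2_def)
    with le show ?thesis using e by (simp add: nn_integral_L2)
  qed
  show thesis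
  proof
    obtain K where K: "\<forall>m\<ge>K. \<forall>n\<ge>K. nsq M (\<lambda>x. f m x - f n x) < 1" using cauchy[of 1] by auto
    have "L2 M (\<lambda>x. f K x - g x)" using key[OF _ K, of K] by simp
    then show "L2 M g" using L2_diff[OF f[of K], of "\<lambda>x. f K x - g x"] by simp
    show "(\<lambda>n. nsq M (\<lambda>x. f n x - g x)) \<longlonglongrightarrow> 0"
    proof (rule LIMSEQ_I)
      fix e :: real assume e: "e > 0"
      then obtain K where K: "\<forall>m\<ge>K. \<forall>n\<ge>K. nsq M (\<lambda>x. f m x - f n x) < e/2" using cauchy[of "e/2"] by auto
      show "\<exists>K. \<forall>n\<ge>K. norm (nsq M (\<lambda>x. f n x - g x) - 0) < e"
      proof (intro exI allI impI)
        fix n assume "n \<ge> K"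
        then have "nsq M (\<lambda>x. f n x - g x) \<le> e/2" using key[OF _ K] e by simp
        then show "norm (nsq M (\<lambda>x. f n x - g x) - 0) < e"
          using e nsq_nonneg[of M "\<lambda>x. f n x - g x"] by simp
      qed
    qed
  qed
qed

section \<open>Orthonormal systems and Bessel's inequality\<close>

definition orthonormal :: "'a measure \<Rightarrow> 'i set \<Rightarrow> ('i \<Rightarrow> 'a \<Rightarrow> real) \<Rightarrow> bool" where
  "orthonormal M I e \<longleftrightarrow> (\<forall>i\<in>I. L2 M (e i)) \<and>
     (\<forall>i\<in>I. \<forall>j\<in>I. ip M (e i) (e j) = (if i = j then 1 else 0))"

lemma ip_sum_right:
  fixes f :: "'a \<Rightarrow> real" and c :: "'i \<Rightarrow> real"
  assumes "L2 M f" "\<And>i. i \<in> I \<Longrightarrow> L2 M (e i)"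
  shows "ip M f (\<lambda>x. \<Sum>i\<in>I. c i * e i x) = (\<Sum>i\<in>I. c i * ip M f (e i))"
proof (cases "finite I")
  case True
  then show ?thesis using assms(2)
  proof (induction I rule: finite_induct)
    case empty
    then show ?case by (simp add: ip_def)
  next
    case (insert i I)
    have "ip M f (\<lambda>x. c i * e i x + (\<Sum>i\<in>I. c i * e i x))
        = ip M f (\<lambda>x. c i * e i x) + ip M f (\<lambda>x. \<Sum>i\<in>I. c i * e i x)"
      using assms(1) insert by (intro ip_add_right L2_sum L2_cmult) auto
    then show ?case using insert ip_scaleR_right[of M f "c i" "e i"] by simp
  qed
qed (simp add: ip_def)

lemma nsq_orthonormal_sum:
  assumes on: "orthonormal M I e" and fin: "finite I"
  shows "nsq M (\<lambda>x. \<Sum>i\<in>I. c i * e i x) = (\<Sum>i\<in>I. (c i)\<^sup>2)"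
proof -
  have L: "\<And>i. i \<in> I \<Longrightarrow> L2 M (e i)" using on by (simp add: orthonormal_def)
  have S: "L2 M (\<lambda>x. \<Sum>i\<in>I. c i * e i x)" by (intro L2_sum L2_cmult L)
  have "ip M (\<lambda>x. \<Sum>i\<in>I. c i * e i x) (e j) = c j" if j: "j \<in> I" for j
  proof -
    have "ip M (e j) (\<lambda>x. \<Sum>i\<in>I. c i * e i x) = (\<Sum>i\<in>I. c i * ip M (e j) (e i))"
      using L j by (intro ip_sum_right)
    also have "\<dots> = (\<Sum>i\<in>I. if j = i then c i else 0)"
      using on j by (intro sum.cong) (auto simp: orthonormal_def)
    also have "\<dots> = c j" using fin j by simp
    finally show ?thesis by (simp add: ip_commute)
  qed
  then show ?thesis
    unfolding nsq_eq_ip using ip_sum_right[OF S L, where I = I and c = c] by (simp add: power2_eq_square)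
qed

text \<open>Pythagoras. Besides Bessel's inequality it gives the splitting of a norm into finitely
  many coefficients and a tail, on which the compactness argument rests.\<close>

lemma nsq_minus_projection:
  assumes on: "orthonormal M I e" and fin: "finite I" and f: "L2 M f"
  shows "nsq M (\<lambda>x. f x - (\<Sum>i\<in>I. ip M f (e i) * e i x)) = nsq M f - (\<Sum>i\<in>I. (ip M f (e i))\<^sup>2)"
proof -
  have L: "\<And>i. i \<in> I \<Longrightarrow> L2 M (e i)" using on by (simp add: orthonormal_def)
  have S: "L2 M (\<lambda>x. \<Sum>i\<in>I. ip M f (e i) * e i x)" by (intro L2_sum L2_cmult L)
  show ?thesis
    using nsq_diff[OF f S] nsq_orthonormal_sum[OF on fin] ip_sum_right[OF f L, where I = I and c = "\<lambda>i. ip M f (e i)"]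
    by (simp add: power2_eq_square)
qed

lemma Bessel:
  assumes "orthonormal M I e" "finite I" "L2 M f"
  shows "(\<Sum>i\<in>I. (ip M f (e i))\<^sup>2) \<le> nsq M f"
  using nsq_minus_projection[OF assms] nsq_nonneg[of M "\<lambda>x. f x - (\<Sum>i\<in>I. ip M f (e i) * e i x)"]
  by simp


section \<open>The cosine basis of the unit square\<close>

definition unit_square :: "point set" where
  "unit_square = {0<..<1} \<times> {0<..<1}"

text \<open>The total mass is one, so the constant mode is a unit vector and its coefficient is the
  mean value.\<close>

definition unit_measure :: "point measure" where
  "unit_measure = restrict_space lborel unit_square"

lemma open_unit_square: "open unit_square"
  unfolding unit_square_def by (intro open_Times) auto

lemma unit_square_borel [measurable, simp]: "unit_square \<in> sets borel"
  using open_unit_square by auto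

lemma space_unit_measure [simp]: "space unit_measure = unit_square"
  by (simp add: unit_measure_def space_restrict_space)

lemma measurable_unit_measure: "f \<in> borel_measurable borel \<Longrightarrow> f \<in> borel_measurable unit_measure"
  unfolding unit_measure_def by (intro measurable_restrict_space1) simp

lemma emeasure_unit_measure: "emeasure unit_measure unit_square = 1"
proof -
  have "emeasure (lborel \<Otimes>\<^sub>M lborel) unit_square = 1"
    unfolding unit_square_def by (subst lborel.emeasure_pair_measure_Times) auto
  then show ?thesis
    unfolding unit_measure_def lborel_prod by (simp add: emeasure_restrict_space)
qed

lemma finite_measure_unit_measure: "finite_measure unit_measure"
  by (intro finite_measureI) (simp add: emeasure_unit_measure)

lemma integral_unit_measure: "(LINT x|unit_measure. f x) = (LINT x:unit_square|lborel. f x)"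
  for f :: "point \<Rightarrow> 'b::euclidean_space"
  unfolding unit_measure_def set_lebesgue_integral_def by (rule integral_restrict_space) simp

lemma integrable_unit_measure: "integrable unit_measure f \<longleftrightarrow> set_integrable lborel unit_square f"
  for f :: "point \<Rightarrow> 'b::euclidean_space"
  unfolding unit_measure_def set_integrable_def by (rule integrable_restrict_space) simp

lemma square_integrable_on_iff_L2:
  assumes "S \<in> sets borel"
  shows "square_integrable_on f S \<longleftrightarrow> L2 (restrict_space lborel S) f"
  using assms unfolding square_integrable_on_def L2_def set_borel_measurable_def set_integrable_def
  by (subst borel_measurable_restrict_space_iff integrable_restrict_space, simp)+ (simp add: mult.commute)

lemma square_integrable_iff_L2: "square_integrable_on f unit_square \<longleftrightarrow> L2 unit_measure f"
  unfolding unit_measure_def by (rule square_integrable_on_iff_L2) simp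

lemma measure_unit_measure [simp]: "measure unit_measure unit_square = 1"
  using emeasure_unit_measure by (simp add: measure_def)

lemma bounded_L2_unit_measure:
  "f \<in> borel_measurable borel \<Longrightarrow> (\<And>x. x \<in> unit_square \<Longrightarrow> norm (f x) \<le> B) \<Longrightarrow> L2 unit_measure f"
  by (rule L2_bounded[OF finite_measure_unit_measure measurable_unit_measure, where B = B]) auto

lemma LINT_unit_interval:
  fixes f :: "real \<Rightarrow> real"
  assumes "continuous_on UNIV f"
  shows "integrable lborel (\<lambda>x. indicator {0<..<1} x * f x)"
    and "(LINT x|lborel. indicator {0<..<1} x * f x) = integral {0..1} f"
proof -
  have *: "set_integrable lborel {0<..<1} f"
    by (rule set_integrable_subset[OF borel_integrable_atLeastAtMost'[of 0 1]])
      (use assms in \<open>auto intro: continuous_on_subset\<close>)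
  then show "integrable lborel (\<lambda>x. indicator {0<..<1} x * f x)"
    by (simp add: set_integrable_def)
  show "(LINT x|lborel. indicator {0<..<1} x * f x) = integral {0..1} f"
    using set_borel_integral_eq_integral(2)[OF *] integral_open_interval_real[of 0 1 f]
    by (simp add: set_lebesgue_integral_def)
qed

lemma LINT_unit_measure_product:
  fixes f g :: "real \<Rightarrow> real"
  assumes f: "continuous_on UNIV f" and g: "continuous_on UNIV g"
  shows "(LINT x|unit_measure. f (fst x) * g (snd x)) = integral {0..1} f * integral {0..1} g"
proof -
  let ?i = "\<lambda>x::real. indicator {0<..<1} x :: real"
  let ?h = "\<lambda>x. (?i (fst x) * f (fst x)) * (?i (snd x) * g (snd x))"
  have [measurable]: "f \<in> borel_measurable borel" "g \<in> borel_measurable borel"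
    using f g by (simp_all add: borel_measurable_continuous_onI)
  have nf: "integrable lborel (\<lambda>x. \<bar>?i x * f x\<bar>)" and ng: "integrable lborel (\<lambda>x. \<bar>?i x * g x\<bar>)"
    using LINT_unit_interval(1)[OF f] LINT_unit_interval(1)[OF g] by (auto intro: integrable_abs)
  have int: "integrable (lborel \<Otimes>\<^sub>M lborel) ?h"
  proof (rule lborel_pair.Fubini_integrable)
    show "?h \<in> borel_measurable (lborel \<Otimes>\<^sub>M lborel)" by measurable
    show "integrable lborel (\<lambda>x. LINT y|lborel. norm (?h (x, y)))"
      using nf by (simp add: abs_mult)
    show "AE x in lborel. integrable lborel (\<lambda>y. ?h (x, y))"
      using LINT_unit_interval(1)[OF g] by simp
  qed
  have "(LINT x|unit_measure. f (fst x) * g (snd x)) = (LINT x|lborel. ?h x)"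
    unfolding integral_unit_measure set_lebesgue_integral_def
    by (intro Bochner_Integration.integral_cong) (auto simp: unit_square_def indicator_def)
  also have "\<dots> = (LINT x|lborel. LINT y|lborel. ?h (x, y))"
    using lborel_pair.integral_fst'[OF int] by (simp add: lborel_prod)
  also have "\<dots> = integral {0..1} f * integral {0..1} g"
    by (simp add: LINT_unit_interval f g)
  finally show ?thesis .
qed

definition cos_mode :: "nat \<Rightarrow> real \<Rightarrow> real" where
  "cos_mode m x = (if m = 0 then 1 else sqrt 2) * cos (m * pi * x)"

text \<open>\<open>sin_mode 0\<close> vanishes whatever its factor; sharing the factor with
  \<open>cos_mode\<close> keeps the derivative rule free of case distinctions.\<close>

definition sin_mode :: "nat \<Rightarrow> real \<Rightarrow> real" where
  "sin_mode m x = (if m = 0 then 1 else sqrt 2) * sin (m * pi * x)"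

lemma cos_mode_0 [simp]: "cos_mode 0 = (\<lambda>x. 1)"
  by (simp add: cos_mode_def fun_eq_iff)

lemma DERIV_sin_mode: "(sin_mode m has_real_derivative m * pi * cos_mode m x) (at x)"
  unfolding sin_mode_def cos_mode_def by (auto intro!: derivative_eq_intros simp: algebra_simps)

lemma continuous_cos_mode: "continuous_on A (cos_mode m)" and continuous_sin_mode: "continuous_on A (sin_mode m)"
  unfolding cos_mode_def sin_mode_def by (intro continuous_intros)+

lemma abs_cos_mode_le: "\<bar>cos_mode m x\<bar> \<le> 2" and abs_sin_mode_le: "\<bar>sin_mode m x\<bar> \<le> 2"
proof -
  have s: "sqrt 2 \<le> 2" by (simp add: real_sqrt_le_iff' )
  have "\<bar>cos_mode m x\<bar> \<le> 2 * 1" unfolding cos_mode_def abs_mult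
    by (intro mult_mono) (use s in auto)
  then show "\<bar>cos_mode m x\<bar> \<le> 2" by simp
  have "\<bar>sin_mode m x\<bar> \<le> 2 * 1" unfolding sin_mode_def abs_mult
    by (intro mult_mono) (use s in auto)
  then show "\<bar>sin_mode m x\<bar> \<le> 2" by simp
qed

text \<open>The frequency is an integer because the product-to-sum formulas produce differences m -
  n.\<close>

lemma integral_cos_int:
  fixes k :: int
  shows "((\<lambda>x. cos (k * pi * x)) has_integral (if k = 0 then 1 else 0)) {0..1::real}"
proof (cases "k = 0")
  case True
  then show ?thesis using has_integral_const_real[of "1::real" 0 1] by simp
next
  case False
  have "((\<lambda>x. cos (k * pi * x)) has_integral
      (sin (k * pi * 1) / (k * pi) - sin (k * pi * 0) / (k * pi))) {0..1::real}"
    by (rule fundamental_theorem_of_calculus)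
      (use False in \<open>auto intro!: derivative_eq_intros simp flip: has_real_derivative_iff_has_vector_derivative\<close>)
  then show ?thesis using False by (simp add: sin_zero_iff_int2 mult.commute)
qed

lemma cos_mode_orthonormal: "integral {0..1} (\<lambda>x. cos_mode m x * cos_mode n x) = (if m = n then 1 else 0)"
proof -
  define c where "c = (if m = 0 then 1 else sqrt 2) * (if n = 0 then 1 else sqrt 2)"
  have e: "cos_mode m x * cos_mode n x
      = c / 2 * (cos (real_of_int (int m - int n) * pi * x) + cos (real_of_int (int m + int n) * pi * x))" for x
    unfolding cos_mode_def c_def using cos_times_cos[of "m * pi * x" "n * pi * x"]
    by (simp add: algebra_simps add_divide_distrib)
  have "((\<lambda>x. cos_mode m x * cos_mode n x) has_integral
     c / 2 * ((if int m - int n = 0 then 1 else 0) + (if int m + int n = 0 then 1 else 0))) {0..1}"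
    unfolding e by (intro has_integral_mult_right has_integral_add integral_cos_int)
  then show ?thesis by (cases "n = 0") (auto simp: c_def dest!: integral_unique split: if_splits)
qed

lemma sin_mode_orthonormal:
  assumes "m > 0" "n > 0"
  shows "integral {0..1} (\<lambda>x. sin_mode m x * sin_mode n x) = (if m = n then 1 else 0)"
proof -
  have e: "sin_mode m x * sin_mode n x
      = cos (real_of_int (int m - int n) * pi * x) - cos (real_of_int (int m + int n) * pi * x)" for x
  proof -
    have "sin_mode m x * sin_mode n x = (sqrt 2 * sqrt 2) * (sin (m * pi * x) * sin (n * pi * x))"
      using assms by (simp add: sin_mode_def)
    then show ?thesis unfolding sin_times_sin
      by (simp add: algebra_simps)
  qed
  have "((\<lambda>x. sin_mode m x * sin_mode n x) has_integral
     (if int m - int n = 0 then 1 else 0) - (if int m + int n = 0 then 1 else 0)) {0..1}"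
    unfolding e by (intro has_integral_diff integral_cos_int)
  then show ?thesis using assms by (auto dest!: integral_unique)
qed

text \<open>The Neumann eigenfunctions of the unit square. Up to the factors -m pi and -n pi,
  \<open>sc\<close> and \<open>cs\<close> are their two partial derivatives; they serve as bases for
  the two components of the weak gradient.\<close>

definition cc :: "nat \<times> nat \<Rightarrow> point \<Rightarrow> real" where
  "cc p x = cos_mode (fst p) (fst x) * cos_mode (snd p) (snd x)"

definition sc :: "nat \<times> nat \<Rightarrow> point \<Rightarrow> real" where
  "sc p x = sin_mode (fst p) (fst x) * cos_mode (snd p) (snd x)"

definition cs :: "nat \<times> nat \<Rightarrow> point \<Rightarrow> real" where
  "cs p x = cos_mode (fst p) (fst x) * sin_mode (snd p) (snd x)"

lemma L2_unit_measure_product: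
  fixes f g :: "real \<Rightarrow> real"
  assumes f: "continuous_on UNIV f" "\<And>x. \<bar>f x\<bar> \<le> B" and g: "continuous_on UNIV g" "\<And>x. \<bar>g x\<bar> \<le> C"
  shows "L2 unit_measure (\<lambda>x. f (fst x) * g (snd x))"
proof (rule bounded_L2_unit_measure)
  show "(\<lambda>x::point. f (fst x) * g (snd x)) \<in> borel_measurable borel"
    by (intro borel_measurable_continuous_onI continuous_on_mult
        continuous_on_compose2[OF f(1)] continuous_on_compose2[OF g(1)] continuous_intros) auto
  show "norm (f (fst x) * g (snd x)) \<le> B * C" for x
    unfolding real_norm_def abs_mult using f(2)[of 0] by (intro mult_mono f(2) g(2)) auto
qed

text \<open>Fubini reduces this to one dimension. The index sets are parameters because the zero
  function \<open>sin_mode 0\<close> must be excluded from the sine factor.\<close>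

lemma orthonormal_product:
  fixes f g :: "nat \<Rightarrow> real \<Rightarrow> real"
  assumes f: "\<And>m. continuous_on UNIV (f m)" "\<And>m x. \<bar>f m x\<bar> \<le> B"
    and g: "\<And>m. continuous_on UNIV (g m)" "\<And>m x. \<bar>g m x\<bar> \<le> C"
    and fo: "\<And>m n. m \<in> I \<Longrightarrow> n \<in> I \<Longrightarrow> integral {0..1} (\<lambda>x. f m x * f n x) = (if m = n then 1 else 0)"
    and go: "\<And>m n. m \<in> J \<Longrightarrow> n \<in> J \<Longrightarrow> integral {0..1} (\<lambda>x. g m x * g n x) = (if m = n then 1 else 0)"
  shows "orthonormal unit_measure (I \<times> J) (\<lambda>p x. f (fst p) (fst x) * g (snd p) (snd x))"
  unfolding orthonormal_def
proof safe
  fix m n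
  show "L2 unit_measure (\<lambda>x. f (fst (m, n)) (fst x) * g (snd (m, n)) (snd x))"
    using L2_unit_measure_product[OF f(1)[of m] f(2) g(1)[of n] g(2)] by simp
next
  fix m n p q assume i: "m \<in> I" "n \<in> J" "p \<in> I" "q \<in> J"
  have "ip unit_measure (\<lambda>x. f m (fst x) * g n (snd x)) (\<lambda>x. f p (fst x) * g q (snd x))
      = (LINT x|unit_measure. (f m (fst x) * f p (fst x)) * (g n (snd x) * g q (snd x)))"
    by (simp add: ip_def ac_simps)
  also have "\<dots> = integral {0..1} (\<lambda>x. f m x * f p x) * integral {0..1} (\<lambda>x. g n x * g q x)"
    by (rule LINT_unit_measure_product) (intro continuous_intros f g)+
  also have "\<dots> = (if (m, n) = (p, q) then 1 else 0)" using i by (simp add: fo go)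
  finally show "ip unit_measure (\<lambda>x. f (fst (m, n)) (fst x) * g (snd (m, n)) (snd x))
      (\<lambda>x. f (fst (p, q)) (fst x) * g (snd (p, q)) (snd x)) = (if (m, n) = (p, q) then 1 else 0)"
    by simp
qed

lemma orthonormal_cc: "orthonormal unit_measure UNIV cc"
  using orthonormal_product[of cos_mode 2 cos_mode 2 UNIV UNIV] continuous_cos_mode abs_cos_mode_le cos_mode_orthonormal
  by (simp add: cc_def[abs_def])

lemma orthonormal_sc: "orthonormal unit_measure ({0<..} \<times> UNIV) sc"
  using orthonormal_product[of sin_mode 2 cos_mode 2 "{0<..}" UNIV] continuous_cos_mode abs_cos_mode_le cos_mode_orthonormal
    continuous_sin_mode abs_sin_mode_le sin_mode_orthonormal
  by (simp add: sc_def[abs_def])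

lemma orthonormal_cs: "orthonormal unit_measure (UNIV \<times> {0<..}) cs"
  using orthonormal_product[of cos_mode 2 sin_mode 2 UNIV "{0<..}"] continuous_cos_mode abs_cos_mode_le cos_mode_orthonormal
    continuous_sin_mode abs_sin_mode_le sin_mode_orthonormal
  by (simp add: cs_def[abs_def])

lemma L2_cc: "L2 unit_measure (cc p)"
  unfolding cc_def[abs_def] by (rule L2_unit_measure_product[OF continuous_cos_mode abs_cos_mode_le continuous_cos_mode abs_cos_mode_le])

lemma cc_0 [simp]: "cc (0, 0) = (\<lambda>x. 1)"
  by (simp add: cc_def fun_eq_iff)

section \<open>Uniform approximation by cosine polynomials\<close>

text \<open>The linear span of the unnormalised modes. Closure under products is not a rule: it
  follows from the product-to-sum formulas and makes the span an algebra, as Stone-Weierstrass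
  requires.\<close>

inductive cosine_poly :: "(point \<Rightarrow> real) \<Rightarrow> bool" where
  basis: "cosine_poly (\<lambda>x. cos (real m * pi * fst x) * cos (real n * pi * snd x))"
| add: "cosine_poly f \<Longrightarrow> cosine_poly g \<Longrightarrow> cosine_poly (\<lambda>x. f x + g x)"
| scale: "cosine_poly f \<Longrightarrow> cosine_poly (\<lambda>x. c * f x)"

text \<open>With truncated subtraction, (m - n) + (n - m) is |m - n|, so the second frequency is
  again a natural number.\<close>

lemma cos_nat_product:
  "cos (real m * t) * cos (real n * t) = (cos (real (m + n) * t) + cos (real ((m - n) + (n - m)) * t)) / 2"
proof -
  have "cos (real ((m - n) + (n - m)) * t) = cos (real m * t - real n * t)"
  proof (cases "n \<le> m")
    case True
    then show ?thesis by (simp add: of_nat_diff algebra_simps)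
  next
    case False
    then have "real ((m - n) + (n - m)) * t = - (real m * t - real n * t)"
      by (simp add: of_nat_diff algebra_simps)
    then show ?thesis by (simp only: cos_minus)
  qed
  then show ?thesis by (simp add: cos_times_cos algebra_simps)
qed

lemma cosine_poly_mult:
  assumes "cosine_poly f" "cosine_poly g"
  shows "cosine_poly (\<lambda>x. f x * g x)"
  using assms
proof (induction arbitrary: g rule: cosine_poly.induct)
  case (basis m n)
  show ?case using basis
  proof (induction rule: cosine_poly.induct)
    case (basis p q)
    let ?a = "m + p" and ?b = "(m - p) + (p - m)" and ?c = "n + q" and ?d = "(n - q) + (q - n)"
    have "(\<lambda>x. cos (real m * pi * fst x) * cos (real n * pi * snd x) *
          (cos (real p * pi * fst x) * cos (real q * pi * snd x)))
      = (\<lambda>x::point. 1/4 * (cos (real ?a * pi * fst x) * cos (real ?c * pi * snd x)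
            + cos (real ?a * pi * fst x) * cos (real ?d * pi * snd x)
            + (cos (real ?b * pi * fst x) * cos (real ?c * pi * snd x)
            + cos (real ?b * pi * fst x) * cos (real ?d * pi * snd x))))"
    proof
      fix x :: point
      have "cos (real m * pi * fst x) * cos (real n * pi * snd x) *
          (cos (real p * pi * fst x) * cos (real q * pi * snd x))
        = (cos (real m * (pi * fst x)) * cos (real p * (pi * fst x))) *
          (cos (real n * (pi * snd x)) * cos (real q * (pi * snd x)))"
        by (simp add: mult.assoc mult.left_commute)
      also have "\<dots> = 1/4 * (cos (real ?a * pi * fst x) * cos (real ?c * pi * snd x)
            + cos (real ?a * pi * fst x) * cos (real ?d * pi * snd x)
            + (cos (real ?b * pi * fst x) * cos (real ?c * pi * snd x)
            + cos (real ?b * pi * fst x) * cos (real ?d * pi * snd x)))"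
        unfolding cos_nat_product mult.assoc by (simp add: field_simps)
      finally show "cos (real m * pi * fst x) * cos (real n * pi * snd x) *
          (cos (real p * pi * fst x) * cos (real q * pi * snd x)) = \<dots>" .
    qed
    then show ?case by (simp only:) (intro cosine_poly.intros)
  next
    case (add f g)
    then show ?case using cosine_poly.add by (simp add: distrib_left)
  next
    case (scale f c)
    then show ?case using cosine_poly.scale[of _ c] by (simp add: mult.left_commute)
  qed
next
  case (add f h)
  then show ?case using cosine_poly.add by (simp add: distrib_right)
next
  case (scale f c)
  then show ?case using cosine_poly.scale[of _ c] by (simp add: mult.assoc)
qed

lemma continuous_cosine_poly: "cosine_poly f \<Longrightarrow> continuous_on A f"
  by (induction rule: cosine_poly.induct) (auto intro!: continuous_intros)

lemma cosine_poly_const: "cosine_poly (\<lambda>x. c)"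
  using scale[OF basis[of 0 0], of c] by simp

abbreviation closed_square :: "point set" where
  "closed_square \<equiv> {0..1} \<times> {0..1}"

lemma compact_closed_square: "compact closed_square"
  by (intro compact_Times) auto

lemma unit_square_subset: "unit_square \<subseteq> closed_square"
  by (auto simp: unit_square_def)

text \<open>Stone-Weierstrass. The modes of frequency one already separate points, since
  \<open>cos\<close> is injective on [0, pi].\<close>

lemma cosine_poly_approx:
  assumes "continuous_on closed_square f" "0 < e"
  shows "\<exists>g. cosine_poly g \<and> (\<forall>x\<in>closed_square. \<bar>f x - g x\<bar> < e)"
proof (rule Stone_Weierstrass_HOL[where P = cosine_poly])
  show "compact closed_square" by (rule compact_closed_square)
  fix x y assume xy: "x \<in> closed_square \<and> y \<in> closed_square \<and> x \<noteq> y"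
  have inj: "a = b" if "cos (pi * a) = cos (pi * b)" "a \<in> {0..1}" "b \<in> {0..1}" for a b
    using that cos_inj_pi[of "pi * a" "pi * b"] by (auto simp: mult_left_le)
  show "\<exists>f. cosine_poly f \<and> f x \<noteq> f y"
  proof (cases "fst x = fst y")
    case False
    then have "cos (pi * fst x) \<noteq> cos (pi * fst y)"
      using inj[of "fst x" "fst y"] xy by (auto simp: mem_Times_iff)
    then show ?thesis using basis[of 1 0] by (intro exI[of _ "\<lambda>x. cos (pi * fst x)"]) auto
  next
    case True
    then have "snd x \<noteq> snd y" using xy by (simp add: prod_eq_iff)
    then have "cos (pi * snd x) \<noteq> cos (pi * snd y)"
      using inj[of "snd x" "snd y"] xy by (auto simp: mem_Times_iff)
    then show ?thesis using basis[of 0 1] by (intro exI[of _ "\<lambda>x. cos (pi * snd x)"]) auto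
  qed
qed (use assms cosine_poly_const continuous_cosine_poly add cosine_poly_mult in auto)

lemma continuous_L2_unit_measure:
  fixes f :: "point \<Rightarrow> 'b::euclidean_space"
  assumes "continuous_on UNIV f"
  shows "L2 unit_measure f"
proof -
  have "bounded (f ` closed_square)"
    using assms compact_closed_square
    by (intro compact_imp_bounded compact_continuous_image continuous_on_subset[OF assms]) auto
  then obtain B where "\<forall>x\<in>closed_square. norm (f x) \<le> B" by (auto simp: bounded_iff)
  then show ?thesis
    using unit_square_subset assms
    by (intro bounded_L2_unit_measure borel_measurable_continuous_onI) auto
qed

section \<open>Completeness of the cosine system\<close>

lemma ip_cosine_poly:
  assumes f: "L2 unit_measure f" and 0: "\<And>p. ip unit_measure f (cc p) = 0"
  shows "cosine_poly g \<Longrightarrow> ip unit_measure f g = 0"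
proof (induction rule: cosine_poly.induct)
  case (basis m n)
  \<comment> \<open>This undoes the normalisation of the two factors of
    \<open>cc (m, n)\<close>.\<close>
  define k where "k = 1 / ((if m = 0 then 1 else sqrt 2) * (if n = 0 then 1 else sqrt 2))"
  have "(\<lambda>x. cos (real m * pi * fst x) * cos (real n * pi * snd x)) = (\<lambda>x. k *\<^sub>R cc (m, n) x)"
    by (auto simp: cc_def cos_mode_def k_def fun_eq_iff)
  then show ?case by (simp only: ip_scaleR_right 0)
next
  case (add g h)
  then have "L2 unit_measure g" "L2 unit_measure h" by (auto intro: continuous_L2_unit_measure continuous_cosine_poly)
  then show ?case using add ip_add_right[OF f, of g h] by simp
next
  case (scale g c)
  then show ?case using ip_scaleR_right[of unit_measure f c g] by simp
qed

text \<open>On a space of mass one uniform approximation implies approximation in the mean, so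
  orthogonality passes from cosine polynomials to continuous functions.\<close>

lemma ip_continuous:
  assumes f: "L2 unit_measure f" and 0: "\<And>p. ip unit_measure f (cc p) = 0" and h: "continuous_on UNIV h"
  shows "ip unit_measure f h = 0"
proof (rule ccontr)
  assume "ip unit_measure f h \<noteq> 0"
  \<comment> \<open>The squared inner product then equals (N + 1)^2 e^2, where N is the squared norm
    of f, while an approximation within e bounds it by N e^2.\<close>
  define e where "e = \<bar>ip unit_measure f h\<bar> / (nsq unit_measure f + 1)"
  have pos: "0 < nsq unit_measure f + 1" using nsq_nonneg[of unit_measure f] by simp
  then have e: "e > 0" using \<open>ip unit_measure f h \<noteq> 0\<close> by (simp add: e_def)
  obtain g where g: "cosine_poly g" "\<And>x. x \<in> closed_square \<Longrightarrow> \<bar>h x - g x\<bar> < e"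
    using cosine_poly_approx[OF continuous_on_subset[OF h] e] by auto
  have gL: "L2 unit_measure g" and hL: "L2 unit_measure h"
    using g(1) h by (auto intro: continuous_L2_unit_measure continuous_cosine_poly)
  have "nsq unit_measure (\<lambda>x. h x - g x) \<le> (LINT x|unit_measure. e\<^sup>2)"
    unfolding nsq_def
  proof (rule integral_mono)
    show "integrable unit_measure (\<lambda>x. (norm (h x - g x))\<^sup>2)"
      by (intro L2_integrable_sq L2_diff hL gL)
    show "integrable unit_measure (\<lambda>x. e\<^sup>2)"
      using finite_measure_unit_measure by (simp add: finite_measure.integrable_const)
    show "(norm (h x - g x))\<^sup>2 \<le> e\<^sup>2" if "x \<in> space unit_measure" for x
    proof (rule power_mono)
      show "norm (h x - g x) \<le> e" using g(2)[of x] that unit_square_subset by auto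
    qed simp
  qed
  then have le: "nsq unit_measure (\<lambda>x. h x - g x) \<le> e\<^sup>2" by simp
  have "(ip unit_measure f h)\<^sup>2 = (ip unit_measure f (\<lambda>x. h x - g x))\<^sup>2"
    using ip_diff_right[OF f hL gL] ip_cosine_poly[OF f 0 g(1)] by simp
  also have "\<dots> \<le> nsq unit_measure f * nsq unit_measure (\<lambda>x. h x - g x)"
    by (intro ip_Cauchy_Schwarz f L2_diff hL gL)
  also have "\<dots> \<le> nsq unit_measure f * e\<^sup>2" by (intro mult_left_mono le nsq_nonneg)
  finally have "(ip unit_measure f h)\<^sup>2 \<le> nsq unit_measure f * e\<^sup>2" .
  moreover have "(ip unit_measure f h)\<^sup>2 = (nsq unit_measure f + 1)\<^sup>2 * e\<^sup>2"
    using pos by (simp add: e_def power_divide)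
  moreover have "nsq unit_measure f * e\<^sup>2 < (nsq unit_measure f + 1)\<^sup>2 * e\<^sup>2"
  proof (rule mult_strict_right_mono)
    have "0 \<le> (nsq unit_measure f)\<^sup>2" by simp
    then show "nsq unit_measure f < (nsq unit_measure f + 1)\<^sup>2"
      using nsq_nonneg[of unit_measure f] unfolding power2_sum power_one mult_1_right by linarith
  qed (use e in simp)
  ultimately show False by simp
qed

text \<open>The indicator of an open set is the pointwise limit of the continuous functions min(1, k
  dist), where dist is the distance to the complement. Dominated convergence with |f| transfers the
  vanishing.\<close>

lemma LINT_open:
  assumes f: "L2 unit_measure f" and 0: "\<And>p. ip unit_measure f (cc p) = 0" and S: "open S"
  shows "(LINT x|unit_measure. f x * indicator S x) = 0"
proof (cases "S = UNIV")
  \<comment> \<open>The distance \<open>infdist\<close> to the empty set is 0, so the approximation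
    by \<open>h\<close> would fail for the whole plane.\<close>
  case True
  then show ?thesis using ip_continuous[OF f 0, of "\<lambda>x. 1"] by (simp add: ip_def)
next
  case False
  then have ne: "- S \<noteq> {}" and cl: "closed (- S)" using S by auto
  define h where "h k x = min 1 (real k * infdist x (- S))" for k x
  have hc: "continuous_on UNIV (h k)" for k
    unfolding h_def by (intro continuous_intros)
  have [measurable]: "h k \<in> borel_measurable unit_measure" for k
    using hc by (intro measurable_unit_measure borel_measurable_continuous_onI)
  have [measurable]: "f \<in> borel_measurable unit_measure" using f by (rule L2_measurable)
  have [measurable]: "(\<lambda>x. indicator S x :: real) \<in> borel_measurable unit_measure"
    using S by (intro measurable_unit_measure) auto
  have "(\<lambda>k. LINT x|unit_measure. f x * h k x) \<longlonglongrightarrow> (LINT x|unit_measure. f x * indicator S x)"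
  proof (rule integral_dominated_convergence[where w = "\<lambda>x. \<bar>f x\<bar>"])
    show "integrable unit_measure (\<lambda>x. \<bar>f x\<bar>)"
      using L2_integrable[OF finite_measure_unit_measure f] by (rule integrable_abs)
    show "AE x in unit_measure. (\<lambda>k. f x * h k x) \<longlonglongrightarrow> f x * indicator S x"
    proof (intro AE_I2 tendsto_mult tendsto_const)
      fix x
      show "(\<lambda>k. h k x) \<longlonglongrightarrow> indicator S x"
      proof (cases "x \<in> S")
        case True
        then have pos: "infdist x (- S) > 0"
          using infdist_pos_not_in_closed[OF cl ne] by auto
        obtain K where K: "1 < real K * infdist x (- S)"
          using reals_Archimedean3[OF pos] by blast
        have "h k x = 1" if "k \<ge> K" for k
        proof -
          have "real K * infdist x (- S) \<le> real k * infdist x (- S)"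
            using that pos by simp
          then show ?thesis using K unfolding h_def by simp
        qed
        then have "\<forall>\<^sub>F k in sequentially. h k x = indicator S x"
          using True unfolding eventually_sequentially by auto
        then show ?thesis by (rule tendsto_eventually)
      next
        case False
        then show ?thesis by (simp add: h_def)
      qed
    qed
    show "AE x in unit_measure. norm (f x * h k x) \<le> \<bar>f x\<bar>" for k
    proof (intro AE_I2)
      fix x
      have "\<bar>h k x\<bar> \<le> 1" using infdist_nonneg[of x "- S"] by (simp add: h_def)
      then show "norm (f x * h k x) \<le> \<bar>f x\<bar>" by (simp add: abs_mult mult_left_le)
    qed
  qed measurable
  moreover have "(LINT x|unit_measure. f x * h k x) = 0" for k
    using ip_continuous[OF f 0 hc] by (simp add: ip_def)
  ultimately show ?thesis by (simp add: LIMSEQ_const_iff)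
qed

text \<open>A pi-lambda argument: the sets over which f integrates to zero include the open sets, a
  generator stable under intersection, and are closed under complements and countable disjoint
  unions. Thus they include all Borel sets.\<close>

lemma cosine_total:
  assumes f: "L2 unit_measure f" and 0: "\<And>p. ip unit_measure f (cc p) = 0"
  shows "AE x in unit_measure. f x = 0"
proof -
  interpret finite_measure unit_measure by (rule finite_measure_unit_measure)
  have int: "integrable unit_measure f" using L2_integrable[OF finite_measure_unit_measure f] .
  have sp: "S \<inter> unit_square \<in> sets unit_measure" if "S \<in> sets borel" for S
    using that by (auto simp: unit_measure_def sets_restrict_space)
  have sint: "set_integrable unit_measure (S \<inter> unit_square) f" if "S \<in> sets borel" for S
    unfolding set_integrable_def using sp[OF that] int by (rule integrable_mult_indicator)
  have *: "(LINT x:S \<inter> unit_square|unit_measure. f x) = 0" if "S \<in> sigma_sets UNIV {S::point set. open S}" for S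
  proof -
    have "Int_stable {S::point set. open S}" "{S::point set. open S} \<subseteq> Pow UNIV"
      by (auto simp: Int_stable_def)
    then show ?thesis using that
    proof (induction rule: sigma_sets_induct_disjoint)
      case (basic S)
      then have "(LINT x|unit_measure. f x * indicator S x) = 0" using LINT_open[OF f 0] by simp
      moreover have "(LINT x|unit_measure. f x * indicator S x) = (LINT x:S \<inter> unit_square|unit_measure. f x)"
        unfolding set_lebesgue_integral_def
        by (intro Bochner_Integration.integral_cong) (auto simp: indicator_def)
      ultimately show ?case by simp
    next
      case empty
      then show ?case by (simp add: set_lebesgue_integral_def)
    next
      case (compl S)
      then have S: "S \<in> sets borel" by (simp add: borel_def)
      have "(LINT x:S \<inter> unit_square \<union> (UNIV - S) \<inter> unit_square|unit_measure. f x)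
        = (LINT x:S \<inter> unit_square|unit_measure. f x) + (LINT x:(UNIV - S) \<inter> unit_square|unit_measure. f x)"
        using S by (intro set_integral_Un sint) auto
      moreover have "S \<inter> unit_square \<union> (UNIV - S) \<inter> unit_square = space unit_measure" by auto
      moreover have "(LINT x:space unit_measure|unit_measure. f x) = 0"
        using ip_continuous[OF f 0, of "\<lambda>x. 1"] set_integral_space[OF int] by (simp add: ip_def)
      ultimately show ?case using compl by simp
    next
      case (union A)
      then have A: "A i \<in> sets borel" for i by (auto simp: borel_def)
      have "(LINT x:(\<Union>i. A i \<inter> unit_square)|unit_measure. f x) = (\<Sum>i. LINT x:A i \<inter> unit_square|unit_measure. f x)"
      proof (rule lebesgue_integral_countable_add)
        show "A i \<inter> unit_square \<in> sets unit_measure" for i using A by (rule sp)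
        show "A i \<inter> unit_square \<inter> (A j \<inter> unit_square) = {}" if "i \<noteq> j" for i j
          using union(1) that unfolding disjoint_family_on_def by blast
        show "set_integrable unit_measure (\<Union>i. A i \<inter> unit_square) f"
          using sint[of "\<Union>i. A i"] A by simp
      qed
      then show ?case using union by simp
    qed
  qed
  show ?thesis
  proof (rule density_zero[OF int])
    fix A assume "A \<in> sets unit_measure"
    then obtain S where S: "S \<in> sets borel" "A = unit_square \<inter> S"
      by (auto simp: unit_measure_def sets_restrict_space)
    then show "(LINT x:A|unit_measure. f x) = 0" using *[of S] by (simp add: borel_def Int_commute)
  qed
qed

text \<open>Truncation to a square block of indices: outside it at least one of the two frequencies
  is at least N, and the block for N = 1 keeps the mean value only.\<close>

definition cosine_projection :: "nat \<Rightarrow> (point \<Rightarrow> real) \<Rightarrow> point \<Rightarrow> real" where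
  "cosine_projection N f x = (\<Sum>p\<in>{..<N} \<times> {..<N}. ip unit_measure f (cc p) * cc p x)"

lemma L2_cosine_projection: "L2 unit_measure (cosine_projection N f)"
  unfolding cosine_projection_def[abs_def] by (intro L2_sum L2_cmult L2_cc)

lemma orthonormal_subset: "orthonormal M I e \<Longrightarrow> J \<subseteq> I \<Longrightarrow> orthonormal M J e"
  unfolding orthonormal_def by (meson subsetD)

lemma orthonormalD:
  "orthonormal M I e \<Longrightarrow> i \<in> I \<Longrightarrow> j \<in> I \<Longrightarrow> ip M (e i) (e j) = (if i = j then 1 else 0)"
  by (simp add: orthonormal_def)

lemma square_mono: "N \<le> K \<Longrightarrow> {..<N} \<times> {..<N} \<subseteq> {..<K} \<times> {..<K::nat}"
  by auto

lemma nsq_cosine_projection_diff: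
  assumes "N \<le> K"
  shows "nsq unit_measure (\<lambda>x. cosine_projection K f x - cosine_projection N f x)
    = (\<Sum>p\<in>{..<K} \<times> {..<K} - {..<N} \<times> {..<N}. (ip unit_measure f (cc p))\<^sup>2)"
proof -
  have "cosine_projection K f x - cosine_projection N f x = (\<Sum>p\<in>{..<K} \<times> {..<K} - {..<N} \<times> {..<N}. ip unit_measure f (cc p) * cc p x)" for x
    unfolding cosine_projection_def by (subst sum_diff[OF _ square_mono[OF assms]]) auto
  then show ?thesis
    using nsq_orthonormal_sum[OF orthonormal_subset[OF orthonormal_cc subset_UNIV],
        of "{..<K} \<times> {..<K} - {..<N} \<times> {..<N}" "\<lambda>p. ip unit_measure f (cc p)"] by simp
qed

text \<open>By Bessel the squared coefficients are summable, so the partial sums have a limit in the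
  mean. It has the same coefficients as f and therefore agrees with f almost everywhere by
  completeness of the system.\<close>

lemma cosine_projection_converges:
  assumes f: "L2 unit_measure f"
  shows "(\<lambda>N. nsq unit_measure (\<lambda>x. cosine_projection N f x - f x)) \<longlonglongrightarrow> 0"
proof -
  let ?S = "\<lambda>N. \<Sum>p\<in>{..<N} \<times> {..<N}. (ip unit_measure f (cc p))\<^sup>2"
  have on: "orthonormal unit_measure A cc" for A
    using orthonormal_subset[OF orthonormal_cc] by simp
  have inc: "incseq ?S"
    by (intro incseq_SucI sum_mono2) auto
  have "bdd_above (range ?S)"
    using Bessel[OF on _ f] by (intro bdd_aboveI[of _ "nsq unit_measure f"]) auto
  then have "convergent ?S"
    by (rule convergentI[OF LIMSEQ_incseq_SUP[OF _ inc]])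
  then have "Cauchy ?S" by (rule convergent_Cauchy)
  have cau: "\<exists>N. \<forall>m\<ge>N. \<forall>n\<ge>N. nsq unit_measure (\<lambda>x. cosine_projection m f x - cosine_projection n f x) < e" if "e > 0" for e
  proof -
    have d: "nsq unit_measure (\<lambda>x. cosine_projection m f x - cosine_projection n f x) = \<bar>?S m - ?S n\<bar>" for m n
    proof (induction m n rule: linorder_wlog)
      case (le a b)
      have "nsq unit_measure (\<lambda>x. cosine_projection b f x - cosine_projection a f x) = ?S b - ?S a"
        unfolding nsq_cosine_projection_diff[OF le] by (subst sum_diff[OF _ square_mono[OF le]]) auto
      moreover have "?S b \<ge> ?S a" using incseqD[OF inc le] .
      ultimately show ?case by (subst nsq_diff_swap) simp
    next
      case (sym a b)
      then show ?case by (subst nsq_diff_swap) (simp add: abs_minus_commute)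
    qed
    show ?thesis
      using CauchyD[OF \<open>Cauchy ?S\<close> that] unfolding d real_norm_def .
  qed
  obtain g where g: "L2 unit_measure g" "(\<lambda>N. nsq unit_measure (\<lambda>x. cosine_projection N f x - g x)) \<longlonglongrightarrow> 0"
    using Riesz_Fischer[OF L2_cosine_projection cau] by blast
  have "ip unit_measure (\<lambda>x. f x - g x) (cc p) = 0" for p
  proof -
    have "(\<lambda>N. ip unit_measure (cc p) (cosine_projection N f)) \<longlonglongrightarrow> ip unit_measure (cc p) g"
      by (rule tendsto_ip[OF L2_cosine_projection g(1) L2_cc g(2)])
    moreover have "\<forall>\<^sub>F N in sequentially. ip unit_measure (cc p) (cosine_projection N f) = ip unit_measure f (cc p)"
    proof (intro eventually_sequentiallyI)
      \<comment> \<open>The index blocks exclude their upper end, hence the successors.\<close>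
      fix N assume "max (Suc (fst p)) (Suc (snd p)) \<le> N"
      then have p: "p \<in> {..<N} \<times> {..<N}" by (cases p) auto
      have "ip unit_measure (cc p) (cosine_projection N f) = (\<Sum>q\<in>{..<N} \<times> {..<N}. ip unit_measure f (cc q) * ip unit_measure (cc p) (cc q))"
        unfolding cosine_projection_def[abs_def] by (intro ip_sum_right L2_cc)
      also have "\<dots> = (\<Sum>q\<in>{..<N} \<times> {..<N}. if p = q then ip unit_measure f (cc q) else 0)"
        by (intro sum.cong refl) (simp add: orthonormalD[OF orthonormal_cc])
      also have "\<dots> = ip unit_measure f (cc p)" using p by simp
      finally show "ip unit_measure (cc p) (cosine_projection N f) = ip unit_measure f (cc p)" .
    qed
    ultimately have "ip unit_measure (cc p) g = ip unit_measure f (cc p)"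
      by (metis LIMSEQ_unique tendsto_eventually)
    then show ?thesis
      using ip_diff_right[OF L2_cc f g(1), of p] by (simp add: ip_commute)
  qed
  then have ae: "AE x in unit_measure. f x - g x = 0"
    by (intro cosine_total L2_diff f g)
  have "nsq unit_measure (\<lambda>x. cosine_projection N f x - g x) = nsq unit_measure (\<lambda>x. cosine_projection N f x - f x)" for N
    unfolding nsq_def using f g(1) L2_cosine_projection[of N f] ae
    by (intro integral_cong_AE) (auto simp: L2_def)
  then show ?thesis using g(2) by simp
qed


section \<open>Sobolev functions on the unit square\<close>

abbreviation H1 :: "(point \<Rightarrow> real) \<Rightarrow> (point \<Rightarrow> point) \<Rightarrow> bool" where
  "H1 \<equiv> H1_function unit_square"

lemma H1_iff:
  "H1 u g \<longleftrightarrow> L2 unit_measure u \<and> L2 unit_measure g \<and>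
    (\<forall>\<phi> D. test_function unit_square \<phi> D \<longrightarrow> (LINT x|unit_measure. u x *\<^sub>R D x) = - (LINT x|unit_measure. \<phi> x *\<^sub>R g x))"
  by (simp add: H1_function_def square_integrable_iff_L2 integral_unit_measure)

lemma H1_L2: "H1 u g \<Longrightarrow> L2 unit_measure u" "H1 u g \<Longrightarrow> L2 unit_measure g"
  by (simp_all add: H1_iff)

lemma test_function_continuous:
  assumes "test_function S \<phi> D"
  shows "continuous_on UNIV \<phi>" "continuous_on UNIV D"
proof -
  have "isCont \<phi> x" for x
  proof (rule has_derivative_continuous)
    show "(\<phi> has_derivative (\<lambda>h. h \<bullet> D x)) (at x)"
      using assms unfolding test_function_def gderiv_def by blast
  qed
  then show "continuous_on UNIV \<phi>" by (simp add: continuous_at_imp_continuous_on)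
  show "continuous_on UNIV D" using assms by (simp add: test_function_def)
qed

text \<open>This single form covers sums, differences (c = -1), multiples (u = 0) and the variations
  u + t v of a minimiser.\<close>

lemma H1_add_scale:
  assumes u: "H1 u g" and v: "H1 v h"
  shows "H1 (\<lambda>x. u x + c * v x) (\<lambda>x. g x + c *\<^sub>R h x)"
  unfolding H1_iff
proof (intro conjI allI impI)
  show "L2 unit_measure (\<lambda>x. u x + c * v x)" "L2 unit_measure (\<lambda>x. g x + c *\<^sub>R h x)"
    using H1_L2[OF u] H1_L2[OF v] by (auto intro!: L2_add L2_cmult L2_scaleR)
  fix \<phi> D assume t: "test_function unit_square \<phi> D"
  have D: "L2 unit_measure D" and p: "L2 unit_measure \<phi>"
    using test_function_continuous[OF t] by (auto intro: continuous_L2_unit_measure)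
  have iu: "integrable unit_measure (\<lambda>x. u x *\<^sub>R D x)" and iv: "integrable unit_measure (\<lambda>x. c *\<^sub>R (v x *\<^sub>R D x))"
    and ig: "integrable unit_measure (\<lambda>x. \<phi> x *\<^sub>R g x)" and ih: "integrable unit_measure (\<lambda>x. c *\<^sub>R (\<phi> x *\<^sub>R h x))"
    using H1_L2[OF u] H1_L2[OF v] D p
    by (auto intro!: Bochner_Integration.integrable_scaleR_right L2_integrable_scaleR simp del: scaleR_scaleR)
  have "(LINT x|unit_measure. (u x + c * v x) *\<^sub>R D x) = (LINT x|unit_measure. u x *\<^sub>R D x + c *\<^sub>R (v x *\<^sub>R D x))"
    by (simp add: scaleR_add_left)
  also have "\<dots> = (LINT x|unit_measure. u x *\<^sub>R D x) + c *\<^sub>R (LINT x|unit_measure. v x *\<^sub>R D x)"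
    unfolding Bochner_Integration.integral_add[OF iu iv] by (simp only: integral_scaleR_right)
  also have "\<dots> = - (LINT x|unit_measure. \<phi> x *\<^sub>R g x) + c *\<^sub>R (- (LINT x|unit_measure. \<phi> x *\<^sub>R h x))"
    using u v t unfolding H1_iff by simp
  also have "\<dots> = - ((LINT x|unit_measure. \<phi> x *\<^sub>R g x) + c *\<^sub>R (LINT x|unit_measure. \<phi> x *\<^sub>R h x))"
    by simp
  also have "(LINT x|unit_measure. \<phi> x *\<^sub>R g x) + c *\<^sub>R (LINT x|unit_measure. \<phi> x *\<^sub>R h x)
      = (LINT x|unit_measure. \<phi> x *\<^sub>R g x + c *\<^sub>R (\<phi> x *\<^sub>R h x))"
    unfolding Bochner_Integration.integral_add[OF ig ih] by (simp only: integral_scaleR_right)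
  also have "\<dots> = (LINT x|unit_measure. \<phi> x *\<^sub>R (g x + c *\<^sub>R h x))"
    by (simp add: scaleR_add_right mult.commute)
  finally show "(LINT x|unit_measure. (u x + c * v x) *\<^sub>R D x) = - (LINT x|unit_measure. \<phi> x *\<^sub>R (g x + c *\<^sub>R h x))" .
qed

text \<open>The weak gradient is a closed operator: for a fixed test function both sides of the
  defining identity are continuous in the mean. Taking components turns the vector-valued integrals
  into inner products.\<close>

lemma H1_limit:
  assumes H: "\<And>n. H1 (u n) (g n)" and v: "L2 unit_measure v" and h: "L2 unit_measure h"
    and lu: "(\<lambda>n. nsq unit_measure (\<lambda>x. u n x - v x)) \<longlonglongrightarrow> 0"
    and lg: "(\<lambda>n. nsq unit_measure (\<lambda>x. g n x - h x)) \<longlonglongrightarrow> 0"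
  shows "H1 v h"
  unfolding H1_iff
proof (intro conjI allI impI v h)
  fix \<phi> D assume t: "test_function unit_square \<phi> D"
  have D: "L2 unit_measure D" and p: "L2 unit_measure \<phi>"
    using test_function_continuous[OF t] by (auto intro: continuous_L2_unit_measure)
  show "(LINT x|unit_measure. v x *\<^sub>R D x) = - (LINT x|unit_measure. \<phi> x *\<^sub>R h x)"
  proof (rule euclidean_eqI)
    fix b :: point assume "b \<in> Basis"
    have Db: "L2 unit_measure (\<lambda>x. D x \<bullet> b)" and pb: "L2 unit_measure (\<lambda>x. \<phi> x *\<^sub>R b)"
      using D p by (auto intro!: L2_linear[of unit_measure D "\<lambda>y. y \<bullet> b"] L2_linear[of unit_measure \<phi> "\<lambda>y. y *\<^sub>R b"]
          simp: linear_iff inner_add_left scaleR_add_left)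
    have e1: "(LINT x|unit_measure. w x *\<^sub>R D x) \<bullet> b = ip unit_measure (\<lambda>x. D x \<bullet> b) w" if "L2 unit_measure w" for w
    proof -
      have "(LINT x|unit_measure. w x *\<^sub>R D x) \<bullet> b = (LINT x|unit_measure. (w x *\<^sub>R D x) \<bullet> b)"
        using L2_integrable_scaleR[OF that D] by (rule integral_inner_left[symmetric])
      also have "\<dots> = ip unit_measure (\<lambda>x. D x \<bullet> b) w"
        unfolding ip_def by (intro Bochner_Integration.integral_cong) auto
      finally show ?thesis .
    qed
    have e2: "(LINT x|unit_measure. \<phi> x *\<^sub>R w x) \<bullet> b = ip unit_measure (\<lambda>x. \<phi> x *\<^sub>R b) w" if "L2 unit_measure w" for w
    proof -
      have "(LINT x|unit_measure. \<phi> x *\<^sub>R w x) \<bullet> b = (LINT x|unit_measure. (\<phi> x *\<^sub>R w x) \<bullet> b)"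
        using L2_integrable_scaleR[OF p that] by (rule integral_inner_left[symmetric])
      also have "\<dots> = ip unit_measure (\<lambda>x. \<phi> x *\<^sub>R b) w"
        unfolding ip_def by (intro Bochner_Integration.integral_cong) (auto simp: inner_commute)
      finally show ?thesis .
    qed
    have "ip unit_measure (\<lambda>x. D x \<bullet> b) (u n) = - ip unit_measure (\<lambda>x. \<phi> x *\<^sub>R b) (g n)" for n
    proof -
      have "(LINT x|unit_measure. u n x *\<^sub>R D x) = - (LINT x|unit_measure. \<phi> x *\<^sub>R g n x)"
        using H[of n] t unfolding H1_iff by blast
      then show ?thesis
        using e1[OF H1_L2(1)[OF H[of n]]] e2[OF H1_L2(2)[OF H[of n]]] by (simp only: inner_minus_left)
    qed
    moreover have "(\<lambda>n. ip unit_measure (\<lambda>x. D x \<bullet> b) (u n)) \<longlonglongrightarrow> ip unit_measure (\<lambda>x. D x \<bullet> b) v"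
      using H by (intro tendsto_ip v Db lu) (auto intro: H1_L2)
    moreover have "(\<lambda>n. - ip unit_measure (\<lambda>x. \<phi> x *\<^sub>R b) (g n)) \<longlonglongrightarrow> - ip unit_measure (\<lambda>x. \<phi> x *\<^sub>R b) h"
      using H by (intro tendsto_minus tendsto_ip h pb lg) (auto intro: H1_L2)
    ultimately have "ip unit_measure (\<lambda>x. D x \<bullet> b) v = - ip unit_measure (\<lambda>x. \<phi> x *\<^sub>R b) h"
      by (simp add: LIMSEQ_unique)
    then show "(LINT x|unit_measure. v x *\<^sub>R D x) \<bullet> b = (- (LINT x|unit_measure. \<phi> x *\<^sub>R h x)) \<bullet> b"
      using e1[OF v] e2[OF h] by simp
  qed
qed

section \<open>Continuously differentiable cutoff functions\<close>

text \<open>Squaring the positive part makes it continuously differentiable, which is exactly the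
  regularity asked of a test function.\<close>

definition ramp :: "real \<Rightarrow> real" where "ramp x = (max 0 x)\<^sup>2"

lemma DERIV_ramp: "(ramp has_real_derivative 2 * max 0 x) (at x)"
proof -
  consider "x < 0" | "x = 0" | "x > 0" by linarith
  then show ?thesis
  proof cases
    case 1
    have "((\<lambda>x. 0) has_real_derivative 2 * max 0 x) (at x)" using 1 by simp
    then show ?thesis
      by (rule has_field_derivative_transform_within_open[of _ _ _ "{..<0}"]) (use 1 in \<open>auto simp: ramp_def\<close>)
  next
    case 3
    have "((\<lambda>x. x\<^sup>2) has_real_derivative 2 * max 0 x) (at x)"
      using 3 by (auto intro!: derivative_eq_intros)
    then show ?thesis
      by (rule has_field_derivative_transform_within_open[of _ _ _ "{0<..}"]) (use 3 in \<open>auto simp: ramp_def\<close>)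
  next
    case 2
    have "((\<lambda>h. (ramp (0 + h) - ramp 0) / h) \<longlongrightarrow> 0) (at 0)"
    proof (rule Lim_null_comparison)
      show "\<forall>\<^sub>F h in at 0. norm ((ramp (0 + h) - ramp 0) / h) \<le> \<bar>h\<bar>"
        by (auto simp: ramp_def eventually_at max_def power2_eq_square intro!: exI[of _ 1])
      show "((\<lambda>h::real. \<bar>h\<bar>) \<longlongrightarrow> 0) (at 0)" by (auto intro!: tendsto_eq_intros)
    qed
    then show ?thesis using 2 by (simp add: DERIV_def)
  qed
qed

text \<open>A transition from 0 on x \<le> 1 to 1 on x \<ge> 2. The two ramps in the denominator
  never vanish at the same point, so the quotient inherits their regularity.\<close>

definition step :: "real \<Rightarrow> real" where
  "step x = ramp (x - 1) / (ramp (x - 1) + ramp (2 - x))"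

definition step' :: "real \<Rightarrow> real" where
  "step' x = (2 * max 0 (x - 1) * (ramp (x - 1) + ramp (2 - x))
     - ramp (x - 1) * (2 * max 0 (x - 1) - 2 * max 0 (2 - x))) / (ramp (x - 1) + ramp (2 - x))\<^sup>2"

lemma ramp_nonneg: "0 \<le> ramp x"
  by (simp add: ramp_def)

lemma step_denom: "0 < ramp (x - 1) + ramp (2 - x)"
proof (cases "x > 1")
  case True
  then have "0 < ramp (x - 1)" by (simp add: ramp_def max_def)
  then show ?thesis using ramp_nonneg[of "2 - x"] by simp
next
  case False
  then have "0 < ramp (2 - x)" by (simp add: ramp_def max_def)
  then show ?thesis using ramp_nonneg[of "x - 1"] by simp
qed

lemma continuous_ramp: "continuous_on A ramp"
  unfolding ramp_def by (intro continuous_intros)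

lemma DERIV_step: "(step has_real_derivative step' x) (at x)"
proof -
  have 1: "((\<lambda>x. ramp (x - 1)) has_real_derivative 2 * max 0 (x - 1) * 1) (at x)"
    by (rule DERIV_chain2[OF DERIV_ramp]) (auto intro!: derivative_eq_intros)
  have 2: "((\<lambda>x. ramp (2 - x)) has_real_derivative 2 * max 0 (2 - x) * -1) (at x)"
    by (rule DERIV_chain2[OF DERIV_ramp]) (auto intro!: derivative_eq_intros)
  show ?thesis
    unfolding step_def[abs_def] step'_def
    by (rule DERIV_cong[OF DERIV_divide[OF 1 DERIV_add[OF 1 2]]])
       (use step_denom[of x] in \<open>simp_all add: power2_eq_square\<close>)
qed

lemma continuous_step': "continuous_on A step'"
  unfolding step'_def using step_denom
  by (intro continuous_intros continuous_on_compose2[OF continuous_ramp[of UNIV]]) (auto simp: less_imp_neq[symmetric])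

lemma step_le_1:
  assumes "x \<le> 1"
  shows "step x = 0" "step' x = 0"
proof -
  have "max 0 (x - 1) = 0" using assms by simp
  then show "step x = 0" "step' x = 0" by (simp_all add: step_def step'_def ramp_def)
qed

lemma step_ge_2:
  assumes "x \<ge> 2"
  shows "step x = 1" "step' x = 0"
proof -
  have "max 0 (2 - x) = 0" "max 0 (x - 1) = x - 1" using assms by simp_all
  then show "step x = 1" "step' x = 0" using assms by (simp_all add: step_def step'_def ramp_def)
qed

lemma abs_step_le: "\<bar>step x\<bar> \<le> 1"
  using step_denom[of x] ramp_nonneg[of "x - 1"] ramp_nonneg[of "2 - x"]
  unfolding step_def by (simp add: field_simps)

lemma step'_bounded: "\<exists>C\<ge>0. \<forall>x. \<bar>step' x\<bar> \<le> C"
proof -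
  have "bounded (step' ` {1..2})"
    by (intro compact_imp_bounded compact_continuous_image continuous_step') auto
  then obtain C where C: "\<forall>x\<in>{1..2}. \<bar>step' x\<bar> \<le> C" by (auto simp: bounded_iff)
  have "\<bar>step' x\<bar> \<le> max C 0" for x
  proof (cases "x \<in> {1..2}")
    case True
    then have "\<bar>step' x\<bar> \<le> C" using C by blast
    then show ?thesis by simp
  next
    case False
    then have "x \<le> 1 \<or> x \<ge> 2" by auto
    then show ?thesis using step_le_1(2)[of x] step_ge_2(2)[of x] by auto
  qed
  then show ?thesis by (intro exI[of _ "max C 0"]) auto
qed

text \<open>Zero within 1 / Suc k of either end point of [0, 1] and one at distance at least 2 / Suc
  k from both. The successor makes these widths meaningful for k = 0.\<close>

definition cutoff :: "nat \<Rightarrow> real \<Rightarrow> real" where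
  "cutoff k x = step (real (Suc k) * x) * step (real (Suc k) * (1 - x))"

definition cutoff' :: "nat \<Rightarrow> real \<Rightarrow> real" where
  "cutoff' k x = real (Suc k) * step' (real (Suc k) * x) * step (real (Suc k) * (1 - x))
    - real (Suc k) * step (real (Suc k) * x) * step' (real (Suc k) * (1 - x))"

lemma DERIV_cutoff: "(cutoff k has_real_derivative cutoff' k x) (at x)"
proof -
  note [simp del] = of_nat_Suc
  have 1: "((\<lambda>x. step (real (Suc k) * x)) has_real_derivative step' (real (Suc k) * x) * real (Suc k)) (at x)"
    by (rule DERIV_chain2[OF DERIV_step]) (auto intro!: derivative_eq_intros)
  have 2: "((\<lambda>x. step (real (Suc k) * (1 - x))) has_real_derivative step' (real (Suc k) * (1 - x)) * - real (Suc k)) (at x)"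
    by (rule DERIV_chain2[OF DERIV_step]) (auto intro!: derivative_eq_intros)
  show ?thesis
    unfolding cutoff_def[abs_def] cutoff'_def
    by (rule DERIV_cong[OF DERIV_mult[OF 1 2]]) (simp add: algebra_simps)
qed

lemma continuous_step: "continuous_on A step"
  using DERIV_step by (intro continuous_at_imp_continuous_on) (auto intro: DERIV_isCont)

lemma continuous_cutoff: "continuous_on A (cutoff k)"
  using DERIV_cutoff by (intro continuous_at_imp_continuous_on) (auto intro: DERIV_isCont)

lemma continuous_cutoff': "continuous_on A (cutoff' k)"
  unfolding cutoff'_def
  by (intro continuous_intros continuous_on_compose2[OF continuous_step[of UNIV]]
      continuous_on_compose2[OF continuous_step'[of UNIV]]) auto

lemma cutoff_support: "x \<notin> {1 / real (Suc k) .. 1 - 1 / real (Suc k)} \<Longrightarrow> cutoff k x = 0"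
  unfolding cutoff_def using step_le_1(1)[of "real (Suc k) * x"] step_le_1(1)[of "real (Suc k) * (1 - x)"]
  by (auto simp: field_simps simp del: of_nat_Suc)

lemma abs_cutoff_le: "\<bar>cutoff k x\<bar> \<le> 1"
  unfolding cutoff_def abs_mult using abs_step_le by (intro mult_le_one) auto

lemma eventually_cutoff:
  assumes "0 < x" "x < 1"
  shows "\<forall>\<^sub>F k in sequentially. cutoff k x = 1 \<and> cutoff' k x = 0"
proof -
  obtain K L where K: "2 < real K * x" and L: "2 < real L * (1 - x)"
    using reals_Archimedean3[of x] reals_Archimedean3[of "1 - x"] assms by force
  show ?thesis
  proof (rule eventually_sequentiallyI)
    fix k assume k: "max K L \<le> k"
    have "real K * x \<le> real (Suc k) * x" "real L * (1 - x) \<le> real (Suc k) * (1 - x)"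
      using k assms by (auto intro!: mult_right_mono)
    then have "2 \<le> real (Suc k) * x" "2 \<le> real (Suc k) * (1 - x)" using K L by linarith+
    then show "cutoff k x = 1 \<and> cutoff' k x = 0"
      unfolding cutoff_def cutoff'_def by (simp add: step_ge_2 step_ge_2)
  qed
qed

text \<open>Although \<open>cutoff'\<close> blows up near the end points, its product with a function that vanishes there
  to first order stays bounded.\<close>

lemma cutoff'_mult_bounded:
  assumes P: "\<And>x. 0 < x \<Longrightarrow> x < 1 \<Longrightarrow> \<bar>P x\<bar> \<le> B * x \<and> \<bar>P x\<bar> \<le> B * (1 - x)"
  shows "\<exists>C. \<forall>k x. 0 < x \<longrightarrow> x < 1 \<longrightarrow> \<bar>cutoff' k x * P x\<bar> \<le> C"
proof -
  obtain C where C: "0 \<le> C" "\<And>x. \<bar>step' x\<bar> \<le> C" using step'_bounded by blast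
  have B: "0 \<le> B" using P[of "1/2"] by simp
  have *: "\<bar>real (Suc k) * step' (real (Suc k) * y) * s * p\<bar> \<le> 2 * C * B"
    if y: "0 < y" and p: "\<bar>p\<bar> \<le> B * y" and s: "\<bar>s\<bar> \<le> 1" for k y s p
  \<comment> \<open>Beyond 2 the derivative \<open>step'\<close> vanishes. Below 2 the large factor
    \<open>Suc k\<close> is absorbed by |p| \<le> B y.\<close>
  proof (cases "real (Suc k) * y \<ge> 2")
    case True
    then show ?thesis using C B by (simp add: step_ge_2)
  next
    case False
    have "\<bar>real (Suc k) * step' (real (Suc k) * y) * s * p\<bar> = (real (Suc k) * \<bar>p\<bar>) * \<bar>step' (real (Suc k) * y)\<bar> * \<bar>s\<bar>"
      by (simp add: abs_mult)
    also have "\<dots> \<le> (2 * B) * C * 1"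
    proof (rule mult_mono[OF mult_mono[OF _ C(2)] s])
      have "real (Suc k) * \<bar>p\<bar> \<le> real (Suc k) * (B * y)" using p by (intro mult_left_mono) auto
      also have "\<dots> = B * (real (Suc k) * y)" by simp
      also have "\<dots> \<le> B * 2" using False B by (intro mult_left_mono) auto
      finally show "real (Suc k) * \<bar>p\<bar> \<le> 2 * B" by simp
    qed (use B C in auto)
    finally show ?thesis by (simp only: mult_1_right mult.assoc mult.commute[of C B])
  qed
  have "\<bar>cutoff' k x * P x\<bar> \<le> 4 * C * B" if "0 < x" "x < 1" for k x
  proof -
    let ?X = "real (Suc k) * step' (real (Suc k) * x) * step (real (Suc k) * (1 - x)) * P x"
    let ?Y = "real (Suc k) * step' (real (Suc k) * (1 - x)) * step (real (Suc k) * x) * P x"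
    have "cutoff' k x * P x = ?X - ?Y"
      by (simp add: cutoff'_def algebra_simps)
    moreover have "\<bar>?X\<bar> \<le> 2 * C * B" "\<bar>?Y\<bar> \<le> 2 * C * B"
      using P[OF that] that by (auto intro!: * abs_step_le simp del: of_nat_Suc)
    ultimately show ?thesis by linarith
  qed
  then show ?thesis by blast
qed


lemma gderiv_product:
  assumes F: "(F has_real_derivative F') (at (fst x))" and G: "(G has_real_derivative G') (at (snd x))"
  shows "GDERIV (\<lambda>x. F (fst x) * G (snd x)) x :> (F' * G (snd x), F (fst x) * G')"
proof -
  have 1: "((\<lambda>x. F (fst x)) has_derivative (\<lambda>h. F' * fst h)) (at x)"
    using has_derivative_compose[OF has_derivative_fst[OF has_derivative_ident]
        F[unfolded has_field_derivative_def]] by simp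
  have 2: "((\<lambda>x. G (snd x)) has_derivative (\<lambda>h. G' * snd h)) (at x)"
    using has_derivative_compose[OF has_derivative_snd[OF has_derivative_ident]
        G[unfolded has_field_derivative_def]] by simp
  show ?thesis
    unfolding gderiv_def using has_derivative_mult[OF 1 2]
    by (rule has_derivative_eq_rhs) (auto simp: fun_eq_iff inner_prod_def algebra_simps)
qed

lemma continuous_on_product:
  fixes F G :: "real \<Rightarrow> real"
  assumes "continuous_on UNIV F" "continuous_on UNIV G"
  shows "continuous_on UNIV (\<lambda>x::point. F (fst x) * G (snd x))"
  by (intro continuous_on_mult continuous_on_compose2[OF assms(1)]
      continuous_on_compose2[OF assms(2)] continuous_intros) auto

lemma has_real_derivative_continuous_on:
  assumes "\<And>x. (F has_real_derivative F' x) (at x)"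
  shows "continuous_on A F"
  using assms by (intro continuous_at_imp_continuous_on) (auto intro: DERIV_isCont)

lemma test_function_cutoff_product:
  assumes P: "\<And>x. (P has_real_derivative P' x) (at x)" "continuous_on UNIV P'"
    and Q: "\<And>x. (Q has_real_derivative Q' x) (at x)" "continuous_on UNIV Q'"
  shows "test_function unit_square (\<lambda>x. (cutoff k (fst x) * P (fst x)) * (cutoff k (snd x) * Q (snd x)))
    (\<lambda>x. ((cutoff' k (fst x) * P (fst x) + cutoff k (fst x) * P' (fst x)) * (cutoff k (snd x) * Q (snd x)),
          (cutoff k (fst x) * P (fst x)) * (cutoff' k (snd x) * Q (snd x) + cutoff k (snd x) * Q' (snd x))))"
  unfolding test_function_def
proof (intro conjI allI)
  have d: "((\<lambda>x. cutoff k x * R x) has_real_derivative cutoff' k x * R x + cutoff k x * R' x) (at x)"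
    if "\<And>x. (R has_real_derivative R' x) (at x)" for R R' and x :: real
    by (rule DERIV_cong[OF DERIV_mult[OF DERIV_cutoff that]]) simp
  show "GDERIV (\<lambda>x. (cutoff k (fst x) * P (fst x)) * (cutoff k (snd x) * Q (snd x))) x :>
     ((cutoff' k (fst x) * P (fst x) + cutoff k (fst x) * P' (fst x)) * (cutoff k (snd x) * Q (snd x)),
      (cutoff k (fst x) * P (fst x)) * (cutoff' k (snd x) * Q (snd x) + cutoff k (snd x) * Q' (snd x)))" for x
    by (rule gderiv_product[OF d[OF P(1)] d[OF Q(1)]])
  have c: "continuous_on UNIV P" "continuous_on UNIV Q"
    using P(1) Q(1) by (auto intro: has_real_derivative_continuous_on)
  show "continuous_on UNIV (\<lambda>x.
     ((cutoff' k (fst x) * P (fst x) + cutoff k (fst x) * P' (fst x)) * (cutoff k (snd x) * Q (snd x)),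
      (cutoff k (fst x) * P (fst x)) * (cutoff' k (snd x) * Q (snd x) + cutoff k (snd x) * Q' (snd x))))"
    by (intro continuous_on_Pair continuous_on_product[of "\<lambda>x. cutoff' k x * P x + cutoff k x * P' x" "\<lambda>x. cutoff k x * Q x"]
        continuous_on_product[of "\<lambda>x. cutoff k x * P x" "\<lambda>x. cutoff' k x * Q x + cutoff k x * Q' x"]
        continuous_on_mult continuous_on_add c P(2) Q(2) continuous_cutoff continuous_cutoff')
  let ?I = "{1 / real (Suc k) .. 1 - 1 / real (Suc k)}"
  show "\<exists>K. compact K \<and> K \<subseteq> unit_square \<and>
      (\<forall>x. x \<notin> K \<longrightarrow> (cutoff k (fst x) * P (fst x)) * (cutoff k (snd x) * Q (snd x)) = 0)"
  proof (intro exI conjI allI impI)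
    show "compact (?I \<times> ?I)" by (intro compact_Times) auto
    have "?I \<subseteq> {0<..<1}"
    proof
      fix x assume x: "x \<in> ?I"
      have "0 < 1 / real (Suc k)" by simp
      with x show "x \<in> {0<..<1}" unfolding atLeastAtMost_iff greaterThanLessThan_iff by linarith
    qed
    then show "?I \<times> ?I \<subseteq> unit_square" unfolding unit_square_def by blast
    fix x assume "x \<notin> ?I \<times> ?I"
    then have "fst x \<notin> ?I \<or> snd x \<notin> ?I" by (cases x) auto
    then show "(cutoff k (fst x) * P (fst x)) * (cutoff k (snd x) * Q (snd x)) = 0"
      using cutoff_support[of "fst x" k] cutoff_support[of "snd x" k] by auto
  qed
qed

text \<open>Dominated convergence with majorant B C |w|. Bounds and limits are assumed only inside
  the open interval, which is where the cutoffs satisfy them.\<close>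

lemma LINT_product_limit:
  fixes w :: "point \<Rightarrow> real" and F0 G0 :: "real \<Rightarrow> real" and F G :: "nat \<Rightarrow> real \<Rightarrow> real"
  assumes w: "integrable unit_measure w"
    and F: "\<And>k. continuous_on UNIV (F k)" "\<And>k x. 0 < x \<Longrightarrow> x < 1 \<Longrightarrow> \<bar>F k x\<bar> \<le> B"
      "\<And>x. 0 < x \<Longrightarrow> x < 1 \<Longrightarrow> (\<lambda>k. F k x) \<longlonglongrightarrow> F0 x" "continuous_on UNIV F0"
    and G: "\<And>k. continuous_on UNIV (G k)" "\<And>k x. 0 < x \<Longrightarrow> x < 1 \<Longrightarrow> \<bar>G k x\<bar> \<le> C"
      "\<And>x. 0 < x \<Longrightarrow> x < 1 \<Longrightarrow> (\<lambda>k. G k x) \<longlonglongrightarrow> G0 x" "continuous_on UNIV G0"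
  shows "(\<lambda>k. LINT x|unit_measure. w x * (F k (fst x) * G k (snd x))) \<longlonglongrightarrow> (LINT x|unit_measure. w x * (F0 (fst x) * G0 (snd x)))"
proof (rule integral_dominated_convergence[where w = "\<lambda>x. \<bar>w x\<bar> * (B * C)"])
  have m: "(\<lambda>x. F (fst x) * G (snd x)) \<in> borel_measurable unit_measure"
    if "continuous_on UNIV F" "continuous_on UNIV G" for F G :: "real \<Rightarrow> real"
    by (intro measurable_unit_measure borel_measurable_continuous_onI continuous_on_product that)
  have [measurable]: "w \<in> borel_measurable unit_measure" using w by auto
  show "(\<lambda>x. w x * (F0 (fst x) * G0 (snd x))) \<in> borel_measurable unit_measure"
    using m[OF F(4) G(4)] by measurable
  show "(\<lambda>x. w x * (F k (fst x) * G k (snd x))) \<in> borel_measurable unit_measure" for k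
    using m[OF F(1) G(1)] by measurable
  show "integrable unit_measure (\<lambda>x. \<bar>w x\<bar> * (B * C))"
    using w by (intro Bochner_Integration.integrable_mult_left integrable_abs)
  show "AE x in unit_measure. (\<lambda>k. w x * (F k (fst x) * G k (snd x))) \<longlonglongrightarrow> w x * (F0 (fst x) * G0 (snd x))"
    by (intro AE_I2 tendsto_mult tendsto_const F(3) G(3)) (auto simp: unit_square_def)
  show "AE x in unit_measure. norm (w x * (F k (fst x) * G k (snd x))) \<le> \<bar>w x\<bar> * (B * C)" for k
  proof (intro AE_I2)
    fix x assume "x \<in> space unit_measure"
    then have x: "0 < fst x" "fst x < 1" "0 < snd x" "snd x < 1" by (auto simp: unit_square_def)
    have "\<bar>F k (fst x)\<bar> * \<bar>G k (snd x)\<bar> \<le> B * C"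
      using F(2)[OF x(1,2), of k] by (intro mult_mono F(2) G(2) x) auto
    then show "norm (w x * (F k (fst x) * G k (snd x))) \<le> \<bar>w x\<bar> * (B * C)"
      by (simp add: abs_mult mult_left_mono)
  qed
qed

lemma integrable_fst_snd:
  fixes f :: "'a \<Rightarrow> point"
  assumes "integrable M f"
  shows "integrable M (\<lambda>x. fst (f x))" "integrable M (\<lambda>x. snd (f x))"
    and "(LINT x|M. fst (f x)) = fst (LINT x|M. f x)" "(LINT x|M. snd (f x)) = snd (LINT x|M. f x)"
  using integrable_bounded_linear[OF bounded_linear_fst assms] integrable_bounded_linear[OF bounded_linear_snd assms]
    integral_bounded_linear[OF bounded_linear_fst assms] integral_bounded_linear[OF bounded_linear_snd assms]
  by auto

lemma cutoff_limits:
  fixes P P' :: "real \<Rightarrow> real"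
  assumes "0 < x" "x < 1"
  shows "(\<lambda>k. cutoff k x * P x) \<longlonglongrightarrow> P x"
    and "(\<lambda>k. cutoff' k x * P x + cutoff k x * P' x) \<longlonglongrightarrow> P' x"
  using eventually_cutoff[OF assms] by (auto intro!: tendsto_eventually elim!: eventually_mono)

lemma cutoff_bounds:
  fixes P :: "real \<Rightarrow> real"
  assumes P: "continuous_on UNIV P"
  shows "\<exists>C. \<forall>k x. 0 < x \<longrightarrow> x < 1 \<longrightarrow> \<bar>cutoff k x * P x\<bar> \<le> C"
proof -
  have "bounded (P ` {0..1})"
    by (intro compact_imp_bounded compact_continuous_image continuous_on_subset[OF P]) auto
  then obtain C where C: "\<forall>x\<in>{0..1}. \<bar>P x\<bar> \<le> C" by (auto simp: bounded_iff)
  have "\<bar>cutoff k x * P x\<bar> \<le> 1 * C" if "0 < x" "x < 1" for k x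
    unfolding abs_mult by (intro mult_mono abs_cutoff_le C[rule_format]) (use that in auto)
  then show ?thesis by (intro exI[of _ C]) simp
qed

lemma cutoff_bounds':
  fixes P P' :: "real \<Rightarrow> real"
  assumes P: "\<And>x. 0 < x \<Longrightarrow> x < 1 \<Longrightarrow> \<bar>P x\<bar> \<le> B * x \<and> \<bar>P x\<bar> \<le> B * (1 - x)"
    and P': "continuous_on UNIV P'"
  shows "\<exists>C. \<forall>k x. 0 < x \<longrightarrow> x < 1 \<longrightarrow> \<bar>cutoff' k x * P x + cutoff k x * P' x\<bar> \<le> C"
proof -
  obtain C D where "\<And>k x. 0 < x \<Longrightarrow> x < 1 \<Longrightarrow> \<bar>cutoff' k x * P x\<bar> \<le> C"
    "\<And>k x. 0 < x \<Longrightarrow> x < 1 \<Longrightarrow> \<bar>cutoff k x * P' x\<bar> \<le> D"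
    using cutoff'_mult_bounded[OF P] cutoff_bounds[OF P'] by blast
  then have "\<bar>cutoff' k x * P x + cutoff k x * P' x\<bar> \<le> C + D" if "0 < x" "x < 1" for k x
    using that abs_triangle_ineq add_mono order_trans by meson
  then show ?thesis by blast
qed

lemma H1_components:
  assumes H: "H1 u g" and t: "test_function unit_square \<phi> D"
  shows "(LINT x|unit_measure. u x * fst (D x)) = - (LINT x|unit_measure. fst (g x) * \<phi> x)"
    and "(LINT x|unit_measure. u x * snd (D x)) = - (LINT x|unit_measure. snd (g x) * \<phi> x)"
proof -
  have 1: "integrable unit_measure (\<lambda>x. u x *\<^sub>R D x)" and 2: "integrable unit_measure (\<lambda>x. \<phi> x *\<^sub>R g x)"
    using H1_L2[OF H] test_function_continuous[OF t]
    by (auto intro: L2_integrable_scaleR continuous_L2_unit_measure)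
  have e: "(LINT x|unit_measure. u x *\<^sub>R D x) = - (LINT x|unit_measure. \<phi> x *\<^sub>R g x)"
    using H t unfolding H1_iff by blast
  show "(LINT x|unit_measure. u x * fst (D x)) = - (LINT x|unit_measure. fst (g x) * \<phi> x)"
    using arg_cong[OF e, of fst] integrable_fst_snd(3)[OF 1] integrable_fst_snd(3)[OF 2]
    by (simp add: mult.commute)
  show "(LINT x|unit_measure. u x * snd (D x)) = - (LINT x|unit_measure. snd (g x) * \<phi> x)"
    using arg_cong[OF e, of snd] integrable_fst_snd(4)[OF 1] integrable_fst_snd(4)[OF 2]
    by (simp add: mult.commute)
qed

text \<open>Integration by parts against a field \<open>(P Q, 0)\<close> resp. \<open>(0, P Q)\<close> that is tangential at the boundary.\<close>

lemma H1_by_parts: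
  assumes H: "H1 u g"
    and P: "\<And>x. (P has_real_derivative P' x) (at x)" "continuous_on UNIV P'"
      "\<And>x. 0 < x \<Longrightarrow> x < 1 \<Longrightarrow> \<bar>P x\<bar> \<le> B * x \<and> \<bar>P x\<bar> \<le> B * (1 - x)"
    and Q: "\<And>x. (Q has_real_derivative Q' x) (at x)" "continuous_on UNIV Q'"
  shows "(LINT x|unit_measure. u x * (P' (fst x) * Q (snd x))) = - (LINT x|unit_measure. fst (g x) * (P (fst x) * Q (snd x)))"
    and "(LINT x|unit_measure. u x * (Q (fst x) * P' (snd x))) = - (LINT x|unit_measure. snd (g x) * (Q (fst x) * P (snd x)))"
proof -
  have cP: "continuous_on UNIV P" and cQ: "continuous_on UNIV Q"
    using P(1) Q(1) by (auto intro: has_real_derivative_continuous_on)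
  have iu: "integrable unit_measure u" and ig: "integrable unit_measure g"
    using H1_L2[OF H] by (auto intro: L2_integrable finite_measure_unit_measure)
  obtain CP where CP: "\<And>k x. 0 < x \<Longrightarrow> x < 1 \<Longrightarrow> \<bar>cutoff k x * P x\<bar> \<le> CP" using cutoff_bounds[OF cP] by blast
  obtain CQ where CQ: "\<And>k x. 0 < x \<Longrightarrow> x < 1 \<Longrightarrow> \<bar>cutoff k x * Q x\<bar> \<le> CQ" using cutoff_bounds[OF cQ] by blast
  obtain CP' where CP': "\<And>k x. 0 < x \<Longrightarrow> x < 1 \<Longrightarrow> \<bar>cutoff' k x * P x + cutoff k x * P' x\<bar> \<le> CP'"
    using cutoff_bounds'[OF P(3) P(2)] by blast
  have c1: "continuous_on UNIV (\<lambda>x. cutoff k x * P x)" "continuous_on UNIV (\<lambda>x. cutoff k x * Q x)"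
    "continuous_on UNIV (\<lambda>x. cutoff' k x * P x + cutoff k x * P' x)" for k
    by (intro continuous_on_mult continuous_on_add continuous_cutoff continuous_cutoff' cP cQ P(2))+
  show "(LINT x|unit_measure. u x * (P' (fst x) * Q (snd x))) = - (LINT x|unit_measure. fst (g x) * (P (fst x) * Q (snd x)))"
  proof -
    have e: "(LINT x|unit_measure. u x * ((cutoff' k (fst x) * P (fst x) + cutoff k (fst x) * P' (fst x)) * (cutoff k (snd x) * Q (snd x))))
      = - (LINT x|unit_measure. fst (g x) * ((cutoff k (fst x) * P (fst x)) * (cutoff k (snd x) * Q (snd x))))" for k
    proof -
      note t = test_function_cutoff_product[OF P(1,2) Q, of k]
      show ?thesis
        using H1_components(1)[OF H t] by (simp only: fst_conv snd_conv)
    qed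
    have "(\<lambda>k. LINT x|unit_measure. u x * ((cutoff' k (fst x) * P (fst x) + cutoff k (fst x) * P' (fst x)) * (cutoff k (snd x) * Q (snd x))))
        \<longlonglongrightarrow> (LINT x|unit_measure. u x * (P' (fst x) * Q (snd x)))"
      by (rule LINT_product_limit[OF iu c1(3) CP' _ P(2) c1(2) CQ _ cQ]) (auto intro: cutoff_limits)
    moreover have "(\<lambda>k. - (LINT x|unit_measure. fst (g x) * ((cutoff k (fst x) * P (fst x)) * (cutoff k (snd x) * Q (snd x)))))
        \<longlonglongrightarrow> - (LINT x|unit_measure. fst (g x) * (P (fst x) * Q (snd x)))"
      by (rule tendsto_minus[OF LINT_product_limit[OF integrable_fst_snd(1)[OF ig] c1(1) CP _ cP c1(2) CQ _ cQ]])
        (auto intro: cutoff_limits)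
    ultimately show ?thesis unfolding e by (rule LIMSEQ_unique)
  qed
  show "(LINT x|unit_measure. u x * (Q (fst x) * P' (snd x))) = - (LINT x|unit_measure. snd (g x) * (Q (fst x) * P (snd x)))"
  proof -
    have e: "(LINT x|unit_measure. u x * ((cutoff k (fst x) * Q (fst x)) * (cutoff' k (snd x) * P (snd x) + cutoff k (snd x) * P' (snd x))))
      = - (LINT x|unit_measure. snd (g x) * ((cutoff k (fst x) * Q (fst x)) * (cutoff k (snd x) * P (snd x))))" for k
    proof -
      note t = test_function_cutoff_product[OF Q P(1,2), of k]
      show ?thesis
        using H1_components(2)[OF H t] by (simp only: fst_conv snd_conv)
    qed
    have "(\<lambda>k. LINT x|unit_measure. u x * ((cutoff k (fst x) * Q (fst x)) * (cutoff' k (snd x) * P (snd x) + cutoff k (snd x) * P' (snd x))))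
        \<longlonglongrightarrow> (LINT x|unit_measure. u x * (Q (fst x) * P' (snd x)))"
      by (rule LINT_product_limit[OF iu c1(2) CQ _ cQ c1(3) CP' _ P(2)]) (auto intro: cutoff_limits)
    moreover have "(\<lambda>k. - (LINT x|unit_measure. snd (g x) * ((cutoff k (fst x) * Q (fst x)) * (cutoff k (snd x) * P (snd x)))))
        \<longlonglongrightarrow> - (LINT x|unit_measure. snd (g x) * (Q (fst x) * P (snd x)))"
      by (rule tendsto_minus[OF LINT_product_limit[OF integrable_fst_snd(2)[OF ig] c1(2) CQ _ cQ c1(1) CP _ cP]])
        (auto intro: cutoff_limits)
    ultimately show ?thesis unfolding e by (rule LIMSEQ_unique)
  qed
qed

section \<open>Cosine coefficients and the Dirichlet energy\<close>

text \<open>First-order vanishing at both ends, in the form that integration by parts demands of its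
  factor \<open>P\<close>.\<close>

lemma sin_mode_boundary:
  assumes "0 < x" "x < 1"
  shows "\<bar>sin_mode m x\<bar> \<le> (2 * m * pi) * x \<and> \<bar>sin_mode m x\<bar> \<le> (2 * m * pi) * (1 - x)"
proof -
  have b: "\<bar>sin_mode m x\<bar> \<le> 2 * \<bar>sin (m * pi * x)\<bar>"
  proof -
    have "sqrt 2 \<le> 2" by (simp add: real_sqrt_le_iff')
    then show ?thesis unfolding sin_mode_def abs_mult by (intro mult_right_mono) auto
  qed
  have s: "\<bar>sin (m * pi * y)\<bar> \<le> m * pi * y" if "0 \<le> y" for y
    using abs_sin_x_le_abs_x[of "m * pi * y"] that by (simp add: abs_mult)
  \<comment> \<open>Reflection at the midpoint changes the sine by a sign only, so the bound at the
    left end also serves at the right end.\<close>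
  have "sin (m * pi * x) = sin (m * pi - m * pi * (1 - x))" by (simp add: algebra_simps)
  also have "\<dots> = - cos (m * pi) * sin (m * pi * (1 - x))"
    unfolding sin_diff by simp
  finally have "\<bar>sin (m * pi * x)\<bar> = \<bar>sin (m * pi * (1 - x))\<bar>"
    by (simp add: abs_mult cos_npi)
  with b s[of x] s[of "1 - x"] assms show ?thesis by simp
qed

text \<open>Integration by parts with a sine mode in the differentiated variable, whose derivative
  is m pi times the cosine mode. Frequency times coefficient of u thus becomes a coefficient of the
  weak gradient in another orthonormal system; at frequency 0 both sides vanish.\<close>

lemma H1_coeff:
  assumes H: "H1 u g"
  shows "m * pi * ip unit_measure u (cc (m, n)) = - ip unit_measure (\<lambda>x. fst (g x)) (sc (m, n))"
    and "n * pi * ip unit_measure u (cc (m, n)) = - ip unit_measure (\<lambda>x. snd (g x)) (cs (m, n))"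
proof -
  have d: "continuous_on UNIV (\<lambda>x. real k * pi * cos_mode k x)" for k
    by (intro continuous_intros continuous_cos_mode)
  have Q: "(cos_mode k has_real_derivative (if k = 0 then 1 else sqrt 2) * (- sin (k * pi * x) * (k * pi))) (at x)" for k x
    unfolding cos_mode_def[abs_def] by (auto intro!: derivative_eq_intros)
  have Q': "continuous_on UNIV (\<lambda>x. (if k = 0 then 1 else sqrt 2) * (- sin (real k * pi * x) * (real k * pi)))" for k :: nat
    by (intro continuous_intros)
  note 1 = H1_by_parts(1)[OF H DERIV_sin_mode d sin_mode_boundary Q Q', of m n]
  note 2 = H1_by_parts(2)[OF H DERIV_sin_mode d sin_mode_boundary Q Q', of m n]
  have "m * pi * ip unit_measure u (cc (m, n)) = (LINT x|unit_measure. m * pi * (u x \<bullet> cc (m, n) x))"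
    unfolding ip_def by simp
  also have "\<dots> = - ip unit_measure (\<lambda>x. fst (g x)) (sc (m, n))"
    using 1 by (simp add: ip_def cc_def sc_def ac_simps)
  finally show "m * pi * ip unit_measure u (cc (m, n)) = - ip unit_measure (\<lambda>x. fst (g x)) (sc (m, n))" .
  have "n * pi * ip unit_measure u (cc (m, n)) = (LINT x|unit_measure. n * pi * (u x \<bullet> cc (m, n) x))"
    unfolding ip_def by simp
  also have "\<dots> = - ip unit_measure (\<lambda>x. snd (g x)) (cs (m, n))"
    using 2 by (simp add: ip_def cc_def cs_def ac_simps)
  finally show "n * pi * ip unit_measure u (cc (m, n)) = - ip unit_measure (\<lambda>x. snd (g x)) (cs (m, n))" .
qed

lemma nsq_point:
  assumes "L2 M g"
  shows "nsq M g = nsq M (\<lambda>x. fst (g x)) + nsq M (\<lambda>x. snd (g x))"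
    and "L2 M (\<lambda>x. fst (g x :: point))" "L2 M (\<lambda>x. snd (g x))"
proof -
  show l: "L2 M (\<lambda>x. fst (g x :: point))" "L2 M (\<lambda>x. snd (g x))"
    using assms by (auto intro: L2_linear linear_fst linear_snd)
  have e: "(norm (g x))\<^sup>2 = (norm (fst (g x)))\<^sup>2 + (norm (snd (g x)))\<^sup>2" for x
    by (simp add: norm_prod_def)
  show "nsq M g = nsq M (\<lambda>x. fst (g x)) + nsq M (\<lambda>x. snd (g x))"
    unfolding nsq_def e using l by (intro Bochner_Integration.integral_add L2_integrable_sq)
qed

text \<open>Bessel's inequality, applied to each component of the gradient in its own sine-cosine
  system; the two weights add up to the Neumann eigenvalue of the mode.\<close>

lemma sum_coeff_le:
  assumes H: "H1 u g" and fin: "finite A"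
  shows "(\<Sum>p\<in>A. ((real (fst p) * pi)\<^sup>2 + (real (snd p) * pi)\<^sup>2) * (ip unit_measure u (cc p))\<^sup>2) \<le> nsq unit_measure g"
proof -
  note g = nsq_point[OF H1_L2(2)[OF H]]
  have 1: "(\<Sum>p\<in>A. (fst p * pi * ip unit_measure u (cc p))\<^sup>2) \<le> nsq unit_measure (\<lambda>x. fst (g x))"
  proof -
    \<comment> \<open>The sine system starts at frequency 1; the discarded terms carry the factor
      0.\<close>
    have "(\<Sum>p\<in>A. (fst p * pi * ip unit_measure u (cc p))\<^sup>2) = (\<Sum>p\<in>A \<inter> {0<..} \<times> UNIV. (fst p * pi * ip unit_measure u (cc p))\<^sup>2)"
      using fin by (intro sum.mono_neutral_right) auto
    also have "\<dots> = (\<Sum>p\<in>A \<inter> {0<..} \<times> UNIV. (ip unit_measure (\<lambda>x. fst (g x)) (sc p))\<^sup>2)"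
      using H1_coeff(1)[OF H] by (intro sum.cong) auto
    also have "\<dots> \<le> nsq unit_measure (\<lambda>x. fst (g x))"
      using fin g(2) by (intro Bessel orthonormal_subset[OF orthonormal_sc]) auto
    finally show ?thesis .
  qed
  have 2: "(\<Sum>p\<in>A. (snd p * pi * ip unit_measure u (cc p))\<^sup>2) \<le> nsq unit_measure (\<lambda>x. snd (g x))"
  proof -
    have "(\<Sum>p\<in>A. (snd p * pi * ip unit_measure u (cc p))\<^sup>2) = (\<Sum>p\<in>A \<inter> UNIV \<times> {0<..}. (snd p * pi * ip unit_measure u (cc p))\<^sup>2)"
      using fin by (intro sum.mono_neutral_right) auto
    also have "\<dots> = (\<Sum>p\<in>A \<inter> UNIV \<times> {0<..}. (ip unit_measure (\<lambda>x. snd (g x)) (cs p))\<^sup>2)"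
      using H1_coeff(2)[OF H] by (intro sum.cong) auto
    also have "\<dots> \<le> nsq unit_measure (\<lambda>x. snd (g x))"
      using fin g(3) by (intro Bessel orthonormal_subset[OF orthonormal_cs]) auto
    finally show ?thesis .
  qed
  have "(\<Sum>p\<in>A. ((fst p * pi)\<^sup>2 + (snd p * pi)\<^sup>2) * (ip unit_measure u (cc p))\<^sup>2)
      = (\<Sum>p\<in>A. (fst p * pi * ip unit_measure u (cc p))\<^sup>2) + (\<Sum>p\<in>A. (snd p * pi * ip unit_measure u (cc p))\<^sup>2)"
    by (simp add: power_mult_distrib distrib_right sum.distrib)
  then show ?thesis using 1 2 g(1) by linarith
qed

text \<open>For \<open>N = 1\<close> this is the Poincare inequality with its optimal constant; for large \<open>N\<close> it gives
  the compactness of the embedding of \<open>H\<^sup>1\<close> into \<open>L\<^sup>2\<close>.\<close>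

lemma H1_tail:
  assumes H: "H1 u g" and N: "N \<ge> 1"
  shows "nsq unit_measure (\<lambda>x. u x - cosine_projection N u x) \<le> nsq unit_measure g / (N * pi)\<^sup>2"
proof -
  have u: "L2 unit_measure u" by (rule H1_L2[OF H])
  have lim: "(\<lambda>K. nsq unit_measure (\<lambda>x. cosine_projection K u x - cosine_projection N u x)) \<longlonglongrightarrow> nsq unit_measure (\<lambda>x. u x - cosine_projection N u x)"
    using cosine_projection_converges[OF u]
    by (intro tendsto_nsq L2_diff L2_cosine_projection u) (simp add: algebra_simps)
  have "nsq unit_measure (\<lambda>x. cosine_projection K u x - cosine_projection N u x) \<le> nsq unit_measure g / (N * pi)\<^sup>2" if K: "K \<ge> N" for K
  proof -
    let ?A = "{..<K} \<times> {..<K} - {..<N} \<times> {..<N}"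
    have "(N * pi)\<^sup>2 * (\<Sum>p\<in>?A. (ip unit_measure u (cc p))\<^sup>2)
        \<le> (\<Sum>p\<in>?A. ((fst p * pi)\<^sup>2 + (snd p * pi)\<^sup>2) * (ip unit_measure u (cc p))\<^sup>2)"
      unfolding sum_distrib_left
    proof (intro sum_mono mult_right_mono)
      fix p assume "p \<in> ?A"
      \<comment> \<open>Outside the block one frequency is at least N, so one of the two summands of
        the weight already reaches (N pi)^2.\<close>
      then have "N \<le> fst p \<or> N \<le> snd p" by auto
      then have "(N * pi)\<^sup>2 \<le> (fst p * pi)\<^sup>2 \<or> (N * pi)\<^sup>2 \<le> (snd p * pi)\<^sup>2"
        by (auto intro!: power_mono)
      then show "(N * pi)\<^sup>2 \<le> (fst p * pi)\<^sup>2 + (snd p * pi)\<^sup>2"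
        using zero_le_power2[of "fst p * pi"] zero_le_power2[of "snd p * pi"] by linarith
    qed simp
    also have "\<dots> \<le> nsq unit_measure g" by (rule sum_coeff_le[OF H]) simp
    finally show ?thesis
      unfolding nsq_cosine_projection_diff[OF K] using N by (simp add: field_simps)
  qed
  then show ?thesis using lim by (intro LIMSEQ_le_const2[OF lim]) blast
qed

lemma cosine_projection_1: "cosine_projection 1 u x = (LINT x|unit_measure. u x)"
proof -
  have "{..<1} \<times> {..<1} = {(0::nat, 0::nat)}" by auto
  then show ?thesis by (simp add: cosine_projection_def ip_def)
qed

lemma Poincare:
  assumes "H1 u g" "(LINT x|unit_measure. u x) = 0"
  shows "pi\<^sup>2 * nsq unit_measure u \<le> nsq unit_measure g"
  using H1_tail[OF assms(1), of 1] assms(2) unfolding cosine_projection_1 by (simp add: field_simps)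

section \<open>Smooth functions as Sobolev functions\<close>

lemma LINT_compact_support_deriv:
  fixes F F' :: "real \<Rightarrow> real"
  assumes d: "\<And>x. (F has_real_derivative F' x) (at x)" and c: "continuous_on UNIV F'"
    and 0: "\<And>x. x \<notin> {0<..<1} \<Longrightarrow> F x = 0" "\<And>x. x \<notin> {0<..<1} \<Longrightarrow> F' x = 0"
  shows "(LINT x|lborel. F' x) = 0"
proof -
  have "(LINT x|lborel. F' x) = (LINT x|lborel. indicator {0<..<1} x * F' x)"
    using 0(2) by (intro Bochner_Integration.integral_cong) (auto simp: indicator_def)
  also have "\<dots> = integral {0..1} F'" by (rule LINT_unit_interval[OF c])
  also have "\<dots> = F 1 - F 0"
    using d by (intro integral_unique fundamental_theorem_of_calculus)
      (auto simp flip: has_real_derivative_iff_has_vector_derivative intro: has_field_derivative_at_within)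
  finally show ?thesis by (simp add: 0)
qed

text \<open>The fundamental theorem of calculus on each line parallel to an axis, combined with
  Fubini; the end values vanish by compact support.\<close>

lemma LINT_test_gradient:
  assumes t: "test_function unit_square \<psi> D"
  shows "(LINT x|unit_measure. D x) = 0"
proof -
  obtain K where K: "compact K" "K \<subseteq> unit_square" "\<And>x. x \<notin> K \<Longrightarrow> \<psi> x = 0"
    using t by (auto simp: test_function_def)
  have g: "GDERIV \<psi> x :> D x" for x using t unfolding test_function_def by blast
  have cD: "continuous_on UNIV D" by (rule test_function_continuous[OF t])
  \<comment> \<open>The support condition speaks of the function only. The gradient vanishes too
    because the complement of the compact support set is open.\<close>
  have D0: "D x = 0" if x: "x \<notin> unit_square" for x
  proof -
    have "open (- K)" "x \<in> - K" using K(1,2) x by (auto simp: compact_imp_closed open_Compl)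
    moreover have "GDERIV (\<lambda>x. 0) x :> 0" by (rule GDERIV_const)
    ultimately have "GDERIV \<psi> x :> 0"
      unfolding gderiv_def using K(3)
      by (elim has_derivative_transform_within_open) auto
    then have "(\<lambda>h. h \<bullet> D x) = (\<lambda>h. h \<bullet> 0)"
      using g[of x] unfolding gderiv_def by (rule has_derivative_unique[symmetric])
    then have "D x \<bullet> D x = 0" by (metis inner_zero_right)
    then show ?thesis by simp
  qed
  have \<psi>0: "\<psi> x = 0" if "x \<notin> unit_square" for x using K that by blast
  have iD: "integrable unit_measure D"
    by (intro L2_integrable[OF finite_measure_unit_measure] continuous_L2_unit_measure cD)
  have id: "(\<lambda>x. indicator unit_square x *\<^sub>R D x) = D"
    using D0 by (auto simp: fun_eq_iff indicator_def)
  have iL: "integrable lborel D"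
    using iD unfolding integrable_unit_measure set_integrable_def id .
  have eL: "(LINT x|unit_measure. D x) = (LINT x|lborel. D x)"
    unfolding integral_unit_measure set_lebesgue_integral_def id ..
  have dx: "((\<lambda>s. \<psi> (s, y)) has_real_derivative fst (D (s, y))) (at s)" for s y
  proof -
    have "((\<lambda>s. (s, y)) has_derivative (\<lambda>h. (h, 0))) (at s)"
      by (auto intro!: derivative_eq_intros)
    then have "((\<lambda>s. \<psi> (s, y)) has_derivative (\<lambda>h. (h, 0) \<bullet> D (s, y))) (at s)"
      using g[of "(s, y)"] unfolding gderiv_def by (rule has_derivative_compose)
    then show ?thesis
      unfolding has_field_derivative_def by (rule has_derivative_eq_rhs) (auto simp: inner_prod_def fun_eq_iff)
  qed
  have dy: "((\<lambda>s. \<psi> (x, s)) has_real_derivative snd (D (x, s))) (at s)" for s x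
  proof -
    have "((\<lambda>s. (x, s)) has_derivative (\<lambda>h. (0, h))) (at s)"
      by (auto intro!: derivative_eq_intros)
    then have "((\<lambda>s. \<psi> (x, s)) has_derivative (\<lambda>h. (0, h) \<bullet> D (x, s))) (at s)"
      using g[of "(x, s)"] unfolding gderiv_def by (rule has_derivative_compose)
    then show ?thesis
      unfolding has_field_derivative_def by (rule has_derivative_eq_rhs) (auto simp: inner_prod_def fun_eq_iff)
  qed
  have nin: "(s, y) \<notin> unit_square" if "s \<notin> {0<..<1}" for s y :: real
    using that by (auto simp: unit_square_def)
  have nin': "(x, s) \<notin> unit_square" if "s \<notin> {0<..<1}" for s x :: real
    using that by (auto simp: unit_square_def)
  have "(LINT s|lborel. fst (D (s, y))) = 0" for y
    by (rule LINT_compact_support_deriv[OF dx])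
      (auto simp: \<psi>0[OF nin] D0[OF nin] intro!: continuous_intros continuous_on_compose2[OF cD])
  moreover have "(LINT y|lborel. LINT s|lborel. fst (D (s, y))) = (LINT x|lborel. fst (D x))"
    using lborel_pair.integral_snd[of "\<lambda>s y. fst (D (s, y))"] integrable_fst_snd(1)[OF iL]
    by (simp add: lborel_prod case_prod_beta')
  ultimately have 1: "fst (LINT x|lborel. D x) = 0"
    using integrable_fst_snd(3)[OF iL] by simp
  have "(LINT s|lborel. snd (D (x, s))) = 0" for x
    by (rule LINT_compact_support_deriv[OF dy])
      (auto simp: \<psi>0[OF nin'] D0[OF nin'] intro!: continuous_intros continuous_on_compose2[OF cD])
  moreover have "(LINT x|lborel. LINT s|lborel. snd (D (x, s))) = (LINT x|lborel. snd (D x))"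
    using lborel_pair.integral_fst[of "\<lambda>x s. snd (D (x, s))"] integrable_fst_snd(2)[OF iL]
    by (simp add: lborel_prod case_prod_beta')
  ultimately have 2: "snd (LINT x|lborel. D x) = 0"
    using integrable_fst_snd(4)[OF iL] by simp
  show ?thesis unfolding eL using 1 2 by (simp add: prod_eq_iff)
qed

text \<open>The product of u with a test function is again a test function, and its gradient has
  integral zero; the product rule turns this into the weak identity. Constants and the first cosine
  enter H1 in this way.\<close>

lemma H1_smooth:
  assumes u: "\<And>x. GDERIV u x :> Du x" and c: "continuous_on UNIV Du"
  shows "H1 u Du"
  unfolding H1_iff
proof (intro conjI allI impI)
  have "isCont u x" for x
    using has_derivative_continuous[OF u[unfolded gderiv_def]] .
  then have cu: "continuous_on UNIV u" by (simp add: continuous_at_imp_continuous_on)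
  show L: "L2 unit_measure u" "L2 unit_measure Du" using cu c by (auto intro: continuous_L2_unit_measure)
  fix \<phi> D assume t: "test_function unit_square \<phi> D"
  have L': "L2 unit_measure \<phi>" "L2 unit_measure D" using test_function_continuous[OF t] by (auto intro: continuous_L2_unit_measure)
  have "test_function unit_square (\<lambda>x. u x * \<phi> x) (\<lambda>x. u x *\<^sub>R D x + \<phi> x *\<^sub>R Du x)"
    unfolding test_function_def
  proof (intro conjI allI)
    show "GDERIV (\<lambda>x. u x * \<phi> x) x :> u x *\<^sub>R D x + \<phi> x *\<^sub>R Du x" for x
      using t u unfolding test_function_def by (intro GDERIV_mult) blast+
    show "continuous_on UNIV (\<lambda>x. u x *\<^sub>R D x + \<phi> x *\<^sub>R Du x)"
      using test_function_continuous[OF t] cu c by (intro continuous_intros)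
    obtain K where "compact K" "K \<subseteq> unit_square" "\<forall>x. x \<notin> K \<longrightarrow> \<phi> x = 0"
      using t by (auto simp: test_function_def)
    then show "\<exists>K. compact K \<and> K \<subseteq> unit_square \<and> (\<forall>x. x \<notin> K \<longrightarrow> u x * \<phi> x = 0)"
      by (intro exI[of _ K]) simp
  qed
  then have "(LINT x|unit_measure. u x *\<^sub>R D x + \<phi> x *\<^sub>R Du x) = 0" by (rule LINT_test_gradient)
  then have "(LINT x|unit_measure. u x *\<^sub>R D x) + (LINT x|unit_measure. \<phi> x *\<^sub>R Du x) = 0"
    using Bochner_Integration.integral_add[OF L2_integrable_scaleR[OF L(1) L'(2)] L2_integrable_scaleR[OF L'(1) L(2)]]
    by simp
  then show "(LINT x|unit_measure. u x *\<^sub>R D x) = - (LINT x|unit_measure. \<phi> x *\<^sub>R Du x)"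
    by (simp add: eq_neg_iff_add_eq_0)
qed

lemma H1_const: "H1 (\<lambda>x. c) (\<lambda>x. 0)"
  by (rule H1_smooth) (auto intro: GDERIV_const)

lemma H1_first_cosine: "H1 (cc (1, 0)) (\<lambda>x. (- pi * sc (1, 0) x) *\<^sub>R (1, 0))"
proof (rule H1_smooth)
  have "(cos_mode 1 has_real_derivative - pi * sin_mode 1 y) (at y)" for y
    unfolding cos_mode_def[abs_def] sin_mode_def by (auto intro!: derivative_eq_intros)
  from gderiv_product[OF this, of "\<lambda>x. 1" 0]
  show "GDERIV (cc (1, 0)) x :> (- pi * sc (1, 0) x) *\<^sub>R (1, 0)" for x
    by (simp add: cc_def[abs_def] sc_def)
  show "continuous_on UNIV (\<lambda>x::point. (- pi * sc (1, 0) x) *\<^sub>R (1::real, 0::real))"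
    unfolding sc_def by (intro continuous_intros continuous_on_compose2[OF continuous_sin_mode[of UNIV]]
      continuous_on_compose2[OF continuous_cos_mode[of UNIV]]) auto
qed


section \<open>Existence of a minimiser and its Euler-Lagrange equation\<close>

text \<open>The first-variation principle: b is half the derivative at t = 0 of a function that has
  its minimum 0 there.\<close>

lemma quadratic_nonneg_imp_linear_zero:
  fixes b c :: real
  assumes "\<And>t. 0 \<le> 2 * t * b + t\<^sup>2 * c"
  shows "b = 0"
proof (rule ccontr)
  assume "b \<noteq> 0"
  \<comment> \<open>With t = - b / k the polynomial becomes b^2 (c - 2 k) / k^2, which is negative
    because c < k.\<close>
  define k where "k = \<bar>c\<bar> + 1"
  have k: "k > 0" "c < k" unfolding k_def by auto
  have "0 \<le> 2 * (- b / k) * b + (- b / k)\<^sup>2 * c" by (rule assms)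
  also have "\<dots> = b\<^sup>2 / k\<^sup>2 * (c - 2 * k)"
    using k by (simp add: field_simps power2_eq_square)
  also have "\<dots> < 0"
    using k \<open>b \<noteq> 0\<close> by (intro mult_pos_neg) auto
  finally show False by simp
qed

text \<open>The direct method: a minimising sequence is \<open>L\<^sup>2\<close>-Cauchy along a subsequence by \<open>H1_tail\<close>, and
  the parallelogram law then makes its gradients Cauchy.\<close>

theorem exists_second_eigenfunction:
  fixes A :: "point \<Rightarrow> point"
  assumes A: "linear A" "inj A"
  obtains u g \<mu> where "H1 u g" "(LINT x|unit_measure. u x) = 0" "nsq unit_measure u = 1" "\<mu> \<le> pi\<^sup>2 * (norm (A (1, 0)))\<^sup>2"
    "\<And>v h. H1 v h \<Longrightarrow> ip unit_measure (\<lambda>x. A (g x)) (\<lambda>x. A (h x)) = \<mu> * ip unit_measure u v"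
proof -
  \<comment> \<open>The energy of the transported problem: A will be the adjoint of the inverse
    linear part, which maps gradients on the square to gradients on the parallelogram.\<close>
  define E where "E g = nsq unit_measure (\<lambda>x. A (g x))" for g :: "point \<Rightarrow> point"
  define adm where "adm u g \<longleftrightarrow> H1 u g \<and> (LINT x|unit_measure. u x) = 0 \<and> nsq unit_measure u = 1" for u g
  define \<mu> where "\<mu> = Inf {E g |u g. adm u g}"
  have LA: "L2 unit_measure (\<lambda>x. A (g x))" if "L2 unit_measure g" for g using that A(1) by (rule L2_linear)
  have AL: "A (x + c *\<^sub>R y) = A x + c *\<^sub>R A y" "A (x - y) = A x - A y" for x y c
    using A(1) by (simp_all add: linear_add linear_scale linear_diff)
  have mean: "(LINT x|unit_measure. u x) = ip unit_measure u (cc (0, 0))" for u by (simp add: ip_def)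
  have E0: "0 \<le> E g" for g by (simp add: E_def nsq_nonneg)
  have bdd: "bdd_below {E g |u g. adm u g}"
    using E0 by (intro bdd_belowI[of _ 0]) auto
  have \<mu>0: "\<mu> \<le> E g" if "adm u g" for u g
    unfolding \<mu>_def using bdd that by (intro cInf_lower) auto
  have first: "adm (cc (1, 0)) (\<lambda>x. (- pi * sc (1, 0) x) *\<^sub>R (1, 0))"
    unfolding adm_def mean nsq_eq_ip
    using H1_first_cosine orthonormalD[OF orthonormal_cc, of "(1, 0)"] by (simp del: cc_0 scaleR_Pair)
  have E1: "E (\<lambda>x. (- pi * sc (1, 0) x) *\<^sub>R (1, 0)) = pi\<^sup>2 * (norm (A (1, 0)))\<^sup>2"
  proof -
    have "(norm (A ((- pi * sc (1, 0) x) *\<^sub>R (1, 0))))\<^sup>2 = pi\<^sup>2 * (norm (A (1, 0)))\<^sup>2 * (sc (1, 0) x)\<^sup>2" for x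
      unfolding linear_scale[OF A(1)] by (simp add: power_mult_distrib)
    then have "E (\<lambda>x. (- pi * sc (1, 0) x) *\<^sub>R (1, 0)) = pi\<^sup>2 * (norm (A (1, 0)))\<^sup>2 * nsq unit_measure (sc (1, 0))"
      unfolding E_def nsq_def by simp
    then show ?thesis
      unfolding nsq_eq_ip using orthonormalD[OF orthonormal_sc, of "(1, 0)" "(1, 0)"] by simp
  qed
  have le1: "\<mu> \<le> pi\<^sup>2 * (norm (A (1, 0)))\<^sup>2" using \<mu>0[OF first] unfolding E1 .
  \<comment> \<open>Homogeneity extends the lower bound from normalised functions to all functions
    of mean zero; those of norm zero have to be split off because they cannot be normalised.\<close>
  have low: "\<mu> * nsq unit_measure w \<le> E h" if H: "H1 w h" and m: "(LINT x|unit_measure. w x) = 0" for w h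
  proof (cases "nsq unit_measure w = 0")
    case True
    then show ?thesis using E0 by simp
  next
    case False
    then have pos: "nsq unit_measure w > 0" using nsq_nonneg[of unit_measure w] by simp
    define c where "c = 1 / sqrt (nsq unit_measure w)"
    have c2: "c\<^sup>2 = 1 / nsq unit_measure w" using pos by (simp add: c_def power_divide)
    have "H1 (\<lambda>x. 0 + c * w x) (\<lambda>x. 0 + c *\<^sub>R h x)"
      by (rule H1_add_scale[OF H1_const H])
    then have "adm (\<lambda>x. c * w x) (\<lambda>x. c *\<^sub>R h x)"
      unfolding adm_def using m nsq_scaleR[of unit_measure c w] pos by (simp add: c2)
    from \<mu>0[OF this] have "\<mu> \<le> c\<^sup>2 * E h"
      unfolding E_def linear_scale[OF A(1)] nsq_scaleR .
    then show ?thesis using pos by (simp add: c2 field_simps)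
  qed
  have "\<exists>u g. adm u g \<and> E g < \<mu> + 1 / real (Suc n)" for n
  proof -
    have "{E g |u g. adm u g} \<noteq> {}" using first by blast
    then have "\<exists>e\<in>{E g |u g. adm u g}. e < \<mu> + 1 / real (Suc n)"
      unfolding \<mu>_def by (intro cInf_lessD) simp_all
    then show ?thesis by blast
  qed
  then obtain U0 G0 where UG0: "\<And>n. adm (U0 n) (G0 n)" "\<And>n. E (G0 n) < \<mu> + 1 / real (Suc n)"
    by metis
  have bd: "norm (ip unit_measure (U0 n) (cc p)) \<le> 1" for n p
  proof -
    have "(ip unit_measure (U0 n) (cc p))\<^sup>2 \<le> nsq unit_measure (U0 n) * nsq unit_measure (cc p)"
      using UG0(1)[of n] by (intro ip_Cauchy_Schwarz L2_cc) (auto simp: adm_def intro: H1_L2)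
    also have "\<dots> = 1"
      using UG0(1)[of n] orthonormalD[OF orthonormal_cc, of p p] by (simp add: adm_def nsq_eq_ip)
    finally show ?thesis by (simp add: abs_square_le_1)
  qed
  \<comment> \<open>Each cosine coefficient is bounded by 1 along the minimising sequence and there
    are countably many, so a diagonal subsequence makes all of them converge.\<close>
  obtain r where r: "strict_mono (r :: nat \<Rightarrow> nat)"
    "\<And>p. p \<in> UNIV \<Longrightarrow> \<exists>l. (\<lambda>n. ip unit_measure (U0 (r n)) (cc p)) \<longlonglongrightarrow> l"
    by (rule function_convergent_subsequence[of UNIV "\<lambda>n p. ip unit_measure (U0 n) (cc p)" 1]) (use bd in auto)
  define U where "U n = U0 (r n)" for n
  define G where "G n = G0 (r n)" for n
  obtain l where l: "\<And>p. (\<lambda>n. ip unit_measure (U n) (cc p)) \<longlonglongrightarrow> l p"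
    using r(2) unfolding U_def by (metis UNIV_I)
  have U: "H1 (U n) (G n)" "(LINT x|unit_measure. U n x) = 0" "nsq unit_measure (U n) = 1" for n
    using UG0(1)[of "r n"] by (auto simp: adm_def U_def G_def)
  have UL: "L2 unit_measure (U n)" "L2 unit_measure (G n)" for n using H1_L2[OF U(1)] by auto
  have EG: "E (G n) < \<mu> + 1 / real (Suc n)" "\<mu> \<le> E (G n)" for n
  proof -
    have "1 / real (Suc (r n)) \<le> 1 / real (Suc n)"
      using seq_suble[OF r(1), of n] by (intro divide_left_mono) auto
    then show "E (G n) < \<mu> + 1 / real (Suc n)" unfolding G_def using UG0(2)[of "r n"] by linarith
    show "\<mu> \<le> E (G n)" unfolding G_def using UG0(1) by (rule \<mu>0)
  qed
  \<comment> \<open>Injectivity of A is the ellipticity of the form: the energy controls the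
    gradient.\<close>
  obtain B where B: "B > 0" "\<And>x. B * norm x \<le> norm (A x)"
    using linear_inj_bounded_below_pos[OF A] by blast
  have coer: "B\<^sup>2 * nsq unit_measure g \<le> E g" if g: "L2 unit_measure g" for g
  proof -
    have "B\<^sup>2 * nsq unit_measure g = (LINT x|unit_measure. B\<^sup>2 * (norm (g x))\<^sup>2)" by (simp add: nsq_def)
    also have "\<dots> \<le> E g"
      unfolding E_def nsq_def
    proof (rule integral_mono)
      show "integrable unit_measure (\<lambda>x. B\<^sup>2 * (norm (g x))\<^sup>2)"
        using L2_integrable_sq[OF g] by (rule Bochner_Integration.integrable_mult_right)
      show "integrable unit_measure (\<lambda>x. (norm (A (g x)))\<^sup>2)" by (rule L2_integrable_sq[OF LA[OF g]])
      show "B\<^sup>2 * (norm (g x))\<^sup>2 \<le> (norm (A (g x)))\<^sup>2" for x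
        unfolding power_mult_distrib[symmetric] using B by (intro power_mono) auto
    qed
    finally show ?thesis .
  qed
  \<comment> \<open>The parallelogram law for the energy; the factor 1 gives the sum the shape of
    \<open>H1_add_scale\<close>.\<close>
  have Ediff: "E (\<lambda>x. G m x - G n x) \<le> 2 * E (G m) + 2 * E (G n) - E (\<lambda>x. G m x + 1 *\<^sub>R G n x)" for m n
    unfolding E_def AL using nsq_diff[OF LA[OF UL(2)] LA[OF UL(2)], of m n]
      nsq_add[OF LA[OF UL(2)] LA[OF UL(2)], of m n] by simp
  have Hdiff: "H1 (\<lambda>x. U m x + c * U n x) (\<lambda>x. G m x + c *\<^sub>R G n x)" for c m n
    by (rule H1_add_scale[OF U(1) U(1)])
  have mdiff: "(LINT x|unit_measure. U m x + c * U n x) = 0" for c m n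
    using L2_integrable[OF finite_measure_unit_measure UL(1)] U(2)
    by (subst Bochner_Integration.integral_add) auto
  have Ebound: "E (\<lambda>x. G m x - G n x) \<le> 4 * \<mu> + 4" for m n
  proof -
    have "1 / real (Suc k) \<le> 1" for k by simp
    then have "E (G k) \<le> \<mu> + 1" for k using EG(1)[of k] by (smt (verit))
    then show ?thesis using Ediff[of m n] E0[of "\<lambda>x. G m x + 1 *\<^sub>R G n x"] by (smt (verit))
  qed
  have cauU: "\<exists>N. \<forall>m\<ge>N. \<forall>n\<ge>N. nsq unit_measure (\<lambda>x. U m x - U n x) < e" if e: "e > 0" for e
  proof -
    define K where "K = (4 * \<mu> + 4) / B\<^sup>2"
    have K: "nsq unit_measure (\<lambda>x. G m x - G n x) \<le> K" for m n
      using coer[OF L2_diff[OF UL(2) UL(2)], of m n] Ebound[of m n] B(1)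
      by (simp add: K_def field_simps)
    \<comment> \<open>With this N the tails of all differences are at most K / (N pi)^2 \<le> K / N
      < e / 2, uniformly in m and n. Only finitely many coefficients are left.\<close>
    obtain N where N: "2 * K / e < real N" "1 \<le> N"
    proof -
      obtain N0 where "2 * K / e < real N0" using reals_Archimedean2 by blast
      then show thesis using that[of "Suc N0"] by simp
    qed
    have K0: "0 \<le> K" using K[of 0 0] nsq_nonneg[of unit_measure "\<lambda>x. G 0 x - G 0 x"] by linarith
    have tail: "nsq unit_measure (\<lambda>x. (U m x - U n x) - cosine_projection N (\<lambda>x. U m x - U n x) x) < e / 2" for m n
    proof -
      have H: "H1 (\<lambda>x. U m x - U n x) (\<lambda>x. G m x - G n x)" using Hdiff[of m "-1" n] by simp
      have "nsq unit_measure (\<lambda>x. (U m x - U n x) - cosine_projection N (\<lambda>x. U m x - U n x) x)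
          \<le> nsq unit_measure (\<lambda>x. G m x - G n x) / (real N * pi)\<^sup>2"
        by (rule H1_tail[OF H N(2)])
      also have "\<dots> \<le> K / (real N * pi)\<^sup>2" by (intro divide_right_mono K) simp
      also have "\<dots> \<le> K / real N"
      proof (intro divide_left_mono K0)
        have "1 \<le> pi" using pi_gt3 by simp
        then have *: "real N * 1 \<le> real N * pi" by (intro mult_left_mono) auto
        moreover have "1 * (real N * pi) \<le> (real N * pi) * (real N * pi)"
        proof (rule mult_right_mono)
          show "1 \<le> real N * pi" using * N(2) by linarith
        qed simp
        ultimately show "real N \<le> (real N * pi)\<^sup>2" unfolding power2_eq_square by linarith
        then show "0 < (real N * pi)\<^sup>2 * real N" using N(2) by simp
      qed
      also have "\<dots> < e / 2" using N e by (simp add: field_simps)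
      finally show ?thesis .
    qed
    have "(\<lambda>n. \<Sum>p\<in>{..<N} \<times> {..<N}. (ip unit_measure (U n) (cc p) - l p)\<^sup>2)
        \<longlonglongrightarrow> (\<Sum>p\<in>{..<N} \<times> {..<N}. (l p - l p)\<^sup>2)"
      by (intro tendsto_intros l)
    then have "(\<lambda>n. \<Sum>p\<in>{..<N} \<times> {..<N}. (ip unit_measure (U n) (cc p) - l p)\<^sup>2) \<longlonglongrightarrow> 0" by simp
    \<comment> \<open>The share e / 8 is doubled by (a - b)^2 \<le> 2 (a - c)^2 + 2 (b - c)^2 and
      occurs for m and for n, which makes e / 2.\<close>
    from LIMSEQ_D[OF this, of "e / 8"] e obtain M where
      "\<And>n. n \<ge> M \<Longrightarrow> norm ((\<Sum>p\<in>{..<N} \<times> {..<N}. (ip unit_measure (U n) (cc p) - l p)\<^sup>2) - 0) < e / 8" by auto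
    then have M: "(\<Sum>p\<in>{..<N} \<times> {..<N}. (ip unit_measure (U n) (cc p) - l p)\<^sup>2) < e / 8" if "n \<ge> M" for n
      using that by fastforce
    have "nsq unit_measure (\<lambda>x. U m x - U n x) < e" if mn: "m \<ge> M" "n \<ge> M" for m n
    proof -
      let ?v = "\<lambda>x. U m x - U n x"
      have v: "L2 unit_measure ?v" by (intro L2_diff UL)
      have "ip unit_measure ?v (cc p) = ip unit_measure (U m) (cc p) - ip unit_measure (U n) (cc p)" for p
        using ip_diff_right[OF L2_cc UL(1) UL(1)] by (simp add: ip_commute)
      moreover have "(a - b)\<^sup>2 \<le> 2 * (a - c)\<^sup>2 + 2 * (b - c)\<^sup>2" for a b c :: real
        using zero_le_power2[of "a + b - 2 * c"] by (simp add: power2_eq_square algebra_simps)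
      ultimately have "(\<Sum>p\<in>{..<N} \<times> {..<N}. (ip unit_measure ?v (cc p))\<^sup>2)
          \<le> (\<Sum>p\<in>{..<N} \<times> {..<N}. 2 * (ip unit_measure (U m) (cc p) - l p)\<^sup>2 + 2 * (ip unit_measure (U n) (cc p) - l p)\<^sup>2)"
        by (intro sum_mono) simp
      also have "\<dots> < e / 2"
        using M[OF mn(1)] M[OF mn(2)] by (simp add: sum.distrib flip: sum_distrib_left)
      finally have "(\<Sum>p\<in>{..<N} \<times> {..<N}. (ip unit_measure ?v (cc p))\<^sup>2) < e / 2" .
      moreover have "nsq unit_measure (\<lambda>x. ?v x - cosine_projection N ?v x) = nsq unit_measure ?v - (\<Sum>p\<in>{..<N} \<times> {..<N}. (ip unit_measure ?v (cc p))\<^sup>2)"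
        unfolding cosine_projection_def by (rule nsq_minus_projection[OF orthonormal_subset[OF orthonormal_cc] _ v]) auto
      ultimately show ?thesis using tail[of m n] by linarith
    qed
    then show ?thesis by blast
  qed
  have cauG: "\<exists>N. \<forall>m\<ge>N. \<forall>n\<ge>N. nsq unit_measure (\<lambda>x. G m x - G n x) < e" if e: "e > 0" for e
  proof -
    have \<mu>nn: "0 \<le> \<mu>" unfolding \<mu>_def by (intro cInf_greatest) (use first E0 in blast)+
    \<comment> \<open>The 1 added to \<mu> guards against a zero denominator and still leaves \<mu>
      times this bound at most a quarter of \<open>B\<^sup>2 * e\<close>.\<close>
    then have d: "0 < B\<^sup>2 * e / (4 * (\<mu> + 1))" using B e by simp
    obtain N1 where N1: "\<And>m n. m \<ge> N1 \<Longrightarrow> n \<ge> N1 \<Longrightarrow> nsq unit_measure (\<lambda>x. U m x - U n x) < B\<^sup>2 * e / (4 * (\<mu> + 1))"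
      using cauU[OF d] by blast
    obtain N2 where N2: "8 / (B\<^sup>2 * e) < real N2" using reals_Archimedean2 by blast
    have "nsq unit_measure (\<lambda>x. G m x - G n x) < e" if mn: "m \<ge> max N1 N2" "n \<ge> max N1 N2" for m n
    proof -
      have pos: "0 < B\<^sup>2 * e" using B e by simp
      have s: "1 / real (Suc k) < B\<^sup>2 * e / 8" if "k \<ge> max N1 N2" for k
      proof -
        have "8 / (B\<^sup>2 * e) < real (Suc k)" using that N2 by simp
        then show ?thesis using pos by (simp add: field_simps)
      qed
      \<comment> \<open>For nearly equal unit vectors the sum has squared norm close to 4, hence
        energy at least nearly 4 \<mu>. Twice the two energies is also close to 4 \<mu>, so the
        parallelogram law leaves little energy for the difference.\<close>
      have "nsq unit_measure (\<lambda>x. U m x + 1 * U n x) = 4 - nsq unit_measure (\<lambda>x. U m x - U n x)"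
        using nsq_add[OF UL(1) UL(1), of m n] nsq_diff[OF UL(1) UL(1), of m n] U(3) by simp
      then have "\<mu> * (4 - nsq unit_measure (\<lambda>x. U m x - U n x)) \<le> E (\<lambda>x. G m x + 1 *\<^sub>R G n x)"
        using low[OF Hdiff mdiff, of m 1 n] by simp
      moreover have "\<mu> * nsq unit_measure (\<lambda>x. U m x - U n x) \<le> \<mu> * (B\<^sup>2 * e / (4 * (\<mu> + 1)))"
        using N1[of m n] mn \<mu>nn by (intro mult_left_mono) auto
      moreover have "\<mu> * (B\<^sup>2 * e / (4 * (\<mu> + 1))) \<le> B\<^sup>2 * e / 4"
        using pos \<mu>nn by (simp add: field_simps)
      ultimately have "E (\<lambda>x. G m x - G n x) < B\<^sup>2 * e"
        using Ediff[of m n] EG(1)[of m] EG(1)[of n] s[OF mn(1)] s[OF mn(2)] pos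
        unfolding right_diff_distrib by linarith
      then have "B\<^sup>2 * nsq unit_measure (\<lambda>x. G m x - G n x) < B\<^sup>2 * e"
        using coer[OF L2_diff[OF UL(2) UL(2)], of m n] by linarith
      then show ?thesis using B by simp
    qed
    then show ?thesis by blast
  qed
  obtain u where u: "L2 unit_measure u" "(\<lambda>n. nsq unit_measure (\<lambda>x. U n x - u x)) \<longlonglongrightarrow> 0"
    using Riesz_Fischer[OF UL(1) cauU] by blast
  obtain g where g: "L2 unit_measure g" "(\<lambda>n. nsq unit_measure (\<lambda>x. G n x - g x)) \<longlonglongrightarrow> 0"
    using Riesz_Fischer[OF UL(2) cauG] by blast
  have H: "H1 u g" by (rule H1_limit[OF U(1) u(1) g(1) u(2) g(2)])
  have nu: "nsq unit_measure u = 1"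
    using tendsto_nsq[OF UL(1) u] U(3) by (simp add: LIMSEQ_const_iff)
  have mu: "(LINT x|unit_measure. u x) = 0"
    using tendsto_ip[OF UL(1) u(1) L2_cc[of "(0, 0)"] u(2)] U(2)
    by (simp add: ip_def LIMSEQ_const_iff)
  have Eg: "E g = \<mu>"
  proof -
    obtain C where C: "\<And>x. norm (A x) \<le> norm x * C"
      using linear_bounded[OF A(1)] by (auto simp: mult.commute)
    have le: "nsq unit_measure (\<lambda>x. A (G n x) - A (g x)) \<le> C\<^sup>2 * nsq unit_measure (\<lambda>x. G n x - g x)" for n
    proof -
      have "nsq unit_measure (\<lambda>x. A (G n x - g x)) \<le> (LINT x|unit_measure. C\<^sup>2 * (norm (G n x - g x))\<^sup>2)"
        unfolding nsq_def
      proof (rule integral_mono)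
        show "integrable unit_measure (\<lambda>x. (norm (A (G n x - g x)))\<^sup>2)"
          by (intro L2_integrable_sq LA L2_diff UL g)
        show "integrable unit_measure (\<lambda>x. C\<^sup>2 * (norm (G n x - g x))\<^sup>2)"
          by (intro Bochner_Integration.integrable_mult_right L2_integrable_sq L2_diff UL g)
        show "(norm (A (G n x - g x)))\<^sup>2 \<le> C\<^sup>2 * (norm (G n x - g x))\<^sup>2" for x
          using power_mono[OF C norm_ge_zero, of "G n x - g x" 2] by (simp add: power_mult_distrib mult.commute)
      qed
      then show ?thesis by (simp add: nsq_def AL)
    qed
    have "(\<lambda>n. nsq unit_measure (\<lambda>x. A (G n x) - A (g x))) \<longlonglongrightarrow> 0"
    proof (rule tendsto_sandwich[OF _ _ tendsto_const])
      show "\<forall>\<^sub>F n in sequentially. nsq unit_measure (\<lambda>x. A (G n x) - A (g x)) \<le> C\<^sup>2 * nsq unit_measure (\<lambda>x. G n x - g x)"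
        using le by simp
      show "(\<lambda>n. C\<^sup>2 * nsq unit_measure (\<lambda>x. G n x - g x)) \<longlonglongrightarrow> 0"
        using tendsto_mult_left[OF g(2), of "C\<^sup>2"] by simp
    qed (simp add: nsq_nonneg)
    then have "(\<lambda>n. E (G n)) \<longlonglongrightarrow> E g"
      unfolding E_def by (intro tendsto_nsq LA UL g)
    moreover have "(\<lambda>n. E (G n)) \<longlonglongrightarrow> \<mu>"
    proof (rule tendsto_sandwich[OF _ _ tendsto_const])
      show "\<forall>\<^sub>F n in sequentially. \<mu> \<le> E (G n)" using EG(2) by simp
      show "\<forall>\<^sub>F n in sequentially. E (G n) \<le> \<mu> + 1 / real (Suc n)"
        using EG(1) by (intro always_eventually) (auto intro: less_imp_le)
      show "(\<lambda>n. \<mu> + 1 / real (Suc n)) \<longlonglongrightarrow> \<mu>"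
        using tendsto_add[OF tendsto_const LIMSEQ_inverse_real_of_nat, of \<mu>]
        by (simp add: inverse_eq_divide)
    qed
    ultimately show ?thesis by (rule LIMSEQ_unique)
  qed
  have EL: "ip unit_measure (\<lambda>x. A (g x)) (\<lambda>x. A (h x)) = \<mu> * ip unit_measure u v" if V: "H1 v h" for v h
  proof -
    \<comment> \<open>Admissible variations have mean zero. Subtracting the mean changes neither the
      gradient of v nor its inner product with u, which has mean zero itself.\<close>
    define m where "m = (LINT x|unit_measure. v x)"
    have v: "L2 unit_measure v" and h: "L2 unit_measure h" using H1_L2[OF V] by auto
    have one: "L2 unit_measure (\<lambda>x. 1 :: real)" using L2_cc[of "(0, 0)"] by simp
    have V0: "H1 (\<lambda>x. v x + (- m) * 1) (\<lambda>x. h x)"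
      using H1_add_scale[OF V H1_const[of 1], of "- m"] by simp
    let ?v = "\<lambda>x. v x + (- m) * 1"
    have v0: "L2 unit_measure ?v" by (rule H1_L2[OF V0])
    have ip0: "ip unit_measure u ?v = ip unit_measure u v"
    proof -
      have "ip unit_measure u ?v = ip unit_measure u v + ip unit_measure u (\<lambda>x. (- m) *\<^sub>R 1)"
        using ip_add_right[OF u(1) v L2_scaleR[OF one, of "- m"]] by simp
      also have "ip unit_measure u (\<lambda>x. (- m) *\<^sub>R 1) = 0"
        unfolding ip_scaleR_right using mu by (simp add: ip_def)
      finally show ?thesis by simp
    qed
    \<comment> \<open>The Rayleigh bound for u + t v, expanded in t; the constant terms cancel
      because u attains the infimum.\<close>
    have "0 \<le> 2 * t * (ip unit_measure (\<lambda>x. A (g x)) (\<lambda>x. A (h x)) - \<mu> * ip unit_measure u v) + t\<^sup>2 * (E h - \<mu> * nsq unit_measure ?v)" for t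
    proof -
      have mt: "(LINT x|unit_measure. u x + t * ?v x) = 0"
      proof -
        have i: "integrable unit_measure u" "integrable unit_measure v" using u(1) v by (auto intro: L2_integrable finite_measure_unit_measure)
        have c: "integrable unit_measure (\<lambda>x. m)"
          using finite_measure_unit_measure by (simp add: finite_measure.integrable_const)
        have "(LINT x|unit_measure. ?v x) = 0"
          using i c by (simp add: m_def)
        then show ?thesis using i mu L2_integrable[OF finite_measure_unit_measure v0] by (subst Bochner_Integration.integral_add) auto
      qed
      have "\<mu> * nsq unit_measure (\<lambda>x. u x + t * ?v x) \<le> E (\<lambda>x. g x + t *\<^sub>R h x)"
        by (rule low[OF H1_add_scale[OF H V0] mt])
      moreover have "nsq unit_measure (\<lambda>x. u x + t * ?v x) = 1 + 2 * t * ip unit_measure u v + t\<^sup>2 * nsq unit_measure ?v"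
        using nsq_add[OF u(1) L2_scaleR[OF v0, of t]] nu unfolding ip_scaleR_right nsq_scaleR ip0 by simp
      moreover have "E (\<lambda>x. g x + t *\<^sub>R h x) = \<mu> + 2 * t * ip unit_measure (\<lambda>x. A (g x)) (\<lambda>x. A (h x)) + t\<^sup>2 * E h"
        using nsq_add[OF LA[OF g(1)] L2_scaleR[OF LA[OF h], of t]] Eg
        unfolding E_def AL ip_scaleR_right nsq_scaleR by simp
      ultimately show ?thesis by (simp add: algebra_simps)
    qed
    then have "ip unit_measure (\<lambda>x. A (g x)) (\<lambda>x. A (h x)) - \<mu> * ip unit_measure u v = 0"
      by (rule quadratic_nonneg_imp_linear_zero)
    then show ?thesis by simp
  qed
  show thesis by (rule that[OF H mu nu le1 EL])
qed


section \<open>Affine changes of variables\<close>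

text \<open>The matrix is factored into two one-dimensional substitutions: t = (c s + D y) / a for
  fixed s, followed by s = a x + b y for fixed y, with D = a d - b c. Their Jacobians multiply to
  |D|.\<close>

lemma nn_integral_shear:
  fixes a b c d :: real and f :: "point \<Rightarrow> ennreal"
  assumes [measurable]: "f \<in> borel_measurable borel" and a: "a \<noteq> 0" and D: "a * d - b * c \<noteq> 0"
  shows "(\<integral>\<^sup>+x. f x \<partial>lborel)
    = ennreal \<bar>a * d - b * c\<bar> * (\<integral>\<^sup>+x. f (a * fst x + b * snd x, c * fst x + d * snd x) \<partial>lborel)"
proof -
  let ?D = "a * d - b * c"
  have [measurable]: "(\<lambda>x. f (h x, k x)) \<in> borel_measurable M"
    if "h \<in> borel_measurable M" "k \<in> borel_measurable M" for h k and M :: "'c measure"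
    using that by measurable
  have "(\<integral>\<^sup>+x. f x \<partial>lborel) = (\<integral>\<^sup>+s. \<integral>\<^sup>+t. f (s, t) \<partial>lborel \<partial>lborel)"
    using lborel.nn_integral_fst[of f lborel] by (simp add: lborel_prod)
  also have "\<dots> = (\<integral>\<^sup>+s. ennreal \<bar>?D / a\<bar> * (\<integral>\<^sup>+y. f (s, c / a * s + ?D / a * y) \<partial>lborel) \<partial>lborel)"
    using a D by (intro nn_integral_cong nn_integral_real_affine) auto
  also have "\<dots> = ennreal \<bar>?D / a\<bar> * (\<integral>\<^sup>+s. \<integral>\<^sup>+y. f (s, c / a * s + ?D / a * y) \<partial>lborel \<partial>lborel)"
    by (rule nn_integral_cmult) measurable
  also have "(\<integral>\<^sup>+s. \<integral>\<^sup>+y. f (s, c / a * s + ?D / a * y) \<partial>lborel \<partial>lborel)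
      = (\<integral>\<^sup>+y. \<integral>\<^sup>+s. f (s, c / a * s + ?D / a * y) \<partial>lborel \<partial>lborel)"
    by (rule lborel_pair.Fubini') measurable
  also have "\<dots> = (\<integral>\<^sup>+y. ennreal \<bar>a\<bar> * (\<integral>\<^sup>+x. f (b * y + a * x, c / a * (b * y + a * x) + ?D / a * y) \<partial>lborel) \<partial>lborel)"
    using a by (intro nn_integral_cong nn_integral_real_affine) auto
  also have "\<dots> = (\<integral>\<^sup>+y. ennreal \<bar>a\<bar> * (\<integral>\<^sup>+x. f (a * x + b * y, c * x + d * y) \<partial>lborel) \<partial>lborel)"
  proof -
    have "f (b * y + a * x, c / a * (b * y + a * x) + ?D / a * y) = f (a * x + b * y, c * x + d * y)" for x y
      by (rule arg_cong[where f = f]) (use a in \<open>simp add: field_simps\<close>)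
    then show ?thesis by (simp only:)
  qed
  also have "\<dots> = ennreal \<bar>a\<bar> * (\<integral>\<^sup>+y. \<integral>\<^sup>+x. f (a * x + b * y, c * x + d * y) \<partial>lborel \<partial>lborel)"
    by (rule nn_integral_cmult) measurable
  also have "(\<integral>\<^sup>+y. \<integral>\<^sup>+x. f (a * x + b * y, c * x + d * y) \<partial>lborel \<partial>lborel)
      = (\<integral>\<^sup>+x. f (a * fst x + b * snd x, c * fst x + d * snd x) \<partial>lborel)"
  proof -
    have "(\<lambda>x. f (a * fst x + b * snd x, c * fst x + d * snd x)) \<in> borel_measurable borel"
      by (rule measurable_compose[OF borel_measurable_continuous_onI assms(1)]) (intro continuous_intros)
    then show ?thesis
      using lborel_pair.nn_integral_snd[of "\<lambda>x. f (a * fst x + b * snd x, c * fst x + d * snd x)"]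
      by (simp add: lborel_prod)
  qed
  finally have "(\<integral>\<^sup>+x. f x \<partial>lborel) = ennreal \<bar>?D / a\<bar> * (ennreal \<bar>a\<bar> *
      (\<integral>\<^sup>+x. f (a * fst x + b * snd x, c * fst x + d * snd x) \<partial>lborel))" .
  moreover have "ennreal \<bar>?D / a\<bar> * ennreal \<bar>a\<bar> = ennreal \<bar>?D\<bar>"
    using a by (simp add: ennreal_mult[symmetric] abs_divide)
  ultimately show ?thesis by (simp only: mult.assoc[symmetric])
qed

lemma nn_integral_swap:
  fixes f :: "point \<Rightarrow> ennreal"
  assumes [measurable]: "f \<in> borel_measurable borel"
  shows "(\<integral>\<^sup>+x. f (snd x, fst x) \<partial>lborel) = (\<integral>\<^sup>+x. f x \<partial>lborel)"
proof -
  have "(\<lambda>x. f (snd x, fst x)) \<in> borel_measurable borel"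
    by (rule measurable_compose[OF borel_measurable_continuous_onI assms]) (intro continuous_intros)
  then have "(\<integral>\<^sup>+x. f (snd x, fst x) \<partial>lborel) = (\<integral>\<^sup>+x. \<integral>\<^sup>+y. f (y, x) \<partial>lborel \<partial>lborel)"
    using lborel.nn_integral_fst[of "\<lambda>x. f (snd x, fst x)" lborel] by (simp add: lborel_prod)
  also have "\<dots> = (\<integral>\<^sup>+x. f x \<partial>lborel)"
    using lborel_pair.nn_integral_snd[of f] by (simp add: lborel_prod)
  finally show ?thesis .
qed

text \<open>Only a positive factor is recorded, as it cancels from both sides of every weak
  identity.\<close>

lemma nn_integral_linear:
  fixes L :: "point \<Rightarrow> point"
  assumes L: "linear L" "inj L"
  shows "\<exists>\<kappa>>0. \<forall>f\<in>borel_measurable borel. (\<integral>\<^sup>+x. f x \<partial>lborel) = ennreal \<kappa> * (\<integral>\<^sup>+x. f (L x) \<partial>lborel)"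
proof -
  define a where "a = fst (L (1, 0))"
  define b where "b = fst (L (0, 1))"
  define c where "c = snd (L (1, 0))"
  define d where "d = snd (L (0, 1))"
  have Lx: "L x = (a * fst x + b * snd x, c * fst x + d * snd x)" for x
  proof -
    have "L x = L (fst x *\<^sub>R (1, 0) + snd x *\<^sub>R (0, 1))" by simp
    also have "\<dots> = fst x *\<^sub>R L (1, 0) + snd x *\<^sub>R L (0, 1)"
      by (simp only: linear_add[OF L(1)] linear_scale[OF L(1)])
    finally show ?thesis by (auto simp: prod_eq_iff a_def b_def c_def d_def)
  qed
  have D: "a * d - b * c \<noteq> 0"
  proof
    assume D: "a * d - b * c = 0"
    \<comment> \<open>With zero determinant both vectors lie in the kernel, so by injectivity all
      entries vanish.\<close>
    have "L (d, - c) = L 0" "L (b, - a) = L 0" using D by (simp_all add: Lx algebra_simps)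
    then have "(d, - c) = (0::point)" "(b, - a) = (0::point)" using L(2) by (auto dest: injD)
    then have "L (1, 0) = L 0" by (simp add: Lx zero_prod_def)
    then have "(1, 0) = (0::point)" using L(2) by (auto dest: injD)
    then show False by (simp add: zero_prod_def)
  qed
  show ?thesis
  proof (intro exI conjI ballI)
    show "0 < \<bar>a * d - b * c\<bar>" using D by simp
    fix f :: "point \<Rightarrow> ennreal" assume f [measurable]: "f \<in> borel_measurable borel"
    show "(\<integral>\<^sup>+x. f x \<partial>lborel) = ennreal \<bar>a * d - b * c\<bar> * (\<integral>\<^sup>+x. f (L x) \<partial>lborel)"
    proof (cases "a = 0")
      case False
      then show ?thesis unfolding Lx by (rule nn_integral_shear[OF f _ D])
    next
      \<comment> \<open>Exchanging the two columns brings the nonzero entry b into the pivot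
        position.\<close>
      case True
      then have b: "b \<noteq> 0" using D by auto
      have "(\<integral>\<^sup>+x. f x \<partial>lborel)
        = ennreal \<bar>b * c - a * d\<bar> * (\<integral>\<^sup>+x. f (b * fst x + a * snd x, d * fst x + c * snd x) \<partial>lborel)"
        using b D by (intro nn_integral_shear f) auto
      also have "(\<integral>\<^sup>+x. f (b * fst x + a * snd x, d * fst x + c * snd x) \<partial>lborel) = (\<integral>\<^sup>+x. f (L x) \<partial>lborel)"
      proof -
        have "(\<lambda>x. f (L x)) \<in> borel_measurable borel" unfolding Lx
          by (rule measurable_compose[OF borel_measurable_continuous_onI f]) (intro continuous_intros)
        from nn_integral_swap[OF this] show ?thesis by (simp add: Lx add.commute)
      qed
      finally show ?thesis by (simp add: abs_minus_commute)
    qed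
  qed
qed

locale affine_bij =
  fixes p :: point and L K :: "point \<Rightarrow> point"
  assumes lin: "linear L" "linear K" and KL: "K (L x) = x" and LK: "L (K x) = x"
begin

definition T :: "point \<Rightarrow> point" where "T x = p + L x"

text \<open>The inverse of \<open>T\<close>, written as a constant plus a linear map: it is the map
  \<open>T\<close> of the locale with L and K exchanged, so push-forward results come from pull-back
  results.\<close>

definition T' :: "point \<Rightarrow> point" where "T' y = - K p + K y"

lemma T'_T [simp]: "T' (T x) = x" and T_T' [simp]: "T (T' y) = y"
  by (simp_all add: T_def T'_def linear_add[OF lin(1)] linear_add[OF lin(2)] linear_diff[OF lin(1)] KL LK)

lemma T_image_iff: "T x \<in> T ` S \<longleftrightarrow> x \<in> S"
  by (metis T'_T imageE image_eqI)

lemma T'_T_image [simp]: "T' ` T ` S = S"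
  by (simp add: image_image)

lemma T'_vimage: "T ` S = T' -` S"
proof (intro set_eqI iffI)
  fix y assume "y \<in> T' -` S"
  then have "T (T' y) \<in> T ` S" by blast
  then show "y \<in> T ` S" by simp
qed auto

lemma inj_L: "inj L"
  by (metis KL injI)

lemma continuous_T: "continuous_on A T" and continuous_T': "continuous_on A T'"
proof -
  have "continuous_on A L" "continuous_on A K"
    using lin by (auto intro: linear_continuous_on simp: linear_conv_bounded_linear)
  then show "continuous_on A T" "continuous_on A T'"
    unfolding T_def[abs_def] T'_def[abs_def] by (auto intro: continuous_on_add continuous_on_diff continuous_on_const)
qed

lemma measurable_T [measurable]: "T \<in> borel \<rightarrow>\<^sub>M borel" and measurable_T' [measurable]: "T' \<in> borel \<rightarrow>\<^sub>M borel"
  by (intro borel_measurable_continuous_onI continuous_T continuous_T')+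

lemma open_T: "open S \<Longrightarrow> open (T ` S)"
  unfolding T'_vimage by (rule open_vimage[OF _ continuous_T'])

lemma adjoint_LK: "adjoint L (adjoint K z) = z" and adjoint_KL: "adjoint K (adjoint L z) = z"
proof -
  have "x \<bullet> adjoint L (adjoint K z) = x \<bullet> z" "x \<bullet> adjoint K (adjoint L z) = x \<bullet> z" for x
    by (simp_all add: adjoint_works lin KL LK)
  then show "adjoint L (adjoint K z) = z" "adjoint K (adjoint L z) = z"
    using vector_eq_ldot by blast+
qed

lemma change_of_variables: "\<exists>\<kappa>>0. distr lborel borel T = density lborel (\<lambda>_. ennreal \<kappa>)"
proof -
  obtain \<kappa> where \<kappa>: "\<kappa> > 0"
    "\<And>f. f \<in> borel_measurable borel \<Longrightarrow> (\<integral>\<^sup>+x. f x \<partial>lborel) = ennreal \<kappa> * (\<integral>\<^sup>+x. f (L x) \<partial>lborel)"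
    using nn_integral_linear[OF lin(1) inj_L] by blast
  have "distr lborel borel T = density lborel (\<lambda>_. ennreal (1 / \<kappa>))"
  proof (rule measure_eqI)
    fix A assume "A \<in> sets (distr lborel borel T)"
    then have A [measurable]: "A \<in> sets borel" by simp
    have "(\<integral>\<^sup>+x. indicator A x \<partial>lborel) = (\<integral>\<^sup>+x. indicator A x \<partial>distr lborel borel ((+) p))"
      by (simp add: lborel_distr_plus)
    also have "\<dots> = (\<integral>\<^sup>+x. indicator A (p + x) \<partial>lborel)"
      by (rule nn_integral_distr) measurable
    also have "\<dots> = ennreal \<kappa> * (\<integral>\<^sup>+x. indicator A (T x) \<partial>lborel)"
      unfolding T_def by (rule \<kappa>(2)) measurable
    also have "(\<integral>\<^sup>+x. indicator A (T x) \<partial>lborel) = (\<integral>\<^sup>+x. indicator A x \<partial>distr lborel borel T)"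
      by (rule nn_integral_distr[symmetric]) measurable
    finally have "emeasure lborel A = ennreal \<kappa> * emeasure (distr lborel borel T) A" by simp
    then have "ennreal (1 / \<kappa>) * emeasure lborel A = ennreal (1 / \<kappa>) * ennreal \<kappa> * emeasure (distr lborel borel T) A"
      by (simp add: mult.assoc)
    also have "ennreal (1 / \<kappa>) * ennreal \<kappa> = 1" using \<kappa>(1) by (simp flip: ennreal_mult)
    finally show "emeasure (distr lborel borel T) A = emeasure (density lborel (\<lambda>_. ennreal (1 / \<kappa>))) A"
      by (simp add: emeasure_density nn_integral_cmult_indicator)
  qed simp
  then show ?thesis using \<kappa>(1) by (intro exI[of _ "1 / \<kappa>"]) simp
qed

text \<open>This number is 1 / |det L|.\<close>

definition \<kappa> :: real where
  "\<kappa> = (SOME k. k > 0 \<and> distr lborel borel T = density lborel (\<lambda>_. ennreal k))"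

lemma \<kappa>: "\<kappa> > 0" "distr lborel borel T = density lborel (\<lambda>_. ennreal \<kappa>)"
  using someI_ex[OF change_of_variables] unfolding \<kappa>_def by blast+

lemma integral_T:
  fixes f :: "point \<Rightarrow> 'b::euclidean_space"
  assumes "set_borel_measurable lborel (T ` S) f"
  shows "set_borel_measurable lborel S (\<lambda>x. f (T x))"
    and "set_integrable lborel S (\<lambda>x. f (T x)) \<longleftrightarrow> set_integrable lborel (T ` S) f"
    and "(LINT x:S|lborel. f (T x)) = \<kappa> *\<^sub>R (LINT x:T ` S|lborel. f x)"
proof -
  let ?F = "\<lambda>x. indicator (T ` S) x *\<^sub>R f x"
  have F [measurable]: "?F \<in> borel_measurable borel" using assms by (simp add: set_borel_measurable_def)
  have FT: "?F (T x) = indicator S x *\<^sub>R f (T x)" for x by (simp add: indicator_def T_image_iff)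
  show "set_borel_measurable lborel S (\<lambda>x. f (T x))"
    unfolding set_borel_measurable_def FT[symmetric] by measurable
  have "integrable (distr lborel borel T) ?F \<longleftrightarrow> integrable lborel (\<lambda>x. ?F (T x))"
    by (rule integrable_distr_eq) measurable
  moreover have "integrable (density lborel (\<lambda>_. ennreal \<kappa>)) ?F \<longleftrightarrow> integrable lborel (\<lambda>x. \<kappa> *\<^sub>R ?F x)"
    using \<kappa>(1) by (intro integrable_density) auto
  moreover have "integrable lborel (\<lambda>x. \<kappa> *\<^sub>R ?F x) \<longleftrightarrow> integrable lborel ?F"
  proof
    assume "integrable lborel (\<lambda>x. \<kappa> *\<^sub>R ?F x)"
    then have "integrable lborel (\<lambda>x. (1 / \<kappa>) *\<^sub>R \<kappa> *\<^sub>R ?F x)"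
      by (rule Bochner_Integration.integrable_scaleR_right)
    moreover have "(\<lambda>x. (1 / \<kappa>) *\<^sub>R \<kappa> *\<^sub>R ?F x) = ?F" using \<kappa>(1) by (simp add: fun_eq_iff)
    ultimately show "integrable lborel ?F" by (simp only:)
  qed (rule Bochner_Integration.integrable_scaleR_right)
  ultimately show "set_integrable lborel S (\<lambda>x. f (T x)) \<longleftrightarrow> set_integrable lborel (T ` S) f"
    unfolding set_integrable_def FT \<kappa>(2) by blast
  have "(LINT x|distr lborel borel T. ?F x) = (LINT x|lborel. ?F (T x))"
    by (rule integral_distr) measurable
  moreover have "(LINT x|density lborel (\<lambda>_. ennreal \<kappa>). ?F x) = (LINT x|lborel. \<kappa> *\<^sub>R ?F x)"
    using \<kappa>(1) by (intro integral_density) auto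
  ultimately show "(LINT x:S|lborel. f (T x)) = \<kappa> *\<^sub>R (LINT x:T ` S|lborel. f x)"
    unfolding set_lebesgue_integral_def FT \<kappa>(2) by (simp only: integral_scaleR_right)
qed

lemma inverse: "affine_bij K L"
  by (rule affine_bij.intro[OF lin(2) lin(1) LK KL])

lemma inverse_T: "affine_bij.T (- K p) K = T'"
  by (simp add: affine_bij.T_def[OF inverse] T'_def fun_eq_iff)

text \<open>By the chain rule, gradients transform with the adjoint of the derivative K of
  \<open>T'\<close>; the compact set is carried along by \<open>T\<close>.\<close>

lemma test_function_push:
  assumes t: "test_function S \<phi> D"
  shows "test_function (T ` S) (\<lambda>y. \<phi> (T' y)) (\<lambda>y. adjoint K (D (T' y)))"
  unfolding test_function_def
proof (intro conjI allI)
  fix y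
  have "(T' has_derivative K) (at y)"
  proof -
    have "((\<lambda>y. - K p + K y) has_derivative (\<lambda>h. 0 + K h)) (at y)"
      by (intro has_derivative_add has_derivative_const linear_imp_has_derivative lin)
    then show ?thesis unfolding T'_def[abs_def] by (simp only: add_0)
  qed
  moreover have "(\<phi> has_derivative (\<lambda>h. h \<bullet> D (T' y))) (at (T' y))"
    using t unfolding test_function_def gderiv_def by blast
  ultimately have "((\<lambda>y. \<phi> (T' y)) has_derivative (\<lambda>h. K h \<bullet> D (T' y))) (at y)"
    by (rule has_derivative_compose)
  then show "GDERIV (\<lambda>y. \<phi> (T' y)) y :> adjoint K (D (T' y))"
    unfolding gderiv_def by (simp add: adjoint_works[OF lin(2)])
next
  show "continuous_on UNIV (\<lambda>y. adjoint K (D (T' y)))"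
  proof (rule continuous_on_compose2[OF _ continuous_on_compose2[OF test_function_continuous(2)[OF t] continuous_T' subset_UNIV] subset_UNIV])
    show "continuous_on UNIV (adjoint K)"
      using adjoint_linear[OF lin(2)] by (intro linear_continuous_on) (simp add: linear_conv_bounded_linear)
  qed
next
  obtain C where C: "compact C" "C \<subseteq> S" "\<And>x. x \<notin> C \<Longrightarrow> \<phi> x = 0"
    using t by (auto simp: test_function_def)
  have "\<phi> (T' y) = 0" if "y \<notin> T ` C" for y
    using that C(3)[of "T' y"] by (auto simp: T'_vimage)
  then show "\<exists>C. compact C \<and> C \<subseteq> T ` S \<and> (\<forall>x. x \<notin> C \<longrightarrow> \<phi> (T' x) = 0)"
    using C by (intro exI[of _ "T ` C"]) (auto intro: compact_continuous_image continuous_T)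
qed

lemma square_integrable_pull:
  fixes f :: "point \<Rightarrow> 'b::euclidean_space"
  assumes f: "square_integrable_on f (T ` S)"
  shows "square_integrable_on (\<lambda>x. f (T x)) S"
proof -
  have m: "set_borel_measurable lborel (T ` S) f" using f by (simp add: square_integrable_on_def)
  have "(\<lambda>x. (norm (indicator (T ` S) x *\<^sub>R f x))\<^sup>2) \<in> borel_measurable lborel"
    using m unfolding set_borel_measurable_def by measurable
  also have "(\<lambda>x. (norm (indicator (T ` S) x *\<^sub>R f x))\<^sup>2) = (\<lambda>x. indicator (T ` S) x *\<^sub>R (norm (f x))\<^sup>2)"
    by (auto simp: fun_eq_iff indicator_def)
  finally have "set_borel_measurable lborel (T ` S) (\<lambda>x. (norm (f x))\<^sup>2)"
    by (simp add: set_borel_measurable_def)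
  from integral_T(2)[OF this] integral_T(1)[OF m] f show ?thesis by (simp add: square_integrable_on_def)
qed

lemma square_integrable_linear:
  fixes f :: "point \<Rightarrow> 'b::euclidean_space" and h :: "'b \<Rightarrow> 'c::euclidean_space"
  assumes S: "S \<in> sets borel" and f: "square_integrable_on f S" and h: "linear h"
  shows "square_integrable_on (\<lambda>x. h (f x)) S"
  using L2_linear[OF _ h, of "restrict_space lborel S" f] f unfolding square_integrable_on_iff_L2[OF S] by blast

text \<open>A test function on S is pushed to the image, where the weak identity holds; transporting
  the integrals back gives both sides the factor \<open>\<kappa>\<close>. Applying
  \<open>adjoint L\<close> finally removes the \<open>adjoint K\<close> of the pushed
  gradient.\<close>

lemma H1_pull:
  assumes S: "open S" and H: "H1_function (T ` S) u g"
  shows "H1_function S (\<lambda>x. u (T x)) (\<lambda>x. adjoint L (g (T x)))"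
  unfolding H1_function_def
proof (intro conjI allI impI)
  have u: "square_integrable_on u (T ` S)" and g: "square_integrable_on g (T ` S)"
    using H by (simp_all add: H1_function_def)
  have lK: "linear (adjoint K)" and lL: "linear (adjoint L)" using lin by (simp_all add: adjoint_linear)
  show "square_integrable_on (\<lambda>x. u (T x)) S" by (rule square_integrable_pull[OF u])
  show "square_integrable_on (\<lambda>x. adjoint L (g (T x))) S"
    using S by (intro square_integrable_linear[OF _ square_integrable_pull[OF g] lL]) simp
  fix \<phi> D assume t: "test_function S \<phi> D"
  note t' = test_function_push[OF t]
  have m: "set_borel_measurable lborel (T ` S) (\<lambda>y. u y *\<^sub>R adjoint K (D (T' y)))"
    "set_borel_measurable lborel (T ` S) (\<lambda>y. \<phi> (T' y) *\<^sub>R g y)"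
  proof -
    have [measurable]: "(\<lambda>y. adjoint K (D (T' y))) \<in> borel_measurable borel" "(\<lambda>y. \<phi> (T' y)) \<in> borel_measurable borel"
      using test_function_continuous[OF t'] by (auto intro: borel_measurable_continuous_onI)
    have [measurable]: "(\<lambda>y. indicator (T ` S) y *\<^sub>R u y) \<in> borel_measurable lborel"
      "(\<lambda>y. indicator (T ` S) y *\<^sub>R g y) \<in> borel_measurable lborel"
      using u g by (simp_all add: square_integrable_on_def set_borel_measurable_def)
    have "(\<lambda>y. (indicator (T ` S) y *\<^sub>R u y) *\<^sub>R adjoint K (D (T' y))) \<in> borel_measurable lborel" by measurable
    then show "set_borel_measurable lborel (T ` S) (\<lambda>y. u y *\<^sub>R adjoint K (D (T' y)))"
      by (simp add: set_borel_measurable_def)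
    have "(\<lambda>y. \<phi> (T' y) *\<^sub>R (indicator (T ` S) y *\<^sub>R g y)) \<in> borel_measurable lborel" by measurable
    then show "set_borel_measurable lborel (T ` S) (\<lambda>y. \<phi> (T' y) *\<^sub>R g y)"
      by (simp add: set_borel_measurable_def mult.commute)
  qed
  have "(LINT y:T ` S|lborel. u y *\<^sub>R adjoint K (D (T' y))) = - (LINT y:T ` S|lborel. \<phi> (T' y) *\<^sub>R g y)"
    using H t' unfolding H1_function_def by blast
  then have "\<kappa> *\<^sub>R (LINT y:T ` S|lborel. u y *\<^sub>R adjoint K (D (T' y)))
      = - (\<kappa> *\<^sub>R (LINT y:T ` S|lborel. \<phi> (T' y) *\<^sub>R g y))" by simp
  then have e: "(LINT x:S|lborel. u (T x) *\<^sub>R adjoint K (D x)) = - (LINT x:S|lborel. \<phi> x *\<^sub>R g (T x))"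
    unfolding integral_T(3)[OF m(1), symmetric] integral_T(3)[OF m(2), symmetric] by simp
  \<comment> \<open>Invertibility of \<open>adjoint L\<close> makes this hold for every f,
    integrable or not.\<close>
  have lint: "(LINT x:S|lborel. adjoint L (f x)) = adjoint L (LINT x:S|lborel. f x)" for f :: "point \<Rightarrow> point"
  proof -
    have "(LINT x|lborel. adjoint L (indicator S x *\<^sub>R f x)) = adjoint L (LINT x|lborel. indicator S x *\<^sub>R f x)"
      using lK lL adjoint_KL by (intro integral_bounded_linear'[of _ "adjoint K"])
        (auto simp: linear_conv_bounded_linear)
    then show ?thesis unfolding set_lebesgue_integral_def by (simp add: linear_scale[OF lL])
  qed
  have "(LINT x:S|lborel. u (T x) *\<^sub>R D x) = (LINT x:S|lborel. adjoint L (u (T x) *\<^sub>R adjoint K (D x)))"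
    by (simp add: linear_scale[OF lL] adjoint_LK)
  also have "\<dots> = - adjoint L (LINT x:S|lborel. \<phi> x *\<^sub>R g (T x))"
    unfolding lint e by (rule linear_neg[OF lL])
  also have "\<dots> = - (LINT x:S|lborel. \<phi> x *\<^sub>R adjoint L (g (T x)))"
    unfolding lint[symmetric] by (simp add: linear_scale[OF lL])
  finally show "(LINT x:S|lborel. u (T x) *\<^sub>R D x) = - (LINT x:S|lborel. \<phi> x *\<^sub>R adjoint L (g (T x)))" .
qed

lemma H1_push:
  assumes S: "open S" and H: "H1_function S u g"
  shows "H1_function (T ` S) (\<lambda>y. u (T' y)) (\<lambda>y. adjoint K (g (T' y)))"
  using affine_bij.H1_pull[OF inverse open_T[OF S], where p = "- K p" and u = u and g = g] H unfolding inverse_T by simp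

end


section \<open>Neumann eigenvalues of parallelograms\<close>

definition eigenvalue_bounds :: "nat \<Rightarrow> point set \<Rightarrow> real set" where
  "eigenvalue_bounds k \<Omega> = {\<Lambda>. \<exists>u \<mu>. ae_independent \<Omega> k u \<and>
     (\<forall>i<k. weak_Neumann_solution \<Omega> (\<mu> i) (u i) \<and> \<mu> i \<le> \<Lambda>)}"

lemma Neumann_eigenvalue_eq: "Neumann_eigenvalue k \<Omega> = Inf (eigenvalue_bounds k \<Omega>)"
  by (simp add: Neumann_eigenvalue_def eigenvalue_bounds_def)

lemma set_borel_measurable_inner:
  fixes f h :: "'a \<Rightarrow> 'b::euclidean_space"
  assumes "set_borel_measurable M S f" "set_borel_measurable M S h"
  shows "set_borel_measurable M S (\<lambda>x. f x \<bullet> h x)"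
proof -
  have "(\<lambda>x. (indicator S x *\<^sub>R f x) \<bullet> (indicator S x *\<^sub>R h x)) \<in> borel_measurable M"
    using assms unfolding set_borel_measurable_def by measurable
  also have "(\<lambda>x. (indicator S x *\<^sub>R f x) \<bullet> (indicator S x *\<^sub>R h x)) = (\<lambda>x. indicator S x *\<^sub>R (f x \<bullet> h x))"
    by (auto simp: fun_eq_iff indicator_def)
  finally show ?thesis by (simp add: set_borel_measurable_def)
qed

context affine_bij
begin

abbreviation \<Omega> :: "point set" where "\<Omega> \<equiv> T ` unit_square"

lemma ip_T:
  fixes f h :: "point \<Rightarrow> 'b::euclidean_space"
  assumes "square_integrable_on f \<Omega>" "square_integrable_on h \<Omega>"
  shows "ip unit_measure (\<lambda>x. f (T x)) (\<lambda>x. h (T x)) = \<kappa> * (LINT y:\<Omega>|lborel. f y \<bullet> h y)"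
  using integral_T(3)[OF set_borel_measurable_inner, of unit_square f h] assms
  by (simp add: ip_def integral_unit_measure square_integrable_on_def)

lemma H1_T: "H1_function \<Omega> u g \<Longrightarrow> H1 (\<lambda>x. u (T x)) (\<lambda>x. adjoint L (g (T x)))"
  by (rule H1_pull[OF open_unit_square])

lemma H1_function_const: "H1_function \<Omega> (\<lambda>x. c) (\<lambda>x. 0)"
proof -
  have "adjoint K 0 = 0" by (intro linear_0 adjoint_linear lin)
  then show ?thesis using H1_push[OF open_unit_square H1_const[of c]] by simp
qed

text \<open>Turns vanishing almost everywhere on the image domain, the notion behind independence,
  into a statement about norms on the square.\<close>

lemma ae_zero_iff:
  assumes w: "square_integrable_on w \<Omega>"
  shows "(AE x in lborel. x \<in> \<Omega> \<longrightarrow> w x = 0) \<longleftrightarrow> nsq unit_measure (\<lambda>x. w (T x)) = 0"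
proof -
  have i: "integrable lborel (\<lambda>x. indicator \<Omega> x *\<^sub>R (norm (w x))\<^sup>2)"
    using w by (simp add: square_integrable_on_def set_integrable_def)
  have "(AE x in lborel. x \<in> \<Omega> \<longrightarrow> w x = 0) \<longleftrightarrow> (AE x in lborel. indicator \<Omega> x *\<^sub>R (norm (w x))\<^sup>2 = 0)"
    by (intro AE_cong) (auto simp: indicator_def)
  also have "\<dots> \<longleftrightarrow> (LINT x:\<Omega>|lborel. (norm (w x))\<^sup>2) = 0"
    unfolding set_lebesgue_integral_def
    by (subst integral_nonneg_eq_0_iff_AE[OF i]) auto
  also have "\<dots> \<longleftrightarrow> nsq unit_measure (\<lambda>x. w (T x)) = 0"
    using ip_T[OF w w] \<kappa>(1) by (simp add: nsq_eq_ip power2_norm_eq_inner)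
  finally show ?thesis .
qed

text \<open>The constant and the transported minimiser are independent weak solutions with
  eigenvalues 0 and \<mu>. The number itself is the energy of the first cosine mode and an upper
  bound for \<mu>, in general not an eigenvalue.\<close>

lemma first_cosine_bound: "pi\<^sup>2 * (norm (adjoint K (1, 0)))\<^sup>2 \<in> eigenvalue_bounds 2 \<Omega>"
proof -
  have A: "linear (adjoint K)" using lin by (simp add: adjoint_linear)
  have inj: "inj (adjoint K)" by (metis adjoint_LK injI)
  obtain u g \<mu> where u: "H1 u g" "(LINT x|unit_measure. u x) = 0" "nsq unit_measure u = 1"
      "\<mu> \<le> pi\<^sup>2 * (norm (adjoint K (1, 0)))\<^sup>2"
    and EL: "\<And>v h. H1 v h \<Longrightarrow> ip unit_measure (\<lambda>x. adjoint K (g x)) (\<lambda>x. adjoint K (h x)) = \<mu> * ip unit_measure u v"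
    using exists_second_eigenfunction[OF A inj] by blast
  define uu where "uu = (\<lambda>y. u (T' y))"
  define gg where "gg = (\<lambda>y. adjoint K (g (T' y)))"
  have H: "H1_function \<Omega> uu gg"
    unfolding uu_def gg_def by (rule H1_push[OF open_unit_square u(1)])
  have sol1: "weak_Neumann_solution \<Omega> \<mu> uu"
    unfolding weak_Neumann_solution_def
  proof (rule exI[of _ gg], intro conjI allI impI)
    show "H1_function \<Omega> uu gg" by (rule H)
    fix v h assume V: "H1_function \<Omega> v h"
    \<comment> \<open>Gradients on the square are adjoints applied to gradients on the image, so
      \<open>adjoint K\<close> recovers the latter and the transported form is the ordinary
      Dirichlet form.\<close>
    have "ip unit_measure (\<lambda>x. gg (T x)) (\<lambda>x. h (T x)) = \<mu> * ip unit_measure (\<lambda>x. uu (T x)) (\<lambda>x. v (T x))"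
      using EL[OF H1_T[OF V]] by (simp add: gg_def uu_def adjoint_KL)
    then have "\<kappa> * (LINT x:\<Omega>|lborel. gg x \<bullet> h x) = \<kappa> * (\<mu> * (LINT x:\<Omega>|lborel. uu x * v x))"
      using H V by (simp add: ip_T H1_function_def)
    then show "(LINT x:\<Omega>|lborel. gg x \<bullet> h x) = \<mu> * (LINT x:\<Omega>|lborel. uu x * v x)"
      using \<kappa>(1) by simp
  qed
  have sol0: "weak_Neumann_solution \<Omega> 0 (\<lambda>x. 1)"
    unfolding weak_Neumann_solution_def
    by (intro exI[of _ "\<lambda>x. 0"] conjI allI impI H1_function_const) (simp add: set_lebesgue_integral_def)
  define w where "w i = (if i = 0 then (\<lambda>x. 1) else uu)" for i :: nat
  define m where "m i = (if i = 0 then 0 else \<mu>)" for i :: nat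
  have nn: "0 \<le> pi\<^sup>2 * (norm (adjoint K (1, 0)))\<^sup>2" by simp
  have "ae_independent \<Omega> 2 w"
    unfolding ae_independent_def
  proof (intro allI impI)
    fix c :: "nat \<Rightarrow> real" and i :: nat
    assume ae: "AE x in lborel. x \<in> \<Omega> \<longrightarrow> (\<Sum>i<2. c i * w i x) = 0" and i: "i < 2"
    have S: "(\<Sum>i<2. c i * w i x) = c 0 + c 1 * uu x" for x
      by (simp add: w_def numeral_2_eq_2)
    have sq: "square_integrable_on (\<lambda>x. c 0 + c 1 * uu x) \<Omega>"
    proof -
      have "square_integrable_on (\<lambda>y. (\<lambda>x. c 0 + c 1 * u x) (T' y)) \<Omega>"
        using H1_push[OF open_unit_square H1_add_scale[OF H1_const u(1)]]
        by (simp add: H1_function_def)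
      then show ?thesis by (simp add: uu_def)
    qed
    have "nsq unit_measure (\<lambda>x. c 0 + c 1 * uu (T x)) = 0"
      using ae unfolding S using ae_zero_iff[OF sq] by simp
    then have z: "nsq unit_measure (\<lambda>x. c 0 + c 1 * u x) = 0" by (simp add: uu_def)
    have c: "L2 unit_measure (\<lambda>x. c 0)" using H1_L2[OF H1_const] by simp
    have "ip unit_measure (\<lambda>x. c 0) (\<lambda>x. c 1 *\<^sub>R u x) = 0"
      unfolding ip_scaleR_right using u(2) by (simp add: ip_def)
    moreover have "nsq unit_measure (\<lambda>x. c 0) = (c 0)\<^sup>2" by (simp add: nsq_def)
    \<comment> \<open>Pythagoras: u has mean zero and is thus orthogonal to the constants.\<close>
    ultimately have "(c 0)\<^sup>2 + (c 1)\<^sup>2 = 0"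
      using z nsq_add[OF c L2_scaleR[OF H1_L2(1)[OF u(1)], of "c 1"]] u(3) nsq_scaleR[of unit_measure "c 1" u] by simp
    then have "c 0 = 0" "c 1 = 0" by (simp_all add: sum_power2_eq_zero_iff)
    moreover have "i = 0 \<or> i = 1" using i by auto
    ultimately show "c i = 0" by auto
  qed
  moreover have "weak_Neumann_solution \<Omega> (m i) (w i) \<and> m i \<le> pi\<^sup>2 * (norm (adjoint K (1, 0)))\<^sup>2" for i
    using sol0 sol1 nn u(4) by (simp add: w_def m_def)
  ultimately show ?thesis unfolding eigenvalue_bounds_def by blast
qed

text \<open>Testing a weak solution with itself equates its energy with \<mu> times its squared
  norm. This bounds the set below, without which its infimum would be meaningless.\<close>

lemma eigenvalue_bound_nonneg:
  assumes "\<Lambda> \<in> eigenvalue_bounds 2 \<Omega>"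
  shows "0 \<le> \<Lambda>"
proof -
  obtain u \<mu> where ind: "ae_independent \<Omega> 2 u" and sol: "weak_Neumann_solution \<Omega> (\<mu> 0) (u 0)" "\<mu> 0 \<le> \<Lambda>"
    using assms unfolding eigenvalue_bounds_def by fastforce
  obtain g where H: "H1_function \<Omega> (u 0) g"
    and eq: "(LINT x:\<Omega>|lborel. g x \<bullet> g x) = \<mu> 0 * (LINT x:\<Omega>|lborel. u 0 x * u 0 x)"
    using sol(1) unfolding weak_Neumann_solution_def by blast
  have sq: "square_integrable_on (u 0) \<Omega>" "square_integrable_on g \<Omega>" using H by (auto simp: H1_function_def)
  have "nsq unit_measure (\<lambda>x. u 0 (T x)) \<noteq> 0"
  proof
    assume "nsq unit_measure (\<lambda>x. u 0 (T x)) = 0"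
    then have "AE x in lborel. x \<in> \<Omega> \<longrightarrow> u 0 x = 0" by (simp only: ae_zero_iff[OF sq(1)])
    \<comment> \<open>The coefficients (1, 0): a null function as first member contradicts
      independence.\<close>
    moreover define c where "c i = (if i = 0 then 1 else 0 :: real)" for i :: nat
    moreover have "(\<Sum>i<2. c i * u i x) = u 0 x" for x by (simp add: c_def numeral_2_eq_2)
    ultimately have "AE x in lborel. x \<in> \<Omega> \<longrightarrow> (\<Sum>i<2. c i * u i x) = 0" by simp
    then have "\<forall>i<2. c i = 0" using ind unfolding ae_independent_def by blast
    then have "c 0 = 0" by simp
    then show False by (simp add: c_def)
  qed
  then have "0 < nsq unit_measure (\<lambda>x. u 0 (T x))" using nsq_nonneg[of unit_measure "\<lambda>x. u 0 (T x)"] by simp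
  moreover have "nsq unit_measure (\<lambda>x. g (T x)) = \<mu> 0 * nsq unit_measure (\<lambda>x. u 0 (T x))"
    using eq ip_T[OF sq(1) sq(1)] ip_T[OF sq(2) sq(2)] by (simp add: nsq_eq_ip)
  ultimately have "0 \<le> \<mu> 0"
    using nsq_nonneg[of unit_measure "\<lambda>x. g (T x)"] by (simp add: zero_le_mult_iff)
  then show ?thesis using sol(2) by simp
qed

lemma Neumann_eigenvalue_upper: "Neumann_eigenvalue 2 \<Omega> \<le> pi\<^sup>2 * (norm (adjoint K (1, 0)))\<^sup>2"
  unfolding Neumann_eigenvalue_eq
  using eigenvalue_bound_nonneg by (intro cInf_lower first_cosine_bound bdd_belowI[of _ 0])

text \<open>The hypothesis \<open>conf\<close> says that gradients are scaled uniformly by s, so the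
  energy on the square is s^2 times the transported one and Poincare applies with s^2 \<mu> < pi^2.
  Being constant almost everywhere is expressed by a vanishing norm.\<close>

lemma small_eigenvalue_imp_const:
  assumes conf: "\<And>z. norm (adjoint L z) = s * norm z" and s: "s > 0"
    and sol: "weak_Neumann_solution \<Omega> \<mu> u" and \<mu>: "\<mu> < pi\<^sup>2 / s\<^sup>2"
  shows "\<exists>m. nsq unit_measure (\<lambda>x. u (T x) - m) = 0"
proof -
  obtain g where H: "H1_function \<Omega> u g"
    and eq: "\<And>v h. H1_function \<Omega> v h \<Longrightarrow>
      (LINT x:\<Omega>|lborel. g x \<bullet> h x) = \<mu> * (LINT x:\<Omega>|lborel. u x * v x)"
    using sol unfolding weak_Neumann_solution_def by blast
  have sq: "square_integrable_on u \<Omega>" "square_integrable_on g \<Omega>" using H by (auto simp: H1_function_def)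
  let ?u = "\<lambda>x. u (T x)"
  let ?g = "\<lambda>x. adjoint L (g (T x))"
  have HU: "H1 ?u ?g" by (rule H1_T[OF H])
  have e1: "nsq unit_measure (\<lambda>x. g (T x)) = \<mu> * nsq unit_measure ?u"
    using eq[OF H] ip_T[OF sq(1) sq(1)] ip_T[OF sq(2) sq(2)] by (simp add: nsq_eq_ip)
  have "nsq unit_measure ?g = s\<^sup>2 * nsq unit_measure (\<lambda>x. g (T x))"
    unfolding nsq_def conf by (simp add: power_mult_distrib)
  then have e2: "nsq unit_measure ?g = s\<^sup>2 * \<mu> * nsq unit_measure ?u" using e1 by simp
  have sq1: "square_integrable_on (\<lambda>x. 1 :: real) \<Omega>"
    using H1_function_const[of 1] by (simp add: H1_function_def)
  \<comment> \<open>Testing with the constant 1 leaves two cases: \<mu> = 0, where the energy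
    vanishes, or mean zero, where Poincare applies to the solution itself.\<close>
  have e3: "\<mu> * (LINT x|unit_measure. ?u x) = 0"
    using eq[OF H1_function_const[of 1]] ip_T[OF sq(1) sq1]
    by (auto simp: ip_def set_lebesgue_integral_def)
  have sm: "s\<^sup>2 * \<mu> < pi\<^sup>2" using \<mu> s by (simp add: field_simps)
  define m where "m = (LINT x|unit_measure. ?u x)"
  have HV: "H1 (\<lambda>x. ?u x + (- m) * 1) (\<lambda>x. ?g x)"
    using H1_add_scale[OF HU H1_const[of 1], of "- m"] by simp
  have iu: "integrable unit_measure ?u" using H1_L2(1)[OF HU] by (rule L2_integrable[OF finite_measure_unit_measure])
  have "(LINT x|unit_measure. ?u x + (- m) * 1) = 0"
    using iu finite_measure_unit_measure by (subst Bochner_Integration.integral_add) (auto simp: m_def finite_measure.integrable_const)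
  from Poincare[OF HV this] have P: "pi\<^sup>2 * nsq unit_measure (\<lambda>x. ?u x - m) \<le> s\<^sup>2 * \<mu> * nsq unit_measure ?u"
    unfolding e2 by simp
  have "nsq unit_measure (\<lambda>x. ?u x - m) = 0"
  proof (cases "\<mu> = 0")
    case True
    then have "pi\<^sup>2 * nsq unit_measure (\<lambda>x. ?u x - m) \<le> 0" using P by simp
    then have "nsq unit_measure (\<lambda>x. ?u x - m) \<le> 0" by (simp add: mult_le_0_iff)
    then show ?thesis using nsq_nonneg[of unit_measure "\<lambda>x. ?u x - m"] by simp
  next
    case False
    then have m0: "m = 0" using e3 by (simp add: m_def)
    show ?thesis
    proof (rule ccontr)
      assume "nsq unit_measure (\<lambda>x. ?u x - m) \<noteq> 0"
      then have "0 < nsq unit_measure ?u" using nsq_nonneg[of unit_measure ?u] m0 by simp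
      then have "s\<^sup>2 * \<mu> * nsq unit_measure ?u < pi\<^sup>2 * nsq unit_measure ?u" using sm by simp
      then show False using P m0 by simp
    qed
  qed
  then show ?thesis by blast
qed

text \<open>If both eigenvalues were below the threshold, both solutions would be constant almost
  everywhere and hence dependent.\<close>

lemma Neumann_eigenvalue_lower:
  assumes conf: "\<And>z. norm (adjoint L z) = s * norm z" and s: "s > 0"
  shows "pi\<^sup>2 / s\<^sup>2 \<le> Neumann_eigenvalue 2 \<Omega>"
  unfolding Neumann_eigenvalue_eq
proof (rule cInf_greatest)
  show "eigenvalue_bounds 2 \<Omega> \<noteq> {}" using first_cosine_bound by blast
  fix \<Lambda> assume "\<Lambda> \<in> eigenvalue_bounds 2 \<Omega>"
  then obtain u \<mu> where ind: "ae_independent \<Omega> 2 u"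
    and sol: "\<And>i. i < 2 \<Longrightarrow> weak_Neumann_solution \<Omega> (\<mu> i) (u i)" "\<And>i. i < 2 \<Longrightarrow> \<mu> i \<le> \<Lambda>"
    unfolding eigenvalue_bounds_def by blast
  show "pi\<^sup>2 / s\<^sup>2 \<le> \<Lambda>"
  proof (rule ccontr)
    assume "\<not> pi\<^sup>2 / s\<^sup>2 \<le> \<Lambda>"
    then have lt: "\<mu> i < pi\<^sup>2 / s\<^sup>2" if "i < 2" for i using sol(2)[OF that] by linarith
    obtain m0 m1 where m: "nsq unit_measure (\<lambda>x. u 0 (T x) - m0) = 0" "nsq unit_measure (\<lambda>x. u 1 (T x) - m1) = 0"
      using small_eigenvalue_imp_const[OF conf s sol(1) lt, of 0]
        small_eigenvalue_imp_const[OF conf s sol(1) lt, of 1] by auto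
    \<comment> \<open>A nontrivial relation between two numbers: (m1, - m0), or (1, 0) when both
      numbers vanish.\<close>
    obtain c0 c1 :: real where c: "c0 * m0 + c1 * m1 = 0" "c0 \<noteq> 0 \<or> c1 \<noteq> 0"
    proof (cases "m0 = 0 \<and> m1 = 0")
      case True
      then show thesis using that[of 1 0] by simp
    next
      case False
      then show thesis using that[of m1 "- m0"] by (auto simp: mult.commute)
    qed
    have sq: "square_integrable_on (u 0) \<Omega>" "square_integrable_on (u 1) \<Omega>"
      using sol(1)[of 0] sol(1)[of 1] by (auto simp: weak_Neumann_solution_def H1_function_def)
    have l: "L2 unit_measure (\<lambda>x. u 0 (T x))" "L2 unit_measure (\<lambda>x. u 1 (T x))"
      using square_integrable_pull[OF sq(1)] square_integrable_pull[OF sq(2)]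
      by (simp_all add: square_integrable_iff_L2)
    have k: "L2 unit_measure (\<lambda>x. k)" for k :: real using H1_L2(1)[OF H1_const] .
    have "AE x in unit_measure. u 0 (T x) - m0 = 0" "AE x in unit_measure. u 1 (T x) - m1 = 0"
      by (rule nsq_eq_0_AE[OF L2_diff[OF l(1) k] m(1)]) (rule nsq_eq_0_AE[OF L2_diff[OF l(2) k] m(2)])
    then have "AE x in unit_measure. c0 * u 0 (T x) + c1 * u 1 (T x) = 0"
      by eventually_elim (use c(1) in simp)
    then have z: "nsq unit_measure (\<lambda>x. c0 * u 0 (T x) + c1 * u 1 (T x)) = 0"
      unfolding nsq_def by (intro integral_eq_zero_AE) (auto elim: eventually_mono)
    have "\<Omega> \<in> sets borel" using open_T[OF open_unit_square] by simp
    then have "square_integrable_on (\<lambda>x. c0 * u 0 x + c1 * u 1 x) \<Omega>"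
      using sq by (simp add: square_integrable_on_iff_L2 L2_add L2_cmult)
    from ae_zero_iff[OF this] z have ae: "AE x in lborel. x \<in> \<Omega> \<longrightarrow> c0 * u 0 x + c1 * u 1 x = 0" by simp
    define c where "c i = (if i = 0 then c0 else c1)" for i :: nat
    have "(\<Sum>i<2. c i * u i x) = c0 * u 0 x + c1 * u 1 x" for x by (simp add: c_def numeral_2_eq_2)
    then have "\<forall>i<2. c i = 0" using ind ae unfolding ae_independent_def by simp
    then have "c 0 = 0" "c 1 = 0" by auto
    then show False using c(2) by (simp add: c_def)
  qed
qed

end

section \<open>Geometry of parallelograms and squares\<close>

definition cross :: "point \<Rightarrow> point \<Rightarrow> real" where
  "cross v w = fst v * snd w - snd v * fst w"

text \<open>Lagrange's identity; it links the area to the angle.\<close>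

lemma cross_sq: "(cross v w)\<^sup>2 = (norm v)\<^sup>2 * (norm w)\<^sup>2 - (v \<bullet> w)\<^sup>2"
  by (simp add: cross_def norm_prod_def inner_prod_def power2_eq_square algebra_simps)

definition parallelogram_region :: "point \<Rightarrow> point \<Rightarrow> point \<Rightarrow> point set" where
  "parallelogram_region p v w = (\<lambda>x. p + (fst x *\<^sub>R v + snd x *\<^sub>R w)) ` unit_square"

lemma parallelogram_region_swap: "parallelogram_region p v w = parallelogram_region p w v"
proof -
  have "parallelogram_region p v w \<subseteq> parallelogram_region p w v" for v w
  proof
    fix y assume "y \<in> parallelogram_region p v w"
    then obtain x where "x \<in> unit_square" "y = p + (fst x *\<^sub>R v + snd x *\<^sub>R w)" by (auto simp: parallelogram_region_def)
    then show "y \<in> parallelogram_region p w v"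
      unfolding parallelogram_region_def by (intro image_eqI[of _ _ "(snd x, fst x)"]) (auto simp: unit_square_def)
  qed
  then show ?thesis by blast
qed

text \<open>Cramer's rule for the coordinates of y in the basis v, w.\<close>

definition coords :: "point \<Rightarrow> point \<Rightarrow> point \<Rightarrow> point" where
  "coords v w y = (cross y w / cross v w, cross v y / cross v w)"

lemma affine_bij_parallelogram_region:
  assumes "cross v w \<noteq> 0"
  shows "affine_bij (\<lambda>x. fst x *\<^sub>R v + snd x *\<^sub>R w) (coords v w)"
proof (rule affine_bij.intro)
  show "linear (\<lambda>x. fst x *\<^sub>R v + snd x *\<^sub>R w)"
    by (simp add: linear_iff algebra_simps)
  show "linear (coords v w)"
    by (simp add: linear_iff coords_def cross_def add_divide_distrib diff_divide_distrib algebra_simps)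
  fix x :: point
  have "cross (fst x *\<^sub>R v + snd x *\<^sub>R w) w = fst x * cross v w"
    "cross v (fst x *\<^sub>R v + snd x *\<^sub>R w) = snd x * cross v w"
    by (simp_all add: cross_def algebra_simps)
  then show "coords v w (fst x *\<^sub>R v + snd x *\<^sub>R w) = x"
    using assms by (simp add: coords_def)
  have "cross x w *\<^sub>R v + cross v x *\<^sub>R w = cross v w *\<^sub>R x"
    by (simp add: cross_def prod_eq_iff algebra_simps)
  then have "(1 / cross v w) *\<^sub>R (cross x w *\<^sub>R v + cross v x *\<^sub>R w) = x"
    using assms by simp
  then show "fst (coords v w x) *\<^sub>R v + snd (coords v w x) *\<^sub>R w = x"
    by (simp add: coords_def scaleR_add_right)
qed

text \<open>The image of (1, 0) under the adjoint is the gradient of the affine coordinate along v.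
  Its length is the reciprocal of the distance between the two sides parallel to w.\<close>

lemma Neumann_parallelogram_region_upper:
  assumes c: "cross v w \<noteq> 0"
  shows "Neumann_eigenvalue 2 (parallelogram_region p v w) \<le> pi\<^sup>2 * ((norm w)\<^sup>2 / (cross v w)\<^sup>2)"
proof -
  interpret affine_bij p "\<lambda>x. fst x *\<^sub>R v + snd x *\<^sub>R w" "coords v w" by (rule affine_bij_parallelogram_region[OF c])
  \<comment> \<open>The vector w turned by a right angle, divided by the determinant: orthogonal to
    w and with inner product 1 with v.\<close>
  define z where "z = (1 / cross v w) *\<^sub>R (snd w, - fst w)"
  have "x \<bullet> adjoint (coords v w) (1, 0) = x \<bullet> z" for x
    unfolding adjoint_works[OF lin(2)]
    by (simp add: coords_def z_def inner_prod_def cross_def diff_divide_distrib mult.commute)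
  then have "adjoint (coords v w) (1, 0) = z" using vector_eq_ldot by blast
  moreover have "(norm z)\<^sup>2 = (norm w)\<^sup>2 / (cross v w)\<^sup>2"
    by (simp add: z_def norm_prod_def power_mult_distrib power_divide add_divide_distrib)
  moreover have "\<Omega> = parallelogram_region p v w" by (simp add: parallelogram_region_def T_def)
  ultimately show ?thesis using Neumann_eigenvalue_upper by simp
qed

text \<open>Orthogonal spanning vectors of equal length make the linear part s times an isometry.
  Its adjoint is therefore s^2 times its inverse and scales all norms by s.\<close>

lemma Neumann_square_lower:
  assumes vw: "v \<bullet> w = 0" "norm v = s" "norm w = s" and s: "s > 0"
  shows "pi\<^sup>2 / s\<^sup>2 \<le> Neumann_eigenvalue 2 (parallelogram_region p v w)"
proof -
  have c2: "(cross v w)\<^sup>2 = s\<^sup>2 * s\<^sup>2" unfolding cross_sq vw by simp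
  then have c: "cross v w \<noteq> 0" using s by auto
  interpret affine_bij p "\<lambda>x. fst x *\<^sub>R v + snd x *\<^sub>R w" "coords v w" by (rule affine_bij_parallelogram_region[OF c])
  let ?L = "\<lambda>x. fst x *\<^sub>R v + snd x *\<^sub>R w"
  have iso: "?L x \<bullet> ?L y = s\<^sup>2 * (x \<bullet> y)" for x y
  proof -
    have "v \<bullet> v = s\<^sup>2" "w \<bullet> w = s\<^sup>2" "w \<bullet> v = 0" using vw by (auto simp: dot_square_norm inner_commute)
    moreover have "x \<bullet> y = fst x * fst y + snd x * snd y" by (simp add: inner_prod_def)
    ultimately show ?thesis
      by (simp add: inner_add_left inner_add_right vw algebra_simps)
  qed
  have "norm (adjoint ?L z) = s * norm z" for z
  proof -
    have "x \<bullet> adjoint ?L z = x \<bullet> (s\<^sup>2 *\<^sub>R coords v w z)" for x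
      using iso[of x "coords v w z"] unfolding adjoint_works[OF lin(1)] LK by simp
    then have "adjoint ?L z = s\<^sup>2 *\<^sub>R coords v w z" using vector_eq_ldot by blast
    moreover have "(norm z)\<^sup>2 = s\<^sup>2 * (norm (coords v w z))\<^sup>2"
      using iso[of "coords v w z" "coords v w z"] unfolding LK power2_norm_eq_inner .
    moreover have "(norm (s\<^sup>2 *\<^sub>R coords v w z))\<^sup>2 = s\<^sup>2 * (s\<^sup>2 * (norm (coords v w z))\<^sup>2)"
      by (simp add: power_mult_distrib power2_eq_square)
    ultimately have "(norm (adjoint ?L z))\<^sup>2 = (s * norm z)\<^sup>2"
      by (simp only: power_mult_distrib)
    then show ?thesis using s by (simp add: power2_eq_iff_nonneg)
  qed
  from Neumann_eigenvalue_lower[OF this s] show ?thesis by (simp add: parallelogram_region_def T_def)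
qed

text \<open>Convex hull and interior commute with an injective affine map of the plane, so only the
  unit square and its corners have to be treated.\<close>

lemma interior_convex_hull_parallelogram_region:
  assumes c: "cross v w \<noteq> 0"
  shows "interior (convex hull {p, p + v, p + v + w, p + w}) = parallelogram_region p v w"
proof -
  interpret affine_bij p "\<lambda>x. fst x *\<^sub>R v + snd x *\<^sub>R w" "coords v w" by (rule affine_bij_parallelogram_region[OF c])
  let ?L = "\<lambda>x. fst x *\<^sub>R v + snd x *\<^sub>R w"
  have h: "convex hull ({0, 1} \<times> {0, 1}) = closed_square"
    unfolding convex_hull_Times by (simp flip: segment_convex_hull add: closed_segment_eq_real_ivl)
  have "?L ` closed_square = convex hull (?L ` ({0, 1} \<times> {0, 1}))"
    unfolding h[symmetric] by (rule convex_hull_linear_image[OF lin(1)])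
  moreover have "{p, p + v, p + v + w, p + w} = (+) p ` ?L ` ({0, 1} \<times> {0, 1})"
    by (auto simp: image_iff algebra_simps)
  ultimately have "convex hull {p, p + v, p + v + w, p + w} = (+) p ` ?L ` closed_square"
    by (simp only: convex_hull_translation)
  then have "interior (convex hull {p, p + v, p + v + w, p + w}) = (+) p ` ?L ` interior closed_square"
    by (simp only: interior_translation interior_injective_linear_image[OF lin(1) inj_L])
  also have "interior closed_square = unit_square"
    by (simp add: interior_Times unit_square_def)
  finally show ?thesis by (simp add: parallelogram_region_def image_image)
qed

lemma parallelogram_vectors:
  assumes "parallelogram A B C D"
  shows "cross (B - A) (D - A) \<noteq> 0"
    and "interior (convex hull (set [A, B, C, D])) = parallelogram_region A (B - A) (D - A)"
    and "polygon_perimeter [A, B, C, D] = 2 * (norm (B - A) + norm (D - A))"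
    and "dist A B = norm (B - A)" and "dist B C = norm (D - A)"
proof -
  have C: "C = A + (B - A) + (D - A)" and nc: "\<not> collinear {A, B, D}"
    using assms by (auto simp: parallelogram_def algebra_simps)
  show c: "cross (B - A) (D - A) \<noteq> 0"
  proof
    assume "cross (B - A) (D - A) = 0"
    \<comment> \<open>Vanishing area is the equality case of Cauchy-Schwarz, that is,
      collinearity.\<close>
    then have "\<bar>(B - A) \<bullet> (D - A)\<bar>\<^sup>2 = (norm (B - A) * norm (D - A))\<^sup>2"
      using cross_sq[of "B - A" "D - A"] by (simp add: power_mult_distrib)
    then have "\<bar>(B - A) \<bullet> (D - A)\<bar> = norm (B - A) * norm (D - A)"
      by (rule power2_eq_imp_eq) simp_all
    then have "collinear {0, B - A, D - A}" by (simp add: norm_cauchy_schwarz_equal)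
    then have "collinear {B, A, D}" by (subst collinear_3) simp
    then show False using nc by (simp add: insert_commute)
  qed
  show "interior (convex hull (set [A, B, C, D])) = parallelogram_region A (B - A) (D - A)"
    using interior_convex_hull_parallelogram_region[OF c, of A] by (simp add: C add.commute)
  show d: "dist A B = norm (B - A)" "dist B C = norm (D - A)"
    by (simp_all add: dist_norm C norm_minus_commute)
  have "dist C D = norm (B - A)" "dist D A = norm (D - A)"
    by (simp_all add: dist_norm C)
  then show "polygon_perimeter [A, B, C, D] = 2 * (norm (B - A) + norm (D - A))"
    using d by (simp add: polygon_perimeter_def lessThan_Suc)
qed

text \<open>Neighbouring angles are the arccosines of c and - c. They are supplementary and have the
  same sine, so it need not be decided which of them is the smaller one; Lagrange's identity does
  the rest.\<close>

lemma sin_smallest_angle: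
  assumes "parallelogram A B C D"
  shows "(sin (smallest_angle A B C D))\<^sup>2 * ((norm (B - A))\<^sup>2 * (norm (D - A))\<^sup>2) = (cross (B - A) (D - A))\<^sup>2"
    and "0 \<le> sin (smallest_angle A B C D)"
proof -
  define v where "v = B - A"
  define w where "w = D - A"
  define c where "c = (v \<bullet> w) / (norm v * norm w)"
  have e: "D - A = w" "B - A = v" "A - B = - v" "C - B = w" "B - C = - w" "D - C = - v" "C - D = v" "A - D = - w"
    using assms by (auto simp: parallelogram_def v_def w_def algebra_simps)
  have a: "angle_at D A B = arccos c" "angle_at A B C = arccos (- c)"
    "angle_at B C D = arccos c" "angle_at C D A = arccos (- c)"
    unfolding angle_at_def e c_def by (simp_all add: inner_commute mult.commute)
  have cr: "cross v w \<noteq> 0" using parallelogram_vectors(1)[OF assms] by (simp add: v_def w_def)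
  then have vw: "v \<noteq> 0" "w \<noteq> 0" by (auto simp: cross_def)
  have c1: "\<bar>c\<bar> \<le> 1"
    using Cauchy_Schwarz_ineq2[of v w] vw by (simp add: c_def abs_mult)
  have "smallest_angle A B C D \<in> {arccos c, arccos (- c)}"
    unfolding smallest_angle_def a using Min_in[of "{arccos c, arccos (- c)}"] by (simp add: insert_commute)
  then have s: "sin (smallest_angle A B C D) = sqrt (1 - c\<^sup>2)"
    using c1 sin_arccos[of c] sin_arccos[of "- c"] by (auto simp: abs_le_iff)
  have c2: "c\<^sup>2 \<le> 1" using c1 by (simp add: abs_square_le_1)
  show "0 \<le> sin (smallest_angle A B C D)" unfolding s using c2 by simp
  have "(sin (smallest_angle A B C D))\<^sup>2 = 1 - c\<^sup>2" unfolding s using c2 by simp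
  then have "(sin (smallest_angle A B C D))\<^sup>2 * ((norm v)\<^sup>2 * (norm w)\<^sup>2) = (cross v w)\<^sup>2"
    unfolding cross_sq c_def using vw by (simp add: power_divide power_mult_distrib field_simps)
  then show "(sin (smallest_angle A B C D))\<^sup>2 * ((norm (B - A))\<^sup>2 * (norm (D - A))\<^sup>2) = (cross (B - A) (D - A))\<^sup>2"
    by (simp add: v_def w_def)
qed

text \<open>The eigenvalue bound pi^2 / s^2 meets the squared perimeter (4 s)^2.\<close>

lemma M2_square_lower:
  assumes "is_square E F G H"
  shows "16 * pi\<^sup>2 \<le> M2 [E, F, G, H]"
proof -
  have P: "parallelogram E F G H" and d: "dist E F = dist F G" and a: "angle_at H E F = pi / 2"
    using assms by (auto simp: is_square_def)
  note pv = parallelogram_vectors[OF P]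
  define v where "v = F - E"
  define w where "w = H - E"
  define s where "s = norm v"
  have cr: "cross v w \<noteq> 0" using pv(1) by (simp add: v_def w_def)
  then have vw: "v \<noteq> 0" "w \<noteq> 0" by (auto simp: cross_def)
  have nw: "norm w = s" using pv(4,5) d by (simp add: v_def w_def s_def)
  have s: "s > 0" using vw by (simp add: s_def)
  \<comment> \<open>Cauchy-Schwarz keeps the quotient in the range where \<open>cos\<close> inverts
    \<open>arccos\<close>, so the right angle means orthogonality.\<close>
  have "v \<bullet> w / (norm w * norm v) = cos (arccos (w \<bullet> v / (norm w * norm v)))"
    using Cauchy_Schwarz_ineq2[of w v] vw
    by (subst cos_arccos) (auto simp: inner_commute field_simps abs_le_iff)
  also have "arccos (w \<bullet> v / (norm w * norm v)) = pi / 2"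
    using a by (simp only: angle_at_def v_def w_def)
  also have "cos (pi / 2) = 0" by simp
  finally have o: "v \<bullet> w = 0" using vw by simp
  have "pi\<^sup>2 / s\<^sup>2 \<le> Neumann_eigenvalue 2 (parallelogram_region E v w)"
    using o s_def[symmetric] nw s by (rule Neumann_square_lower)
  then have "pi\<^sup>2 / s\<^sup>2 * (2 * (s + s))\<^sup>2 \<le> Neumann_eigenvalue 2 (parallelogram_region E v w) * (2 * (s + s))\<^sup>2"
    by (rule mult_right_mono) simp
  also have "\<dots> = M2 [E, F, G, H]"
    unfolding M2_def pv(2,3) using nw by (simp add: v_def w_def s_def)
  also have "pi\<^sup>2 / s\<^sup>2 * (2 * (s + s))\<^sup>2 = 16 * pi\<^sup>2"
    using s by (simp add: power2_eq_square field_simps)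
  finally show ?thesis .
qed

theorem theorem2:
  fixes A B C D E F G H :: point and a b \<alpha> :: real
  assumes "parallelogram A B C D"
    and "\<alpha> = smallest_angle A B C D"
    and "{dist A B, dist B C} = {a, b}" and "a \<ge> b" and "b > 0"
    and "b / a \<le> 2 * sin \<alpha> - 1"
    and "is_square E F G H"
  shows "M2 [A, B, C, D] \<le> M2 [E, F, G, H]"
proof -
  note pv = parallelogram_vectors[OF assms(1)]
  define v where "v = B - A"
  define w where "w = D - A"
  have cr: "cross v w \<noteq> 0" using pv(1) by (simp add: v_def w_def)
  have crs: "(sin \<alpha>)\<^sup>2 * ((norm v)\<^sup>2 * (norm w)\<^sup>2) = (cross v w)\<^sup>2"
    using sin_smallest_angle(1)[OF assms(1)] assms(2) by (simp add: v_def w_def)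
  have a: "a > 0" using assms(4,5) by simp
  have "a + b \<le> a * (2 * sin \<alpha>)" using assms(6) a by (simp add: field_simps)
  then have ab: "(a + b)\<^sup>2 \<le> 4 * (a * sin \<alpha>)\<^sup>2"
    using power_mono[of "a + b" "a * (2 * sin \<alpha>)" 2] a assms(5) by (simp add: power_mult_distrib)
  \<comment> \<open>Positivity of sin \<alpha> comes from the inequality just derived, as a + b > 0;
    it allows (a sin \<alpha>)^2 to be cancelled at the end.\<close>
  have "0 < a * (2 * sin \<alpha>)" using \<open>a + b \<le> a * (2 * sin \<alpha>)\<close> a assms(5) by linarith
  then have sn: "0 < a * sin \<alpha>" by simp
  \<comment> \<open>The equality of sets leaves open which side has length a. In the second case the
    cosine has to vary along w, so the two vectors exchange their roles.\<close>
  have "(norm v = a \<and> norm w = b) \<or> (norm v = b \<and> norm w = a)"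
    using assms(3) unfolding pv(4,5) v_def w_def by (auto simp: doubleton_eq_iff)
  then have sum: "norm v + norm w = a + b"
    and N: "Neumann_eigenvalue 2 (parallelogram_region A v w) \<le> pi\<^sup>2 / (a * sin \<alpha>)\<^sup>2"
  proof (atomize (full), elim disjE conjE, goal_cases)
    case 1
    have "(norm w)\<^sup>2 / (cross v w)\<^sup>2 = 1 / (a * sin \<alpha>)\<^sup>2"
      unfolding crs[symmetric] 1 using assms(5) by (simp add: power_mult_distrib)
    then show ?case using 1 Neumann_parallelogram_region_upper[OF cr, of A] by simp
  next
    case 2
    have cr': "cross w v \<noteq> 0" "(cross w v)\<^sup>2 = (cross v w)\<^sup>2"
      using cr by (auto simp: cross_def power2_eq_square algebra_simps)
    have "(norm v)\<^sup>2 / (cross w v)\<^sup>2 = 1 / (a * sin \<alpha>)\<^sup>2"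
      unfolding cr'(2) crs[symmetric] 2 using assms(5) by (simp add: power_mult_distrib)
    then show ?case using 2 Neumann_parallelogram_region_upper[OF cr'(1), of A] parallelogram_region_swap[of A v w] by simp
  qed
  have "M2 [A, B, C, D] = Neumann_eigenvalue 2 (parallelogram_region A v w) * (2 * (a + b))\<^sup>2"
    unfolding M2_def pv(2,3) using sum by (simp add: v_def w_def)
  also have "\<dots> \<le> pi\<^sup>2 / (a * sin \<alpha>)\<^sup>2 * (2 * (a + b))\<^sup>2"
    using N by (rule mult_right_mono) simp
  also have "\<dots> = pi\<^sup>2 / (a * sin \<alpha>)\<^sup>2 * 4 * (a + b)\<^sup>2"
    by (simp only: power_mult_distrib[of 2]) simp
  also have "\<dots> \<le> pi\<^sup>2 / (a * sin \<alpha>)\<^sup>2 * 4 * (4 * (a * sin \<alpha>)\<^sup>2)"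
    using ab by (rule mult_left_mono) simp
  also have "\<dots> = 16 * pi\<^sup>2" using sn by auto
  also have "\<dots> \<le> M2 [E, F, G, H]" by (rule M2_square_lower[OF assms(7)])
  finally show ?thesis .
qed

end
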